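(* Let $X$ be a Hausdorff topological space and $\mu$ a $\sigma$-finite Borel measure on $X$. Let $\mathcal E$ be a nonlinear order preserving form on $L^2(\mu)$ for which $\mathcal E_e$ exists; assume $\mathcal E$ is reflexive, subcritical and satisfies the $\Delta_2$-condition, and that there exists an $\mathcal E$-excessive function $h\in D(\mathcal E_e)$ with $h>0$ a.e. For $A\subseteq X$ the following are equivalent: (i) $A$ is $\mathcal E$-exceptional; (ii) for all $\mathcal E$-excessive $\tilde h\in D(\mathcal E_e)$ with $\tilde h>0$ a.e. we have $\mathrm{cap}_{\tilde h}(A)=0$. If moreover $Nh$ is $\mathcal E$-excessive for each $N\in\mathbb N$, then these are equivalent to (iii) $\mathrm{cap}_h(A)=0$.
   Context: $L^0(\mu)$ carries local convergence in measure. A nonlinear order preserving form is a lower semicontinuous convex $\mathcal E\colon L^2(\mu)\to[0,\infty]$ with $\mathcal E(-f)=\mathcal E(f)$, $\mathcal E(0)=0$ and $\mathcal E(f+|g|)+\mathcal E(f-|g|)\le\mathcal E(f+g)+\mathcal E(f-g)$. $M(\mathcal E)=\{f:\lim_{\lambda\to0+}\mathcal E(\lambda f)=0\}$, $\|f\|_L=\inf\{\lambda>0:\mathcal E(\lambda^{-1}f)\le1\}$; reflexive: image of $M(\mathcal E)$ dense in the bidual of $(M(\mathcal E),\|\cdot\|_L)$. $\Delta_2$-condition: $\mathcal E(2f)\le K\mathcal E(f)$ for some $K$ and all $f$. $\mathcal E_e$: lower semicontinuous relaxation on $L^0(\mu)$ (local convergence in measure) of $\mathcal E$ extended by $+\infty$;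 $M(\mathcal E_e)$, $\|\cdot\|_{L_e}$ its modular space and Luxemburg seminorm. Resolvent $G_\alpha f$ minimizes $g\mapsto\mathcal E(g)+\frac\alpha2\|g-\alpha^{-1}f\|_2^2$, extended to nonnegative functions by monotone limits; $Gf=\lim_{\alpha\to0+}G_\alpha f$; subcritical: $Gf<\infty$ a.e. for some measurable $f>0$. A measurable $\tilde h\ge0$ is $\mathcal E$-excessive if $G_\alpha(\alpha\tilde h)\le\tilde h$ for all $\alpha>0$; for such $\tilde h$, $\mathrm{cap}_{\tilde h}(A)=\inf\{\mathcal E_e(f): f\in L^0(\mu),\ f\ge\tilde h$ a.e. on an open neighborhood of $A\}$. For $G\subseteq X$ and $\mathcal F\subseteq L^0(\mu)$, $\mathcal F_G=\{f\in\mathcal F: f=0$ on an open neighborhood of $X\setminus G\}$. An increasing sequence $(F_n)$ of closed sets is an $\mathcal E$-nest if $\bigcup_nM(\mathcal E_e)_{F_n}$ is $\|\cdot\|_{L_e}$-dense in $M(\mathcal E_e)$. $A$ is $\mathcal E$-exceptional if there is an $\mathcal E$-nest $(F_n)$ with $A\subseteq\bigcap_n(X\setminus F_n)$. *)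

theory Defs
  imports "HOL-Analysis.Analysis" "HOL-Probability.Probability"
begin

text \<open>Functions are represented by real-valued functions on the carrier; all notions
below are invariant under equality almost everywhere.  A form on L2 is represented by
a map E into [0,\<infinity>] which is \<infinity> outside L2 (the extension by \<infinity>).\<close>

definition L2 :: "'a measure \<Rightarrow> ('a \<Rightarrow> real) set" where
  "L2 M = {f. f \<in> borel_measurable M \<and> integrable M (\<lambda>x. (f x)\<^sup>2)}"

definition nonlinear_order_preserving_form ::
  "'a measure \<Rightarrow> (('a \<Rightarrow> real) \<Rightarrow> ennreal) \<Rightarrow> bool" where
  "nonlinear_order_preserving_form M E \<longleftrightarrow>
     (\<forall>f. f \<notin> L2 M \<longrightarrow> E f = \<infinity>) \<and>
     (\<forall>f\<in>L2 M. \<forall>g\<in>L2 M. (AE x in M. f x = g x) \<longrightarrow> E f = E g) \<and>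
     (\<forall>f\<in>L2 M. \<forall>fs. (\<forall>n. fs n \<in> L2 M) \<and>
         (\<lambda>n. integral\<^sup>L M (\<lambda>x. (fs n x - f x)\<^sup>2)) \<longlonglongrightarrow> 0
         \<longrightarrow> E f \<le> liminf (\<lambda>n. E (fs n))) \<and>
     (\<forall>f\<in>L2 M. \<forall>g\<in>L2 M. \<forall>t::real. 0 \<le> t \<and> t \<le> 1 \<longrightarrow>
         E (\<lambda>x. t * f x + (1 - t) * g x) \<le> ennreal t * E f + ennreal (1 - t) * E g) \<and>
     (\<forall>f. E (\<lambda>x. - f x) = E f) \<and>
     E (\<lambda>x. 0) = 0 \<and>
     (\<forall>f\<in>L2 M. \<forall>g\<in>L2 M.
         E (\<lambda>x. f x + \<bar>g x\<bar>) + E (\<lambda>x. f x - \<bar>g x\<bar>) \<le> E (\<lambda>x. f x + g x) + E (\<lambda>x. f x - g x))"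

definition modular_space :: "(('a \<Rightarrow> real) \<Rightarrow> ennreal) \<Rightarrow> ('a \<Rightarrow> real) set" where
  "modular_space E = {f. ((\<lambda>t::real. E (\<lambda>x. t * f x)) \<longlongrightarrow> 0) (at_right 0)}"

definition luxemburg :: "(('a \<Rightarrow> real) \<Rightarrow> ennreal) \<Rightarrow> ('a \<Rightarrow> real) \<Rightarrow> ennreal" where
  "luxemburg E f = Inf {ennreal l | l. l > 0 \<and> E (\<lambda>x. f x / l) \<le> 1}"

definition dual_space :: "(('a \<Rightarrow> real) \<Rightarrow> ennreal) \<Rightarrow> (('a \<Rightarrow> real) \<Rightarrow> real) set" where
  "dual_space E = {\<phi>.
     (\<forall>f\<in>modular_space E. \<forall>g\<in>modular_space E. \<forall>a b.
        \<phi> (\<lambda>x. a * f x + b * g x) = a * \<phi> f + b * \<phi> g) \<and>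
     (\<exists>C. \<forall>f\<in>modular_space E. \<bar>\<phi> f\<bar> \<le> C * enn2real (luxemburg E f)) \<and>
     (\<forall>f. f \<notin> modular_space E \<longrightarrow> \<phi> f = 0)}"

definition dual_norm :: "(('a \<Rightarrow> real) \<Rightarrow> ennreal) \<Rightarrow> (('a \<Rightarrow> real) \<Rightarrow> real) \<Rightarrow> real" where
  "dual_norm E \<phi> = Sup {\<bar>\<phi> f\<bar> | f. f \<in> modular_space E \<and> luxemburg E f \<le> 1}"

definition bidual_space ::
  "(('a \<Rightarrow> real) \<Rightarrow> ennreal) \<Rightarrow> ((('a \<Rightarrow> real) \<Rightarrow> real) \<Rightarrow> real) set" where
  "bidual_space E = {\<Phi>.
     (\<forall>\<phi>\<in>dual_space E. \<forall>\<psi>\<in>dual_space E. \<forall>a b.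
        \<Phi> (\<lambda>f. a * \<phi> f + b * \<psi> f) = a * \<Phi> \<phi> + b * \<Phi> \<psi>) \<and>
     (\<exists>C. \<forall>\<phi>\<in>dual_space E. \<bar>\<Phi> \<phi>\<bar> \<le> C * dual_norm E \<phi>) \<and>
     (\<forall>\<phi>. \<phi> \<notin> dual_space E \<longrightarrow> \<Phi> \<phi> = 0)}"

definition reflexive_form :: "(('a \<Rightarrow> real) \<Rightarrow> ennreal) \<Rightarrow> bool" where
  "reflexive_form E \<longleftrightarrow>
     (\<forall>\<Phi>\<in>bidual_space E. \<forall>\<epsilon>>0. \<exists>f\<in>modular_space E.
        \<forall>\<phi>\<in>dual_space E. \<bar>\<Phi> \<phi> - \<phi> f\<bar> \<le> \<epsilon> * dual_norm E \<phi>)"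

definition delta2_condition :: "(('a \<Rightarrow> real) \<Rightarrow> ennreal) \<Rightarrow> bool" where
  "delta2_condition E \<longleftrightarrow> (\<exists>K::real. \<forall>f. E (\<lambda>x. 2 * f x) \<le> ennreal K * E f)"

definition loc_conv_in_measure ::
  "'a measure \<Rightarrow> (nat \<Rightarrow> 'a \<Rightarrow> real) \<Rightarrow> ('a \<Rightarrow> real) \<Rightarrow> bool" where
  "loc_conv_in_measure M gs f \<longleftrightarrow>
     (\<forall>A\<in>sets M. emeasure M A < \<infinity> \<longrightarrow> (\<forall>\<epsilon>>0.
        (\<lambda>n. emeasure M {x\<in>A. \<epsilon> < \<bar>gs n x - f x\<bar>}) \<longlonglongrightarrow> 0))"

text \<open>Lower semicontinuous relaxation on L0 (metrizable for sigma-finite M, hence given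
by the sequential formula).\<close>

definition E_ext :: "'a measure \<Rightarrow> (('a \<Rightarrow> real) \<Rightarrow> ennreal) \<Rightarrow> ('a \<Rightarrow> real) \<Rightarrow> ennreal" where
  "E_ext M E f = (if f \<in> borel_measurable M then
      Inf {liminf (\<lambda>n. E (gs n)) | gs. (\<forall>n. gs n \<in> borel_measurable M) \<and> loc_conv_in_measure M gs f}
    else \<infinity>)"

definition extended_form_exists :: "'a measure \<Rightarrow> (('a \<Rightarrow> real) \<Rightarrow> ennreal) \<Rightarrow> bool" where
  "extended_form_exists M E \<longleftrightarrow> (\<forall>f\<in>L2 M. E_ext M E f = E f)"

definition dom_ext :: "'a measure \<Rightarrow> (('a \<Rightarrow> real) \<Rightarrow> ennreal) \<Rightarrow> ('a \<Rightarrow> real) set" where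
  "dom_ext M E = {f. f \<in> borel_measurable M \<and> E_ext M E f < \<infinity>}"

definition is_resolvent ::
  "'a measure \<Rightarrow> (('a \<Rightarrow> real) \<Rightarrow> ennreal) \<Rightarrow> real \<Rightarrow> ('a \<Rightarrow> real) \<Rightarrow> ('a \<Rightarrow> real) \<Rightarrow> bool" where
  "is_resolvent M E \<alpha> f g \<longleftrightarrow> g \<in> L2 M \<and>
     (\<forall>u\<in>L2 M. E g + ennreal (\<alpha> / 2 * integral\<^sup>L M (\<lambda>x. (g x - f x / \<alpha>)\<^sup>2))
               \<le> E u + ennreal (\<alpha> / 2 * integral\<^sup>L M (\<lambda>x. (u x - f x / \<alpha>)\<^sup>2)))"

definition ext_resolvent ::
  "'a measure \<Rightarrow> (('a \<Rightarrow> real) \<Rightarrow> ennreal) \<Rightarrow> real \<Rightarrow> ('a \<Rightarrow> real) \<Rightarrow> 'a \<Rightarrow> ennreal" where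
  "ext_resolvent M E \<alpha> f = (SOME u. \<exists>fs gs.
      (\<forall>n. fs n \<in> L2 M \<and> (\<forall>x. 0 \<le> fs n x)) \<and>
      (AE x in M. incseq (\<lambda>n. fs n x) \<and> (\<lambda>n. fs n x) \<longlonglongrightarrow> f x) \<and>
      (\<forall>n. is_resolvent M E \<alpha> (fs n) (gs n)) \<and>
      u = (\<lambda>x. SUP n. ennreal (gs n x)))"

text \<open>G f = lim_{\<alpha>\<rightarrow>0+} G_\<alpha> f; since G_\<alpha> f is a.e. decreasing in \<alpha>, we take the
representative sup over \<alpha> = 1/(n+1).\<close>

definition green_op :: "'a measure \<Rightarrow> (('a \<Rightarrow> real) \<Rightarrow> ennreal) \<Rightarrow> ('a \<Rightarrow> real) \<Rightarrow> 'a \<Rightarrow> ennreal" where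
  "green_op M E f = (\<lambda>x. SUP n. ext_resolvent M E (1 / real (Suc n)) f x)"

definition subcritical :: "'a measure \<Rightarrow> (('a \<Rightarrow> real) \<Rightarrow> ennreal) \<Rightarrow> bool" where
  "subcritical M E \<longleftrightarrow> (\<exists>f. f \<in> borel_measurable M \<and> (AE x in M. 0 < f x) \<and>
      (AE x in M. green_op M E f x < \<infinity>))"

definition excessive :: "'a measure \<Rightarrow> (('a \<Rightarrow> real) \<Rightarrow> ennreal) \<Rightarrow> ('a \<Rightarrow> real) \<Rightarrow> bool" where
  "excessive M E h \<longleftrightarrow> h \<in> borel_measurable M \<and> (AE x in M. 0 \<le> h x) \<and>
     (\<forall>\<alpha>>0. AE x in M. ext_resolvent M E \<alpha> (\<lambda>y. \<alpha> * h y) x \<le> ennreal (h x))"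

definition capacity ::
  "'a::topological_space measure \<Rightarrow> (('a \<Rightarrow> real) \<Rightarrow> ennreal) \<Rightarrow> ('a \<Rightarrow> real) \<Rightarrow> 'a set \<Rightarrow> ennreal" where
  "capacity M E h A = Inf {E_ext M E f | f. f \<in> borel_measurable M \<and>
      (\<exists>U. open U \<and> A \<subseteq> U \<and> (AE x in M. x \<in> U \<longrightarrow> h x \<le> f x))}"

definition local_space ::
  "'a::topological_space measure \<Rightarrow> ('a \<Rightarrow> real) set \<Rightarrow> 'a set \<Rightarrow> ('a \<Rightarrow> real) set" where
  "local_space M F G = {f\<in>F. \<exists>U. open U \<and> - G \<subseteq> U \<and> (AE x in M. x \<in> U \<longrightarrow> f x = 0)}"

definition is_nest ::
  "'a::topological_space measure \<Rightarrow> (('a \<Rightarrow> real) \<Rightarrow> ennreal) \<Rightarrow> (nat \<Rightarrow> 'a set) \<Rightarrow> bool" where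
  "is_nest M E F \<longleftrightarrow> (\<forall>n. closed (F n)) \<and> incseq F \<and>
     (\<forall>f\<in>modular_space (E_ext M E). \<forall>\<epsilon>>0. \<exists>n.
        \<exists>g\<in>local_space M (modular_space (E_ext M E)) (F n).
          luxemburg (E_ext M E) (\<lambda>x. f x - g x) < ennreal \<epsilon>)"

definition exceptional ::
  "'a::topological_space measure \<Rightarrow> (('a \<Rightarrow> real) \<Rightarrow> ennreal) \<Rightarrow> 'a set \<Rightarrow> bool" where
  "exceptional M E A \<longleftrightarrow> (\<exists>F. is_nest M E F \<and> A \<subseteq> (\<Inter>n. - F n))"

end

theory Submission
  imports Defs
begin

text \<open>
  Write \<open>\<E>\<^sub>e\<close> for the extended form. It is convex, lower semicontinuous with respect to convergence almost
  everywhere, and submodular: \<open>\<E>\<^sub>e(f \<and> g) + \<E>\<^sub>e(f \<or> g) \<le> \<E>\<^sub>e(f) + \<E>\<^sub>e(g)\<close>. A function \<open>h \<ge> 0\<close> is excessive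
  iff \<open>\<E>\<^sub>e(f \<and> h) \<le> \<E>\<^sub>e(f)\<close> for all \<open>f\<close>, and subcriticality provides \<open>\<phi> > 0\<close> and \<open>C\<close> with
  \<open>\<integral> \<phi> |v| \<le> C + \<E>\<^sub>e(v)\<close>; with the \<open>\<Delta>\<^sub>2\<close>-condition, \<open>\<E>\<^sub>e\<close> vanishes only at \<open>0\<close>.

  If \<open>A\<close> is exceptional and \<open>g\<close> approximates \<open>h\<close> and vanishes near \<open>A\<close>, then \<open>h - g\<close> competes in the
  capacity, which is therefore zero.

  Conversely, solving obstacle problems gives excessive functions \<open>H\<^sub>N \<ge> N h\<close> increasing in \<open>N\<close>. Choose
  \<open>f\<^sub>k \<ge> H\<^sub>k\<close> on open sets \<open>U\<^sub>k \<supseteq> A\<close> with \<open>\<E>\<^sub>e(f\<^sub>k) \<le> 2\<^sup>-\<^sup>k\<close>, and let \<open>F\<^sub>n\<close> be the complement of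
  \<open>\<Union>\<^sub>k\<^sub>\<ge>\<^sub>n U\<^sub>k\<close>. For \<open>0 \<le> g \<le> H\<^sub>N\<close> and \<open>e\<^sub>n = sup\<^sub>k\<^sub>\<ge>\<^sub>n (f\<^sub>k \<and> H\<^sub>N)\<close> the function \<open>g - g \<and> e\<^sub>n\<close> vanishes off \<open>F\<^sub>n\<close>, and
  \<open>\<E>\<^sub>e(g \<and> e\<^sub>n) \<rightarrow> 0\<close>. For general \<open>g \<ge> 0\<close> the truncations \<open>g \<and> H\<^sub>N\<close> are bounded in energy, so by reflexivity
  convex combinations of them converge to \<open>g\<close>.
\<close>

section \<open>Hahn--Banach separation and generalized limits\<close>

text \<open>The form is convex but not quadratic, so a multiple \<open>N h\<close> of an excessive
  function need not be excessive. Truncation at \<open>h\<close> alone reaches only functions below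
  \<open>h\<close>, while exhausting the domain takes excessive levels above every
  \<open>N h\<close>. This is why the levels \<open>H N\<close> come from obstacle problems, and why
  the capacity of the single function \<open>h\<close> is used only when all \<open>N h\<close> are
  excessive. Cutting the competitors \<open>f k\<close> at \<open>H N\<close> costs no energy and
  bounds their suprema pointwise; the tail suprema decrease to a function of energy 0, that is, to
  0. Reflexivity is density of an image in the bidual of a seminormed space, so it gives no weakly
  convergent subsequence directly. A generalized limit along a bounded sequence defines a bidual
  element, a member of the space matches it up to an error, and separation converts this into convex
  combinations. Reflexivity concerns \<open>E\<close> on L2; hence density is shown first for
  nonnegative L2 functions, then for their differences, then for almost everywhere limits of bounded
  energy.\<close>

definition fun_subspace :: "('b \<Rightarrow> real) set \<Rightarrow> bool" where
  "fun_subspace V \<longleftrightarrow> (\<lambda>x. 0) \<in> V \<and>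
     (\<forall>f\<in>V. \<forall>g\<in>V. \<forall>a b. (\<lambda>x. a * f x + b * g x) \<in> V)"

definition sublinear_on :: "('b \<Rightarrow> real) set \<Rightarrow> (('b \<Rightarrow> real) \<Rightarrow> real) \<Rightarrow> bool" where
  "sublinear_on V p \<longleftrightarrow>
     (\<forall>f\<in>V. \<forall>g\<in>V. p (\<lambda>x. f x + g x) \<le> p f + p g) \<and>
     (\<forall>f\<in>V. \<forall>t\<ge>0. p (\<lambda>x. t * f x) = t * p f)"

text \<open>Linearity is relative to a carrier \<open>V\<close>: the modular space depends on the
  form and is a set, not a type.\<close>

definition linear_fun_on :: "('b \<Rightarrow> real) set \<Rightarrow> (('b \<Rightarrow> real) \<Rightarrow> real) \<Rightarrow> bool" where
  "linear_fun_on V \<phi> \<longleftrightarrow>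
     (\<forall>f\<in>V. \<forall>g\<in>V. \<forall>a b. \<phi> (\<lambda>x. a * f x + b * g x) = a * \<phi> f + b * \<phi> g)"

lemma fun_subspace_zero: "fun_subspace V \<Longrightarrow> (\<lambda>x. 0) \<in> V"
  by (simp add: fun_subspace_def)

lemma fun_subspace_lin:
  "fun_subspace V \<Longrightarrow> f \<in> V \<Longrightarrow> g \<in> V \<Longrightarrow> (\<lambda>x. a * f x + b * g x) \<in> V"
  by (simp add: fun_subspace_def)

lemma fun_subspace_add: "fun_subspace V \<Longrightarrow> f \<in> V \<Longrightarrow> g \<in> V \<Longrightarrow> (\<lambda>x. f x + g x) \<in> V"
  using fun_subspace_lin[of V f g 1 1] by simp

lemma fun_subspace_diff: "fun_subspace V \<Longrightarrow> f \<in> V \<Longrightarrow> g \<in> V \<Longrightarrow> (\<lambda>x. f x - g x) \<in> V"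
  using fun_subspace_lin[of V f g 1 "-1"] by simp

lemma fun_subspace_scale: "fun_subspace V \<Longrightarrow> f \<in> V \<Longrightarrow> (\<lambda>x. a * f x) \<in> V"
  using fun_subspace_lin[of V f f a 0] by simp

lemma fun_subspace_minus: "fun_subspace V \<Longrightarrow> f \<in> V \<Longrightarrow> (\<lambda>x. - f x) \<in> V"
  using fun_subspace_scale[of V f "-1"] by simp

lemma sublinear_on_add:
  "sublinear_on V p \<Longrightarrow> f \<in> V \<Longrightarrow> g \<in> V \<Longrightarrow> p (\<lambda>x. f x + g x) \<le> p f + p g"
  by (simp add: sublinear_on_def)

lemma sublinear_on_scale:
  "sublinear_on V p \<Longrightarrow> f \<in> V \<Longrightarrow> 0 \<le> t \<Longrightarrow> p (\<lambda>x. t * f x) = t * p f"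
  by (simp add: sublinear_on_def)

lemma sublinear_on_zero: "sublinear_on V p \<Longrightarrow> (\<lambda>x. 0) \<in> V \<Longrightarrow> p (\<lambda>x. 0) = 0"
  using sublinear_on_scale[of V p "\<lambda>x. 0" 0] by simp

lemma sublinear_on_minus:
  assumes "fun_subspace V" "sublinear_on V p" "f \<in> V"
  shows "0 \<le> p f + p (\<lambda>x. - f x)"
  using sublinear_on_add[OF assms(2,3) fun_subspace_minus[OF assms(1,3)]]
    sublinear_on_zero[OF assms(2) fun_subspace_zero[OF assms(1)]] by simp

text \<open>Applying the inequality to \<open>u * f\<close> with the factor \<open>1 / u\<close>
  gives the reverse one.\<close>

lemma sublinear_onI:
  assumes V: "fun_subspace V" and zero: "p (\<lambda>x. 0) = 0"
    and add: "\<And>f g. f \<in> V \<Longrightarrow> g \<in> V \<Longrightarrow> p (\<lambda>x. f x + g x) \<le> p f + p g"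
    and hom: "\<And>f u. f \<in> V \<Longrightarrow> 0 < u \<Longrightarrow> p (\<lambda>x. u * f x) \<le> u * p f"
  shows "sublinear_on V p"
  unfolding sublinear_on_def
proof (intro conjI ballI allI impI add)
  fix f and u :: real assume f: "f \<in> V" and u: "0 \<le> u"
  show "p (\<lambda>x. u * f x) = u * p f"
  proof (cases "u = 0")
    case False
    then have u: "u > 0" using u by simp
    have "p (\<lambda>x. (1/u) * (u * f x)) \<le> (1/u) * p (\<lambda>x. u * f x)"
      using u by (intro hom fun_subspace_scale[OF V f]) auto
    then have "u * p f \<le> p (\<lambda>x. u * f x)" using u by (simp add: field_simps)
    with hom[OF f u] show ?thesis by simp
  qed (simp add: zero)
qed

text \<open>The infimum defining \<open>p\<close> runs over the cone generated by \<open>K\<close>. For \<open>K = {f}\<close> and \<open>d = n f\<close> it shows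
  that a minimal sublinear functional is odd, for general \<open>K\<close> it separates \<open>K\<close> from \<open>0\<close>.\<close>

lemma sublinear_below_on_convex:
  fixes V K :: "('b \<Rightarrow> real) set"
  assumes V: "fun_subspace V" and n: "sublinear_on V n" and KV: "K \<subseteq> V" and ne: "K \<noteq> {}"
    and conv: "\<And>f g t. f \<in> K \<Longrightarrow> g \<in> K \<Longrightarrow> 0 \<le> t \<Longrightarrow> t \<le> 1 \<Longrightarrow> (\<lambda>x. t * f x + (1 - t) * g x) \<in> K"
    and far: "\<And>f. f \<in> K \<Longrightarrow> d \<le> n f"
  obtains p where "sublinear_on V p" "\<And>f. f \<in> V \<Longrightarrow> p f \<le> n f" "\<And>f. f \<in> K \<Longrightarrow> p (\<lambda>x. - f x) \<le> - d"
proof -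
  define S where "S f = {n (\<lambda>x. f x + t * c x) - t * d | t c. t \<ge> 0 \<and> c \<in> K}" for f
  define p where "p f = Inf (S f)" for f
  have K: "c \<in> V" if "c \<in> K" for c using KV that by blast
  have n0: "n (\<lambda>x. 0) = 0" by (rule sublinear_on_zero[OF n fun_subspace_zero[OF V]])
  \<comment> \<open>Subadditivity and \<open>far\<close> bound all candidates below, uniformly in
    \<open>t\<close> and \<open>c\<close>, so the infimum is finite.\<close>
  have low: "- n (\<lambda>x. - f x) \<le> y" if f: "f \<in> V" and "y \<in> S f" for f y
  proof -
    from that obtain t c where t: "t \<ge> 0" "c \<in> K" "y = n (\<lambda>x. f x + t * c x) - t * d" by (auto simp: S_def)
    have "n (\<lambda>x. (f x + t * c x) + - f x) \<le> n (\<lambda>x. f x + t * c x) + n (\<lambda>x. - f x)"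
      by (intro sublinear_on_add[OF n] fun_subspace_add[OF V] fun_subspace_scale[OF V]
          fun_subspace_minus[OF V] f K t)
    moreover have "n (\<lambda>x. t * c x) = t * n c" by (intro sublinear_on_scale[OF n] K t)
    moreover have "t * d \<le> t * n c" using t far by (intro mult_left_mono) auto
    ultimately show ?thesis using t by simp
  qed
  have bdd: "bdd_below (S f)" if "f \<in> V" for f using low[OF that] by (auto simp: bdd_below_def)
  have neS: "S f \<noteq> {}" for f unfolding S_def using ne by blast
  have ple: "p f \<le> n (\<lambda>x. f x + t * c x) - t * d" if "f \<in> V" "t \<ge> 0" "c \<in> K" for f t c
    unfolding p_def by (rule cInf_lower[OF _ bdd[OF that(1)]]) (use that in \<open>auto simp: S_def\<close>)
  have pn: "p f \<le> n f" if "f \<in> V" for f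
  proof -
    obtain c where "c \<in> K" using ne by blast
    from ple[OF that order_refl this] show ?thesis by simp
  qed
  have "sublinear_on V p"
  proof (rule sublinear_onI[OF V])
    have "0 \<le> p (\<lambda>x. 0)"
      unfolding p_def using low[OF fun_subspace_zero[OF V]] n0 by (intro cInf_greatest[OF neS]) auto
    then show "p (\<lambda>x. 0) = 0" using pn[OF fun_subspace_zero[OF V]] n0 by simp
  next
    fix f g assume f: "f \<in> V" and g: "g \<in> V"
    have "p (\<lambda>x. f x + g x) - a \<le> p g" if a: "a \<in> S f" for a
      unfolding p_def[of g]
    proof (rule cInf_greatest[OF neS])
      fix b assume b: "b \<in> S g"
      from a b obtain t c s e where t: "t \<ge> 0" "c \<in> K" "a = n (\<lambda>x. f x + t * c x) - t * d"
        and s: "s \<ge> 0" "e \<in> K" "b = n (\<lambda>x. g x + s * e x) - s * d" by (auto simp: S_def)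
      \<comment> \<open>The cone over a convex set is closed under addition: normalize by
        \<open>t + s\<close>. If both weights vanish, any member of \<open>K\<close> serves.\<close>
      have "\<exists>k\<in>K. \<forall>x. t * c x + s * e x = (t + s) * k x"
      proof (cases "t + s = 0")
        case True
        then have "t = 0" "s = 0" using t s by auto
        then show ?thesis using t by auto
      next
        case False
        then have pos: "t + s > 0" using t s by simp
        have "(\<lambda>x. t/(t+s) * c x + (1 - t/(t+s)) * e x) \<in> K"
          using pos t s by (intro conv) (auto simp: field_simps)
        moreover have "t * c x + s * e x = (t+s) * (t/(t+s) * c x + (1 - t/(t+s)) * e x)" for x
        proof -
          have "1 - t/(t+s) = s/(t+s)" using pos by (simp add: field_simps)
          then show ?thesis using pos by (simp add: distrib_left)
        qed
        ultimately show ?thesis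
          by (intro bexI[of _ "\<lambda>x. t/(t+s) * c x + (1 - t/(t+s)) * e x"]) auto
      qed
      then obtain k where k: "k \<in> K" "\<And>x. t * c x + s * e x = (t + s) * k x" by blast
      have "p (\<lambda>x. f x + g x) \<le> n (\<lambda>x. (f x + g x) + (t+s) * k x) - (t+s) * d"
        using fun_subspace_add[OF V f g] t s k by (intro ple) auto
      also have "(\<lambda>x. (f x + g x) + (t+s) * k x) = (\<lambda>x. (f x + t * c x) + (g x + s * e x))"
        by (rule ext) (simp add: k(2)[symmetric])
      also have "n \<dots> \<le> n (\<lambda>x. f x + t * c x) + n (\<lambda>x. g x + s * e x)"
        by (intro sublinear_on_add[OF n] fun_subspace_add[OF V] fun_subspace_scale[OF V] f g K t s)
      finally show "p (\<lambda>x. f x + g x) - a \<le> b" using t s by (simp add: algebra_simps)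
    qed
    then have "p (\<lambda>x. f x + g x) - p g \<le> p f"
      unfolding p_def[of f] by (intro cInf_greatest[OF neS]) (simp add: algebra_simps)
    then show "p (\<lambda>x. f x + g x) \<le> p f + p g" by simp
  next
    fix f and u :: real assume f: "f \<in> V" and u: "0 < u"
    have "p (\<lambda>x. u * f x) / u \<le> p f"
      unfolding p_def[of f]
    proof (rule cInf_greatest[OF neS])
      fix b assume "b \<in> S f"
      then obtain t c where t: "t \<ge> 0" "c \<in> K" "b = n (\<lambda>x. f x + t * c x) - t * d" by (auto simp: S_def)
      have "p (\<lambda>x. u * f x) \<le> n (\<lambda>x. u * f x + (u*t) * c x) - (u*t) * d"
        using u t by (intro ple fun_subspace_scale[OF V f]) auto
      also have "n (\<lambda>x. u * f x + (u*t) * c x) = n (\<lambda>x. u * (f x + t * c x))"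
        by (simp add: algebra_simps)
      also have "\<dots> = u * n (\<lambda>x. f x + t * c x)"
        using u by (intro sublinear_on_scale[OF n] fun_subspace_add[OF V] fun_subspace_scale[OF V] f K t) auto
      finally have "p (\<lambda>x. u * f x) \<le> u * b" using t by (simp add: right_diff_distrib mult.assoc)
      then show "p (\<lambda>x. u * f x) / u \<le> b" using u by (simp add: field_simps)
    qed
    then show "p (\<lambda>x. u * f x) \<le> u * p f" using u by (simp add: field_simps)
  qed
  moreover have "p (\<lambda>x. - c x) \<le> - d" if "c \<in> K" for c
    using ple[OF fun_subspace_minus[OF V K[OF that]] zero_le_one that] n0 by simp
  ultimately show ?thesis using pn by (intro that)
qed

text \<open>For \<open>K = {f}\<close> the previous lemma gives \<open>r\<close> below
  \<open>q\<close> with \<open>r(-f) \<le> - q(f)\<close>; minimality identifies \<open>r\<close>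
  with \<open>q\<close>, so \<open>q\<close> is odd, and an odd subadditive functional is
  additive.\<close>

lemma linear_if_minimal_sublinear:
  fixes V :: "('b \<Rightarrow> real) set"
  assumes V: "fun_subspace V" and q: "sublinear_on V q"
    and minimal: "\<And>r. sublinear_on V r \<Longrightarrow> (\<And>f. f \<in> V \<Longrightarrow> r f \<le> q f) \<Longrightarrow>
                    (\<And>f. f \<in> V \<Longrightarrow> r f = q f)"
  shows "linear_fun_on V q"
proof -
  have neg: "q (\<lambda>x. - f x) = - q f" if f: "f \<in> V" for f
  proof -
    obtain r where r: "sublinear_on V r" "\<And>g. g \<in> V \<Longrightarrow> r g \<le> q g" "r (\<lambda>x. - f x) \<le> - q f"
    proof (rule sublinear_below_on_convex[OF V q, of "{f}" "q f"])
      show "(\<lambda>x. t * g x + (1 - t) * k x) \<in> {f}" if "g \<in> {f}" "k \<in> {f}" for g k and t :: real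
        using that by (auto simp: algebra_simps)
    qed (use f in auto)
    have "r (\<lambda>x. - f x) = q (\<lambda>x. - f x)" using minimal[OF r(1,2) fun_subspace_minus[OF V f]] .
    then show ?thesis using r(3) sublinear_on_minus[OF V q f] by simp
  qed
  have add: "q (\<lambda>x. f x + g x) = q f + q g" if f: "f \<in> V" and g: "g \<in> V" for f g
  proof -
    have "q (\<lambda>x. (f x + g x) + - g x) \<le> q (\<lambda>x. f x + g x) + q (\<lambda>x. - g x)"
      by (intro sublinear_on_add[OF q] fun_subspace_add[OF V] fun_subspace_minus[OF V] f g)
    then show ?thesis using neg[OF g] sublinear_on_add[OF q f g] by simp
  qed
  have scale: "q (\<lambda>x. a * f x) = a * q f" if f: "f \<in> V" for a f
  proof (cases "a \<ge> 0")
    case True then show ?thesis using sublinear_on_scale[OF q f] by simp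
  next
    case False
    then have "q (\<lambda>x. (-a) * f x) = (-a) * q f" using sublinear_on_scale[OF q f, of "-a"] by simp
    moreover have "q (\<lambda>x. - (a * f x)) = - q (\<lambda>x. a * f x)" by (intro neg fun_subspace_scale[OF V f])
    ultimately show ?thesis by simp
  qed
  show ?thesis
    unfolding linear_fun_on_def using add scale V by (simp add: fun_subspace_scale)
qed

text \<open>An infimum of sublinear functionals need not be subadditive; in a chain, the smaller of
  two members handles both summands. The lower bound \<open>- p(-f)\<close> keeps the infimum
  finite.\<close>

lemma chain_Inf_sublinear:
  fixes V :: "('b \<Rightarrow> real) set"
  assumes V: "fun_subspace V" and ne: "C \<noteq> {}"
    and sub: "\<And>q. q \<in> C \<Longrightarrow> sublinear_on V q"
    and bound: "\<And>q f. q \<in> C \<Longrightarrow> f \<in> V \<Longrightarrow> q f \<le> p f"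
    and chain: "\<And>q r. q \<in> C \<Longrightarrow> r \<in> C \<Longrightarrow> (\<forall>f\<in>V. q f \<le> r f) \<or> (\<forall>f\<in>V. r f \<le> q f)"
  shows "sublinear_on V (\<lambda>f. INF q\<in>C. q f)"
    and "\<And>q f. q \<in> C \<Longrightarrow> f \<in> V \<Longrightarrow> (INF q\<in>C. q f) \<le> q f"
proof -
  have bdd: "bdd_below ((\<lambda>q. q f) ` C)" if f: "f \<in> V" for f
  proof -
    have "- p (\<lambda>x. - f x) \<le> q f" if "q \<in> C" for q
      using sublinear_on_minus[OF V sub[OF that] f] bound[OF that fun_subspace_minus[OF V f]] by simp
    then show ?thesis by (auto simp: bdd_below_def)
  qed
  show low: "\<And>q f. q \<in> C \<Longrightarrow> f \<in> V \<Longrightarrow> (INF q\<in>C. q f) \<le> q f"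
    by (rule cINF_lower[OF bdd])
  show "sublinear_on V (\<lambda>f. INF q\<in>C. q f)"
  proof (rule sublinear_onI[OF V])
    fix f g assume f: "f \<in> V" and g: "g \<in> V"
    have key: "(INF q\<in>C. q (\<lambda>x. f x + g x)) \<le> q f + r g" if q: "q \<in> C" and r: "r \<in> C" for q r
      using low[OF q fun_subspace_add[OF V f g]] low[OF r fun_subspace_add[OF V f g]]
        sublinear_on_add[OF sub[OF q] f g] sublinear_on_add[OF sub[OF r] f g] chain[OF q r] f g
      by fastforce
    have "(INF q\<in>C. q (\<lambda>x. f x + g x)) - r g \<le> (INF q\<in>C. q f)" if "r \<in> C" for r
      by (intro cINF_greatest[OF ne]) (use key that in \<open>simp add: algebra_simps\<close>)
    then have "(INF q\<in>C. q (\<lambda>x. f x + g x)) - (INF q\<in>C. q f) \<le> (INF q\<in>C. q g)"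
      by (intro cINF_greatest[OF ne]) (simp add: algebra_simps)
    then show "(INF q\<in>C. q (\<lambda>x. f x + g x)) \<le> (INF q\<in>C. q f) + (INF q\<in>C. q g)" by simp
  next
    fix f and u :: real assume f: "f \<in> V" and u: "0 < u"
    have "(INF q\<in>C. q (\<lambda>x. u * f x)) / u \<le> (INF q\<in>C. q f)"
    proof (rule cINF_greatest[OF ne])
      fix q assume q: "q \<in> C"
      have "(INF q\<in>C. q (\<lambda>x. u * f x)) \<le> u * q f"
        using low[OF q fun_subspace_scale[OF V f], of u] sublinear_on_scale[OF sub[OF q] f, of u] u by simp
      then show "(INF q\<in>C. q (\<lambda>x. u * f x)) / u \<le> q f" using u by (simp add: field_simps)
    qed
    then show "(INF q\<in>C. q (\<lambda>x. u * f x)) \<le> u * (INF q\<in>C. q f)" using u by (simp add: field_simps)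
  next
    have "(INF q\<in>C. q (\<lambda>x. 0)) = (INF q\<in>C. 0 :: real)"
      using sublinear_on_zero[OF sub fun_subspace_zero[OF V]] by (intro INF_cong) auto
    then show "(INF q\<in>C. q (\<lambda>x. 0)) = 0" using ne by simp
  qed
qed

text \<open>Zorn's lemma runs over sublinear functionals below \<open>p\<close>, not over partial
  linear extensions: a minimal one is linear.\<close>

theorem hahn_banach_dominated:
  fixes V :: "('b \<Rightarrow> real) set"
  assumes V: "fun_subspace V" and p: "sublinear_on V p"
  obtains \<phi> where "linear_fun_on V \<phi>" "\<And>f. f \<in> V \<Longrightarrow> \<phi> f \<le> p f"
proof -
  \<comment> \<open>Restricting to functionals vanishing off \<open>V\<close> makes the pointwise order antisymmetric.\<close>
  define P where "P = {q. sublinear_on V q \<and> (\<forall>f\<in>V. q f \<le> p f) \<and> (\<forall>f. f \<notin> V \<longrightarrow> q f = 0)}"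
  \<comment> \<open>The order is reversed, so the maximal element from \<open>predicate_Zorn\<close>
    is a minimal functional.\<close>
  define R where "R = (\<lambda>q r. \<forall>f\<in>V. r f \<le> (q f :: real))"
  have "\<exists>m\<in>P. \<forall>q\<in>P. R m q \<longrightarrow> q = m"
  proof (rule predicate_Zorn)
    show "partial_order_on P (relation_of R P)"
    proof (rule partial_order_on_relation_ofI)
      fix q r assume "q \<in> P" "r \<in> P" "R q r" "R r q"
      then show "q = r" unfolding P_def R_def by (intro ext) (smt (verit) mem_Collect_eq)
    qed (auto simp: R_def intro: order_trans)
  next
    fix C assume "C \<in> Chains (relation_of R P)"
    then have CP: "C \<subseteq> P" and ch: "\<And>q r. q \<in> C \<Longrightarrow> r \<in> C \<Longrightarrow> R q r \<or> R r q"
      by (auto simp: Chains_def relation_of_def)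
    show "\<exists>u\<in>P. \<forall>q\<in>C. R q u"
    proof (cases "C = {}")
      case True
      have "(\<lambda>f. if f \<in> V then p f else 0) \<in> P"
        unfolding P_def using p V
        by (auto simp: sublinear_on_def fun_subspace_add fun_subspace_scale)
      then show ?thesis using True by auto
    next
      case False
      have sl: "\<And>q. q \<in> C \<Longrightarrow> sublinear_on V q" and bd: "\<And>q f. q \<in> C \<Longrightarrow> f \<in> V \<Longrightarrow> q f \<le> p f"
        using CP by (auto simp: P_def)
      have chn: "\<And>q r. q \<in> C \<Longrightarrow> r \<in> C \<Longrightarrow> (\<forall>f\<in>V. q f \<le> r f) \<or> (\<forall>f\<in>V. r f \<le> q f)"
        using ch unfolding R_def by blast
      let ?u = "\<lambda>f. INF q\<in>C. q f"
      have low: "?u f \<le> q f" if "q \<in> C" "f \<in> V" for q f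
        by (rule chain_Inf_sublinear(2)[where V = V and p = p]) (use V False sl bd chn that in auto)
      have "sublinear_on V ?u" 
        by (rule chain_Inf_sublinear(1)[where V = V and p = p]) (use V False sl bd chn in auto)
      moreover have "?u f \<le> p f" if "f \<in> V" for f
      proof -
        obtain q where q: "q \<in> C" using False by blast
        show ?thesis using low[OF q that] bd[OF q that] by linarith
      qed
      moreover have "?u f = 0" if "f \<notin> V" for f
      proof -
        have "(INF q\<in>C. q f) = (INF q\<in>C. 0)" using CP that by (intro INF_cong) (auto simp: P_def)
        then show ?thesis using False by simp
      qed
      ultimately have "?u \<in> P" unfolding P_def by blast
      then show ?thesis using low unfolding R_def by (intro bexI[of _ ?u]) auto
    qed
  qed
  then obtain m where m: "m \<in> P" and max: "\<And>q. q \<in> P \<Longrightarrow> R m q \<Longrightarrow> q = m" by blast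
  have "linear_fun_on V m"
  proof (rule linear_if_minimal_sublinear[OF V])
    show "sublinear_on V m" using m by (simp add: P_def)
    fix r f assume r: "sublinear_on V r" and le: "\<And>f. f \<in> V \<Longrightarrow> r f \<le> m f" and f: "f \<in> V"
    let ?r = "\<lambda>f. if f \<in> V then r f else 0"
    have "sublinear_on V ?r"
      using r V by (auto simp: sublinear_on_def fun_subspace_add fun_subspace_scale)
    then have "?r \<in> P" using le m by (auto simp: P_def intro: order_trans)
    moreover have "R m ?r" using le by (auto simp: R_def)
    ultimately have "?r = m" by (rule max)
    from fun_cong[OF this, of f] show "r f = m f" using f by simp
  qed
  moreover have "m f \<le> p f" if "f \<in> V" for f using m that by (simp add: P_def)
  ultimately show ?thesis by (rule that)
qed

text \<open>A linear functional below \<open>p\<close> satisfies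
  \<open>\<phi>(-c) \<le> p(-c) \<le> -d\<close> on \<open>K\<close>, and linearity turns the sign
  around.\<close>

theorem hahn_banach_separation:
  fixes V K :: "('b \<Rightarrow> real) set"
  assumes V: "fun_subspace V" and n: "sublinear_on V n" and KV: "K \<subseteq> V" and ne: "K \<noteq> {}"
    and conv: "\<And>f g t. f \<in> K \<Longrightarrow> g \<in> K \<Longrightarrow> 0 \<le> t \<Longrightarrow> t \<le> 1 \<Longrightarrow> (\<lambda>x. t * f x + (1 - t) * g x) \<in> K"
    and far: "\<And>f. f \<in> K \<Longrightarrow> d \<le> n f"
  obtains \<phi> where "linear_fun_on V \<phi>" "\<And>f. f \<in> V \<Longrightarrow> \<phi> f \<le> n f" "\<And>f. f \<in> K \<Longrightarrow> d \<le> \<phi> f"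
proof -
  obtain p where p: "sublinear_on V p" "\<And>f. f \<in> V \<Longrightarrow> p f \<le> n f" "\<And>f. f \<in> K \<Longrightarrow> p (\<lambda>x. - f x) \<le> - d"
    using sublinear_below_on_convex[OF V n KV ne conv far] by blast
  obtain \<phi> where lin: "linear_fun_on V \<phi>" and dom: "\<And>f. f \<in> V \<Longrightarrow> \<phi> f \<le> p f"
    using hahn_banach_dominated[OF V p(1)] by blast
  have "d \<le> \<phi> c" if c: "c \<in> K" for c
  proof -
    have cV: "c \<in> V" using c KV by blast
    have "\<phi> (\<lambda>x. - c x) \<le> - d" using dom[OF fun_subspace_minus[OF V cV]] p(3)[OF c] by simp
    moreover have "\<phi> (\<lambda>x. (-1) * c x + 0 * c x) = (-1) * \<phi> c + 0 * \<phi> c"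
      using lin cV unfolding linear_fun_on_def by blast
    ultimately show ?thesis by simp
  qed
  moreover have "\<phi> f \<le> n f" if "f \<in> V" for f using dom[OF that] p(2)[OF that] by linarith
  ultimately show ?thesis using that[OF lin] by blast
qed

section \<open>Generalized limits of bounded sequences\<close>

definition bounded_seqs :: "(nat \<Rightarrow> real) set" where
  "bounded_seqs = {x. \<exists>c. \<forall>n. \<bar>x n\<bar> \<le> c}"

lemma bounded_seqs_subspace: "fun_subspace bounded_seqs"
  unfolding fun_subspace_def
proof (intro conjI ballI allI)
  show "(\<lambda>x. 0) \<in> bounded_seqs" by (auto simp: bounded_seqs_def)
  fix f g :: "nat \<Rightarrow> real" and a b assume "f \<in> bounded_seqs" "g \<in> bounded_seqs"
  then obtain c d where c: "\<And>n. \<bar>f n\<bar> \<le> c" and d: "\<And>n. \<bar>g n\<bar> \<le> d" by (auto simp: bounded_seqs_def)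
  have "\<bar>a * f n + b * g n\<bar> \<le> \<bar>a\<bar> * c + \<bar>b\<bar> * d" for n
    using mult_left_mono[OF c[of n], of "\<bar>a\<bar>"] mult_left_mono[OF d[of n], of "\<bar>b\<bar>"]
      abs_triangle_ineq[of "a * f n" "b * g n"] by (simp add: abs_mult)
  then show "(\<lambda>x. a * f x + b * g x) \<in> bounded_seqs" unfolding bounded_seqs_def by blast
qed

text \<open>Hahn-Banach with the limit superior as dominating functional. The result evaluates all
  dual functionals along one bounded sequence at once and thereby produces a bidual element.\<close>

lemma generalized_limit:
  obtains L where "linear_fun_on bounded_seqs L"
    "\<And>x c. x \<in> bounded_seqs \<Longrightarrow> eventually (\<lambda>n. x n \<le> c) sequentially \<Longrightarrow> L x \<le> c"
    "\<And>x c. x \<in> bounded_seqs \<Longrightarrow> eventually (\<lambda>n. c \<le> x n) sequentially \<Longrightarrow> c \<le> L x"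
proof -
  \<comment> \<open>\<open>S x\<close> collects the eventual upper bounds, so its infimum
    \<open>p x\<close> is the limit superior.\<close>
  define S where "S x = {c. eventually (\<lambda>n. x n \<le> c) sequentially}" for x :: "nat \<Rightarrow> real"
  define p where "p x = Inf (S x)" for x
  have ne: "S x \<noteq> {}" and bdd: "bdd_below (S x)" if x: "x \<in> bounded_seqs" for x
  proof -
    from x obtain c where c: "\<And>n. \<bar>x n\<bar> \<le> c" by (auto simp: bounded_seqs_def)
    have "x n \<le> c" for n using c[of n] by simp
    then have "c \<in> S x" by (simp add: S_def)
    then show "S x \<noteq> {}" by blast
    show "bdd_below (S x)"
    proof (rule bdd_belowI)
      fix d assume "d \<in> S x"
      then obtain n where "x n \<le> d" by (auto simp: S_def eventually_sequentially)
      then show "- c \<le> d" using c[of n] by simp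
    qed
  qed
  note V = bounded_seqs_subspace
  have sub: "sublinear_on bounded_seqs p"
  proof (rule sublinear_onI[OF V])
    have "S (\<lambda>n. 0) = {0..}" by (auto simp: S_def eventually_sequentially)
    then show "p (\<lambda>n. 0) = 0" by (simp add: p_def)
  next
    fix x y assume x: "x \<in> bounded_seqs" and y: "y \<in> bounded_seqs"
    note xy = fun_subspace_add[OF V x y]
    have "p (\<lambda>n. x n + y n) - c \<le> p y" if "c \<in> S x" for c
      unfolding p_def[of y]
    proof (rule cInf_greatest[OF ne[OF y]])
      fix d assume "d \<in> S y"
      then have "eventually (\<lambda>n. x n + y n \<le> c + d) sequentially"
        using that unfolding S_def mem_Collect_eq by eventually_elim simp
      then have "p (\<lambda>n. x n + y n) \<le> c + d" unfolding p_def by (intro cInf_lower bdd xy) (simp add: S_def)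
      then show "p (\<lambda>n. x n + y n) - c \<le> d" by simp
    qed
    then have "p (\<lambda>n. x n + y n) - p y \<le> p x"
      unfolding p_def[of x] by (intro cInf_greatest[OF ne[OF x]]) (simp add: algebra_simps)
    then show "p (\<lambda>n. x n + y n) \<le> p x + p y" by simp
  next
    fix x and u :: real assume x: "x \<in> bounded_seqs" and u: "0 < u"
    have "p (\<lambda>n. u * x n) / u \<le> p x"
      unfolding p_def[of x]
    proof (rule cInf_greatest[OF ne[OF x]])
      fix c assume "c \<in> S x"
      then have "eventually (\<lambda>n. x n \<le> c) sequentially" by (simp add: S_def)
      then have "eventually (\<lambda>n. u * x n \<le> u * c) sequentially"
        by (rule eventually_mono) (use u in simp)
      then have "p (\<lambda>n. u * x n) \<le> u * c"
        unfolding p_def by (intro cInf_lower bdd fun_subspace_scale[OF V x]) (simp add: S_def)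
      then show "p (\<lambda>n. u * x n) / u \<le> c" using u by (simp add: field_simps)
    qed
    then show "p (\<lambda>n. u * x n) \<le> u * p x" using u by (simp add: field_simps)
  qed
  obtain L where lin: "linear_fun_on bounded_seqs L" and dom: "\<And>x. x \<in> bounded_seqs \<Longrightarrow> L x \<le> p x"
    using hahn_banach_dominated[OF V sub] by blast
  have up: "L x \<le> c" if x: "x \<in> bounded_seqs" and ev: "eventually (\<lambda>n. x n \<le> c) sequentially" for x c
  proof -
    have "p x \<le> c" unfolding p_def by (intro cInf_lower bdd[OF x]) (simp add: S_def ev)
    then show ?thesis using dom[OF x] by simp
  qed
  have "c \<le> L x" if x: "x \<in> bounded_seqs" and ev: "eventually (\<lambda>n. c \<le> x n) sequentially" for x c
  proof -
    have "L (\<lambda>n. - x n) \<le> - c" using ev by (intro up fun_subspace_minus[OF V x]) simp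
    moreover have "L (\<lambda>n. (-1) * x n + 0 * x n) = (-1) * L x + 0 * L x"
      using lin x unfolding linear_fun_on_def by blast
    ultimately show ?thesis by simp
  qed
  with lin up show ?thesis by (rule that)
qed

text \<open>Function types are not real vector spaces here, so convex hulls are generated by binary combinations.\<close>

inductive_set cvx_hull :: "('b \<Rightarrow> real) set \<Rightarrow> ('b \<Rightarrow> real) set" for S where
  base: "s \<in> S \<Longrightarrow> s \<in> cvx_hull S"
| step: "a \<in> cvx_hull S \<Longrightarrow> b \<in> cvx_hull S \<Longrightarrow> 0 \<le> t \<Longrightarrow> t \<le> 1 \<Longrightarrow>
    (\<lambda>x. t * a x + (1 - t) * b x) \<in> cvx_hull S"

lemma cvx_hull_mono: "f \<in> cvx_hull S \<Longrightarrow> S \<subseteq> T \<Longrightarrow> f \<in> cvx_hull T"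
  by (induction rule: cvx_hull.induct) (auto intro: cvx_hull.intros)

lemma cvx_hull_near:
  assumes "f \<in> cvx_hull S" and S: "\<And>s. s \<in> S \<Longrightarrow> \<bar>s x - a\<bar> \<le> e"
  shows "\<bar>f x - a\<bar> \<le> e"
  using assms(1)
proof induction
  case (step g h t)
  have "(t * g x + (1 - t) * h x) - a = t * (g x - a) + (1 - t) * (h x - a)" by (simp add: algebra_simps)
  also have "\<bar>\<dots>\<bar> \<le> t * \<bar>g x - a\<bar> + (1 - t) * \<bar>h x - a\<bar>"
    using step abs_triangle_ineq[of "t * (g x - a)" "(1 - t) * (h x - a)"] by (simp add: abs_mult)
  also have "\<dots> \<le> t * e + (1 - t) * e" using step by (intro add_mono mult_left_mono) auto
  finally show ?case by (simp add: algebra_simps)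
qed (rule S)

section \<open>Square-integrable functions and convergence in measure\<close>

lemma L2D: assumes "f \<in> L2 M" shows "f \<in> borel_measurable M" "integrable M (\<lambda>x. (f x)\<^sup>2)"
  using assms by (auto simp: L2_def)

lemma L2_mult:
  assumes "f \<in> L2 M" "g \<in> L2 M"
  shows "integrable M (\<lambda>x. f x * g x)"
proof (rule Bochner_Integration.integrable_bound)
  note [measurable] = L2D(1)[OF assms(1)] L2D(1)[OF assms(2)]
  show "integrable M (\<lambda>x. (f x)\<^sup>2 + (g x)\<^sup>2)" 
    using L2D(2)[OF assms(1)] L2D(2)[OF assms(2)] by simp
  show "(\<lambda>x. f x * g x) \<in> borel_measurable M" by measurable
  have "\<bar>f x * g x\<bar> \<le> (f x)\<^sup>2 + (g x)\<^sup>2" for x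
  proof -
    have "2 * (\<bar>f x\<bar> * \<bar>g x\<bar>) \<le> (f x)\<^sup>2 + (g x)\<^sup>2"
      using sum_squares_bound[of "\<bar>f x\<bar>" "\<bar>g x\<bar>"] by simp
    moreover have "0 \<le> \<bar>f x\<bar> * \<bar>g x\<bar>" by simp
    ultimately show ?thesis unfolding abs_mult by linarith
  qed
  then show "AE x in M. norm (f x * g x) \<le> norm ((f x)\<^sup>2 + (g x)\<^sup>2)" by simp
qed

lemma L2_dominated:
  assumes g: "g \<in> L2 M" and f: "f \<in> borel_measurable M" and le: "AE x in M. \<bar>f x\<bar> \<le> \<bar>g x\<bar>"
  shows "f \<in> L2 M"
proof -
  have "integrable M (\<lambda>x. (f x)\<^sup>2)"
  proof (rule Bochner_Integration.integrable_bound)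
    show "integrable M (\<lambda>x. (g x)\<^sup>2)" using g by (rule L2D)
    show "AE x in M. norm ((f x)\<^sup>2) \<le> norm ((g x)\<^sup>2)" using le by eventually_elim (simp add: abs_le_square_iff)
  qed (use f in measurable)
  then show ?thesis using f by (simp add: L2_def)
qed

lemma L2_lin:
  assumes "f \<in> L2 M" "g \<in> L2 M"
  shows "(\<lambda>x. a * f x + b * g x) \<in> L2 M"
proof -
  note [measurable] = L2D(1)[OF assms(1)] L2D(1)[OF assms(2)]
  have "integrable M (\<lambda>x. a\<^sup>2 * (f x)\<^sup>2 + (2 * a * b) * (f x * g x) + b\<^sup>2 * (g x)\<^sup>2)"
    using L2_mult[OF assms] L2D(2)[OF assms(1)] L2D(2)[OF assms(2)] by simp
  also have "(\<lambda>x. a\<^sup>2 * (f x)\<^sup>2 + (2 * a * b) * (f x * g x) + b\<^sup>2 * (g x)\<^sup>2) = (\<lambda>x. (a * f x + b * g x)\<^sup>2)"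
    by (auto simp: power2_eq_square algebra_simps)
  finally show ?thesis by (simp add: L2_def)
qed

lemma L2_add: "f \<in> L2 M \<Longrightarrow> g \<in> L2 M \<Longrightarrow> (\<lambda>x. f x + g x) \<in> L2 M"
  using L2_lin[of f M g 1 1] by simp

lemma L2_diff: "f \<in> L2 M \<Longrightarrow> g \<in> L2 M \<Longrightarrow> (\<lambda>x. f x - g x) \<in> L2 M"
  using L2_lin[of f M g 1 "-1"] by simp

lemma L2_scale: "f \<in> L2 M \<Longrightarrow> (\<lambda>x. a * f x) \<in> L2 M"
  using L2_lin[of f M f a 0] by simp

lemma L2_divide: "f \<in> L2 M \<Longrightarrow> (\<lambda>x. f x / a) \<in> L2 M"
  using L2_scale[of f M "1/a"] by simp

lemma L2_zero: "(\<lambda>x. 0) \<in> L2 M"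
  by (simp add: L2_def)

lemma L2_abs: "f \<in> L2 M \<Longrightarrow> (\<lambda>x. \<bar>f x\<bar>) \<in> L2 M"
  by (rule L2_dominated) (auto dest: L2D(1))

text \<open>Reduces lattice operations to sums and absolute values, the operations in the order
  preserving inequality.\<close>

lemma min_max_real:
  "min a b = (a + b) / 2 - \<bar>(a - b) / 2\<bar>" "max a b = (a + b) / 2 + \<bar>(a - b) / 2\<bar>" for a b :: real
  by (auto simp: min_def max_def abs_if field_simps)

lemma L2_min: "f \<in> L2 M \<Longrightarrow> g \<in> L2 M \<Longrightarrow> (\<lambda>x. min (f x) (g x)) \<in> L2 M"
  unfolding min_max_real by (intro L2_add L2_diff L2_divide L2_abs)

lemma L2_max: "f \<in> L2 M \<Longrightarrow> g \<in> L2 M \<Longrightarrow> (\<lambda>x. max (f x) (g x)) \<in> L2 M"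
  unfolding min_max_real by (intro L2_add L2_diff L2_divide L2_abs)

lemma integral_square_nonpos_imp_AE:
  assumes "d \<in> L2 M" "(\<integral>x. (d x)\<^sup>2 \<partial>M) \<le> 0"
  shows "AE x in M. d x = 0"
proof -
  have "(\<integral>x. (d x)\<^sup>2 \<partial>M) = 0" using assms(2) by (intro antisym) auto
  then have "AE x in M. (d x)\<^sup>2 = 0" using L2D(2)[OF assms(1)] by (subst (asm) integral_nonneg_eq_0_iff_AE) auto
  then show ?thesis by simp
qed

text \<open>The error \<open>t * c\<close> arises as the quadratic remainder in the first variation
  of the resolvent problem.\<close>

lemma le_of_le_add_small:
  fixes a b c :: real
  assumes "\<And>t. 0 < t \<Longrightarrow> t \<le> 1 \<Longrightarrow> a \<le> b + t * c"
  shows "a \<le> b"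
proof (rule ccontr)
  assume "\<not> a \<le> b"
  then have d: "a - b > 0" by simp
  \<comment> \<open>Makes \<open>t * c\<close> at most half of the gap \<open>a - b\<close>; the
    summand 1 guards against \<open>c = 0\<close>.\<close>
  define t where "t = min 1 ((a - b) / (2 * (\<bar>c\<bar> + 1)))"
  have t: "0 < t" "t \<le> 1" using d by (auto simp: t_def)
  have "t * c \<le> t * (\<bar>c\<bar> + 1)" using t by (intro mult_left_mono) auto
  also have "\<dots> \<le> (a - b) / (2 * (\<bar>c\<bar> + 1)) * (\<bar>c\<bar> + 1)" by (intro mult_right_mono) (auto simp: t_def)
  also have "\<dots> = (a - b) / 2" by (simp add: field_simps)
  finally have "t * c \<le> (a - b) / 2" .
  with assms[OF t] d show False by simp
qed

lemma ennreal_lincomb: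
  "0 \<le> t \<Longrightarrow> 0 \<le> s \<Longrightarrow> 0 \<le> a \<Longrightarrow> 0 \<le> b \<Longrightarrow>
    ennreal t * ennreal a + ennreal s * ennreal b = ennreal (t * a + s * b)"
  by (simp add: ennreal_mult ennreal_plus)

lemma one_over_Suc_tendsto: "(\<lambda>n. 1 / real (Suc n)) \<longlonglongrightarrow> 0"
  by (rule LIMSEQ_Suc[OF lim_1_over_n])

text \<open>Tail infima increase, so both lower limits are suprema over one common index, where the
  termwise bound applies.\<close>

lemma ennreal_liminf_superadd:
  fixes a b :: "nat \<Rightarrow> ennreal"
  assumes "\<And>n. a n + b n \<le> c"
  shows "liminf a + liminf b \<le> c"
proof -
  have "liminf a + liminf b = (SUP n. (INF m\<in>{n..}. a m) + (INF m\<in>{n..}. b m))"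
    unfolding liminf_SUP_INF
    by (rule ennreal_SUP_add[symmetric]; unfold incseq_def; intro allI impI INF_superset_mono) simp_all
  also have "\<dots> \<le> c"
  proof (rule SUP_least)
    fix n
    have "(INF m\<in>{n..}. a m) + (INF m\<in>{n..}. b m) \<le> a n + b n"
      by (intro add_mono INF_lower) auto
    then show "(INF m\<in>{n..}. a m) + (INF m\<in>{n..}. b m) \<le> c" using assms order_trans by blast
  qed
  finally show ?thesis .
qed

lemma liminf_le_const:
  fixes a :: "nat \<Rightarrow> ennreal"
  assumes "\<And>n. a n \<le> c"
  shows "liminf a \<le> c"
  using Liminf_mono[of a "\<lambda>_. c" sequentially] assms by (simp add: Liminf_const)

text \<open>On a set of finite measure the indicators of the deviation sets have an integrable
  majorant and tend to 0 almost everywhere.\<close>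

lemma AE_imp_loc_conv_in_measure:
  assumes gs [measurable]: "\<And>n. gs n \<in> borel_measurable M" and f [measurable]: "f \<in> borel_measurable M"
    and lim: "AE x in M. (\<lambda>n. gs n x) \<longlonglongrightarrow> f x"
  shows "loc_conv_in_measure M gs f"
  unfolding loc_conv_in_measure_def
proof (intro ballI impI allI)
  fix A and e :: real assume A [measurable]: "A \<in> sets M" and fin: "emeasure M A < \<infinity>" and e: "e > 0"
  let ?S = "\<lambda>n. {x\<in>A. e < \<bar>gs n x - f x\<bar>}"
  have S: "?S n \<in> sets M" for n
  proof -
    have "?S n = A \<inter> {x\<in>space M. e < \<bar>gs n x - f x\<bar>}" using sets.sets_into_space[OF A] by auto
    then show ?thesis by simp
  qed
  have "(\<lambda>n. \<integral>\<^sup>+x. indicator (?S n) x \<partial>M) \<longlonglongrightarrow> (\<integral>\<^sup>+x. 0 \<partial>M)"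
  proof (rule nn_integral_dominated_convergence[where w = "indicator A"])
    show "(\<lambda>x. indicator (?S n) x) \<in> borel_measurable M" for n using S by simp
    show "AE x in M. indicator (?S n) x \<le> (indicator A x :: ennreal)" for n
      by (intro AE_I2) (auto simp: indicator_def)
    show "(\<integral>\<^sup>+x. indicator A x \<partial>M) < \<infinity>" using fin by simp
    show "AE x in M. (\<lambda>n. indicator (?S n) x) \<longlonglongrightarrow> (0::ennreal)"
      using lim
    proof eventually_elim
      case (elim x)
      then have "eventually (\<lambda>n. \<bar>gs n x - f x\<bar> < e) sequentially"
        using e by (auto dest: tendstoD simp: dist_real_def)
      then have "eventually (\<lambda>n. indicator (?S n) x = (0::ennreal)) sequentially"
        by eventually_elim (auto simp: indicator_def)
      then show ?case by (rule tendsto_eventually)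
    qed
  qed simp_all
  then show "(\<lambda>n. emeasure M (?S n)) \<longlonglongrightarrow> 0" using S by simp
qed

text \<open>Capping at 1 gives \<open>w^2 \<le> w\<close>, which later makes the weight square
  integrable too.\<close>

lemma (in sigma_finite_measure) obtain_weight:
  obtains w :: "'a \<Rightarrow> real" where "w \<in> borel_measurable M" "\<And>x. 0 \<le> w x" "\<And>x. w x \<le> 1"
    "\<And>x. x \<in> space M \<Longrightarrow> 0 < w x" "integrable M w"
proof -
  obtain h where h [measurable]: "h \<in> borel_measurable M" and fin: "integral\<^sup>N M h \<noteq> \<infinity>"
    and pos: "\<And>x. x \<in> space M \<Longrightarrow> 0 < h x \<and> h x < \<infinity>"
    using Ex_finite_integrable_function by blast
  let ?w = "\<lambda>x. min 1 (enn2real (h x))"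
  have "integrable M ?w"
  proof (rule integrableI_bounded)
    have "(\<integral>\<^sup>+x. ennreal (norm (?w x)) \<partial>M) \<le> integral\<^sup>N M h"
    proof (rule nn_integral_mono)
      fix x assume "x \<in> space M"
      then have "h x < \<infinity>" using pos by blast
      then have "ennreal (enn2real (h x)) = h x" by simp
      moreover have "ennreal (norm (?w x)) \<le> ennreal (enn2real (h x))" by (intro ennreal_leI) (simp add: min_def)
      ultimately show "ennreal (norm (?w x)) \<le> h x" by simp
    qed
    then show "(\<integral>\<^sup>+x. ennreal (norm (?w x)) \<partial>M) < \<infinity>" using fin by (simp add: less_top top_unique)
  qed simp
  moreover have "0 < ?w x" if "x \<in> space M" for x
    using pos[OF that] by (simp add: enn2real_positive_iff less_top)
  ultimately show ?thesis by (intro that[of ?w]) auto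
qed

locale weighted_measure =
  fixes M :: "'a measure" and w :: "'a \<Rightarrow> real"
  assumes w_meas [measurable]: "w \<in> borel_measurable M"
    and w_nonneg: "\<And>x. 0 \<le> w x" and w_le1: "\<And>x. w x \<le> 1"
    and w_pos: "\<And>x. x \<in> space M \<Longrightarrow> 0 < w x" and w_int: "integrable M w"
begin

text \<open>\<open>rho\<close> metrizes local convergence in measure.\<close>

definition rho :: "('a \<Rightarrow> real) \<Rightarrow> real" where
  "rho d = (\<integral>x. w x * min 1 \<bar>d x\<bar> \<partial>M)"

lemma w_L2: "w \<in> L2 M"
proof -
  have "integrable M (\<lambda>x. (w x)\<^sup>2)"
  proof (rule Bochner_Integration.integrable_bound[OF w_int])
    have "(w x)\<^sup>2 \<le> w x" for x
      using mult_mono[OF order_refl w_le1[of x] w_nonneg[of x]] w_nonneg[of x] by (simp add: power2_eq_square)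
    then show "AE x in M. norm ((w x)\<^sup>2) \<le> norm (w x)" using w_nonneg by simp
  qed simp
  then show ?thesis by (simp add: L2_def)
qed

lemma rho_integrable:
  assumes [measurable]: "d \<in> borel_measurable M"
  shows "integrable M (\<lambda>x. w x * min 1 \<bar>d x\<bar>)"
proof (rule Bochner_Integration.integrable_bound[OF w_int])
  show "AE x in M. norm (w x * min 1 \<bar>d x\<bar>) \<le> norm (w x)"
    using w_nonneg by (intro AE_I2) (auto simp: abs_mult min_def mult_left_le)
qed simp

lemma rho_nonneg: "0 \<le> rho d"
  unfolding rho_def using w_nonneg by (intro integral_nonneg_AE AE_I2) auto

lemma AE_imp_rho_tendsto:
  assumes ds [measurable]: "\<And>n. ds n \<in> borel_measurable M" and lim: "AE x in M. (\<lambda>n. ds n x) \<longlonglongrightarrow> 0"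
  shows "(\<lambda>n. rho (ds n)) \<longlonglongrightarrow> 0"
proof -
  have "(\<lambda>n. \<integral>x. w x * min 1 \<bar>ds n x\<bar> \<partial>M) \<longlonglongrightarrow> (\<integral>x. 0 \<partial>M)"
  proof (rule integral_dominated_convergence[OF _ _ w_int])
    show "AE x in M. (\<lambda>n. w x * min 1 \<bar>ds n x\<bar>) \<longlonglongrightarrow> 0"
      using lim
    proof eventually_elim
      case (elim x)
      then have "(\<lambda>n. w x * min 1 \<bar>ds n x\<bar>) \<longlonglongrightarrow> w x * min 1 \<bar>0\<bar>" by (intro tendsto_intros)
      then show ?case by simp
    qed
    show "AE x in M. norm (w x * min 1 \<bar>ds n x\<bar>) \<le> w x" for n
      using w_nonneg by (intro AE_I2) (auto simp: abs_mult min_def mult_left_le)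
  qed simp_all
  then show ?thesis unfolding rho_def by simp
qed

lemma rho_tendsto_imp_AE_subseq:
  assumes ds [measurable]: "\<And>n. ds n \<in> borel_measurable M" and lim: "(\<lambda>n. rho (ds n)) \<longlonglongrightarrow> 0"
  obtains r :: "nat \<Rightarrow> nat" where "strict_mono r" "AE x in M. (\<lambda>n. ds (r n) x) \<longlonglongrightarrow> 0"
proof -
  have eq: "norm (w x * min 1 \<bar>ds n x\<bar>) = w x * min 1 \<bar>ds n x\<bar>" for n x
    using w_nonneg[of x] by simp
  have "\<exists>r::nat\<Rightarrow>nat. strict_mono r \<and> (AE x in M. (\<lambda>n. w x * min 1 \<bar>ds (r n) x\<bar>) \<longlonglongrightarrow> 0)"
  proof (rule tendsto_L1_AE_subseq)
    show "(\<lambda>n. LINT x|M. norm (w x * min 1 \<bar>ds n x\<bar>)) \<longlonglongrightarrow> 0"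
      unfolding eq using lim by (simp add: rho_def)
  qed (rule rho_integrable[OF ds])
  then obtain r :: "nat \<Rightarrow> nat" where r: "strict_mono r"
    and "AE x in M. (\<lambda>n. w x * min 1 \<bar>ds (r n) x\<bar>) \<longlonglongrightarrow> 0" by blast
  from this(2) have "AE x in M. (\<lambda>n. ds (r n) x) \<longlonglongrightarrow> 0"
    using AE_space
  proof eventually_elim
    case (elim x)
    have "(\<lambda>n. (1 / w x) * (w x * min 1 \<bar>ds (r n) x\<bar>)) \<longlonglongrightarrow> (1 / w x) * 0"
      by (intro tendsto_mult_left elim)
    then have m: "(\<lambda>n. min 1 \<bar>ds (r n) x\<bar>) \<longlonglongrightarrow> 0" using w_pos[OF elim(2)] by simp
    \<comment> \<open>Once the truncated value is below 1 the truncation is inactive and can be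
      removed from the limit.\<close>
    then have "eventually (\<lambda>n. min 1 \<bar>ds (r n) x\<bar> < 1) sequentially" by (rule order_tendstoD) simp
    then have "eventually (\<lambda>n. min 1 \<bar>ds (r n) x\<bar> = \<bar>ds (r n) x\<bar>) sequentially"
      by eventually_elim auto
    then have "(\<lambda>n. \<bar>ds (r n) x\<bar>) \<longlonglongrightarrow> 0" using m tendsto_cong by fast
    then show ?case by (rule tendsto_rabs_zero_cancel)
  qed
  with r show ?thesis by (rule that)
qed

text \<open>The set where \<open>w\<close> is small contributes little and its complement
  \<open>A\<close> has finite measure. On \<open>A\<close> the deviation is at most \<open>e\<close>
  outside a set of small measure.\<close>

lemma loc_conv_imp_rho_tendsto:
  assumes gs [measurable]: "\<And>n. gs n \<in> borel_measurable M" and f [measurable]: "f \<in> borel_measurable M"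
    and lim: "loc_conv_in_measure M gs f"
  shows "(\<lambda>n. rho (\<lambda>x. gs n x - f x)) \<longlonglongrightarrow> 0"
proof (rule LIMSEQ_I)
  fix r :: real assume r: "0 < r"
  define W where "W = (\<integral>x. w x \<partial>M)"
  have W: "W \<ge> 0" unfolding W_def using w_nonneg by simp
  \<comment> \<open>Three contributions of size \<open>r/3\<close>: small weight, deviation at most
    \<open>e\<close> (in total \<open>e * W\<close>), large deviation. The summand 1 avoids division
    by 0.\<close>
  define e where "e = r / (3 * (W + 1))"
  have e: "e > 0" using r W by (simp add: e_def)
  define B where "B k = {x\<in>space M. w x < 1 / real (Suc k)}" for k
  have B [measurable]: "B k \<in> sets M" for k unfolding B_def by measurable
  have "(\<lambda>k. \<integral>x. indicator (B k) x * w x \<partial>M) \<longlonglongrightarrow> (\<integral>x. 0 \<partial>M)"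
  proof (rule integral_dominated_convergence[OF _ _ w_int])
    show "AE x in M. (\<lambda>k. indicator (B k) x * w x) \<longlonglongrightarrow> 0"
    proof (rule AE_I2)
      fix x assume "x \<in> space M"
      then have "w x > 0" by (rule w_pos)
      have "eventually (\<lambda>k. 1 / real (Suc k) < w x) sequentially"
        by (rule order_tendstoD(2)[OF LIMSEQ_inverse_real_of_nat[unfolded inverse_eq_divide] \<open>w x > 0\<close>])
      then have "eventually (\<lambda>k. indicator (B k) x * w x = 0) sequentially"
        by eventually_elim (auto simp: B_def indicator_def)
      then show "(\<lambda>k. indicator (B k) x * w x) \<longlonglongrightarrow> 0" by (rule tendsto_eventually)
    qed
    show "AE x in M. norm (indicator (B k) x * w x) \<le> w x" for k
      using w_nonneg by (intro AE_I2) (auto simp: indicator_def)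
  qed simp_all
  then have "eventually (\<lambda>k. (\<integral>x. indicator (B k) x * w x \<partial>M) < r/3) sequentially"
    using r by (intro order_tendstoD(2)[of _ 0]) auto
  then obtain k where k: "(\<integral>x. indicator (B k) x * w x \<partial>M) < r/3" by (auto simp: eventually_sequentially)
  define A where "A = space M - B k"
  have A [measurable]: "A \<in> sets M" unfolding A_def by measurable
  have finA: "emeasure M A < \<infinity>"
  proof -
    have "emeasure M A = (\<integral>\<^sup>+x. indicator A x \<partial>M)" by simp
    \<comment> \<open>Markov's inequality: \<open>w\<close> is at least \<open>1 / (k + 1)\<close>
      on \<open>A\<close>.\<close>
    also have "\<dots> \<le> (\<integral>\<^sup>+x. ennreal (real (Suc k) * w x) \<partial>M)"
    proof (rule nn_integral_mono)
      fix x assume "x \<in> space M"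
      show "indicator A x \<le> ennreal (real (Suc k) * w x)"
      proof (cases "x \<in> A")
        case True
        then have "1 \<le> real (Suc k) * w x" by (auto simp: A_def B_def field_simps)
        then have "ennreal 1 \<le> ennreal (real (Suc k) * w x)" by (rule ennreal_leI)
        then show ?thesis using True by simp
      qed simp
    qed
    also have "\<dots> < \<infinity>"
    proof -
      have "integrable M (\<lambda>x. real (Suc k) * w x)" using w_int by simp
      then show ?thesis using w_nonneg by (subst nn_integral_eq_integral) auto
    qed
    finally show ?thesis .
  qed
  let ?S = "\<lambda>n. {x\<in>A. e < \<bar>gs n x - f x\<bar>}"
  have S [measurable]: "?S n \<in> sets M" for n
  proof -
    have "?S n = A \<inter> {x\<in>space M. e < \<bar>gs n x - f x\<bar>}" using sets.sets_into_space[OF A] by auto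
    then show ?thesis by simp
  qed
  have finS: "emeasure M (?S n) < \<infinity>" for n
  proof -
    have "emeasure M (?S n) \<le> emeasure M A" by (intro emeasure_mono) auto
    then show ?thesis using finA by (rule le_less_trans)
  qed
  have "(\<lambda>n. emeasure M (?S n)) \<longlonglongrightarrow> 0"
    using lim A finA e unfolding loc_conv_in_measure_def by blast
  then have "eventually (\<lambda>n. emeasure M (?S n) < ennreal (r/3)) sequentially"
    using r by (auto dest!: order_tendstoD(2))
  then obtain N where N: "\<And>n. n \<ge> N \<Longrightarrow> emeasure M (?S n) < ennreal (r/3)"
    by (auto simp: eventually_sequentially)
  have "norm (rho (\<lambda>x. gs n x - f x) - 0) < r" if n: "n \<ge> N" for n
  proof -
    have mS: "measure M (?S n) < r/3" 
    proof -
      have "emeasure M (?S n) = ennreal (measure M (?S n))"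
        using finS[of n] by (intro emeasure_eq_ennreal_measure) auto
      then show ?thesis using N[OF n] by (simp add: ennreal_less_iff)
    qed
    have bnd: "w x * min 1 \<bar>gs n x - f x\<bar> \<le> indicator (B k) x * w x + e * w x + indicator (?S n) x"
      if x: "x \<in> space M" for x
    proof -
      have w: "0 \<le> w x" "w x \<le> 1" using w_nonneg w_le1 by auto
      consider "x \<in> B k" | "x \<in> ?S n" | "x \<notin> B k" "\<bar>gs n x - f x\<bar> \<le> e" 
        using x by (cases "x \<in> B k"; cases "e < \<bar>gs n x - f x\<bar>") (auto simp: A_def not_less)
      then show ?thesis
      proof cases
        case 1
        have "w x * min 1 \<bar>gs n x - f x\<bar> \<le> w x * 1" using w by (intro mult_left_mono) auto
        moreover have "0 \<le> e * w x" "0 \<le> (indicator (?S n) x :: real)" using w e by simp_all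
        moreover have "indicator (B k) x * w x = w x" using 1 by simp
        ultimately show ?thesis by linarith
      next
        case 2
        have "w x * min 1 \<bar>gs n x - f x\<bar> \<le> 1 * 1" using w by (intro mult_mono) auto
        moreover have "0 \<le> e * w x" "0 \<le> indicator (B k) x * w x" using w e by simp_all
        moreover have "(indicator (?S n) x :: real) = 1" using 2 by simp
        ultimately show ?thesis by linarith
      next
        case 3
        have "w x * min 1 \<bar>gs n x - f x\<bar> \<le> w x * e" using w 3 by (intro mult_left_mono) auto
        moreover have "0 \<le> indicator (B k) x * w x" "0 \<le> (indicator (?S n) x :: real)" using w by simp_all
        ultimately show ?thesis unfolding mult.commute[of "w x" e] by linarith
      qed
    qed
    have iB: "integrable M (\<lambda>x. indicator (B k) x * w x)"
      using integrable_mult_indicator[OF B w_int] by simp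
    have iS: "integrable M (\<lambda>x. indicator (?S n) x :: real)"
      using finS[of n] by (intro integrable_real_indicator S)
    have "rho (\<lambda>x. gs n x - f x) \<le> (\<integral>x. indicator (B k) x * w x + e * w x + indicator (?S n) x \<partial>M)"
      unfolding rho_def
      by (intro integral_mono rho_integrable Bochner_Integration.integrable_add iB iS integrable_mult_right w_int bnd)
        simp_all
    also have "\<dots> = (\<integral>x. indicator (B k) x * w x \<partial>M) + e * W + measure M (?S n)"
      using iB iS w_int by (simp add: W_def)
    also have "\<dots> < r"
    proof -
      have "e * W \<le> r/3" using W r by (simp add: e_def field_simps)
      then show ?thesis using k mS by simp
    qed
    finally show ?thesis using rho_nonneg by simp
  qed
  then show "\<exists>no. \<forall>n\<ge>no. norm (rho (\<lambda>x. gs n x - f x) - 0) < r" by blast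
qed

text \<open>Multiplication by the square integrable \<open>w\<close> turns a Cauchy sequence of L2
  into one of L1, which has an almost everywhere Cauchy subsequence; division by
  \<open>w > 0\<close> recovers \<open>u\<close>.\<close>

lemma L2_Cauchy_AE_subseq:
  fixes u :: "nat \<Rightarrow> 'a \<Rightarrow> real"
  assumes us: "\<And>n. u n \<in> L2 M"
    and C: "\<And>e. e > 0 \<Longrightarrow> \<exists>N. \<forall>i\<ge>N. \<forall>j\<ge>N. (\<integral>x. (u i x - u j x)\<^sup>2 \<partial>M) < e"
  obtains r v where "strict_mono r" "v \<in> borel_measurable M" "AE x in M. (\<lambda>n. u (r n) x) \<longlonglongrightarrow> v x"
proof -
  note [measurable] = L2D(1)[OF us]
  define W where "W = (\<integral>x. (w x)\<^sup>2 \<partial>M)"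
  have W: "W \<ge> 0" by (simp add: W_def)
  obtain r where r: "strict_mono r" and "AE x in M. Cauchy (\<lambda>i. w x * u (r i) x)"
  proof (rule cauchy_L1_AE_cauchy_subseq[where s = "\<lambda>n x. w x * u n x" and M = M])
    show "integrable M (\<lambda>x. w x * u n x)" for n by (rule L2_mult[OF w_L2 us])
    fix e :: real assume e: "e > 0"
    \<comment> \<open>Balances the two AM-GM terms: \<open>c/2 * W \<le> e/2\<close>, and a squared
      distance below \<open>c * e\<close> contributes less than \<open>e/2\<close>.\<close>
    define c where "c = e / (W + 1)"
    have c: "c > 0" using e W by (simp add: c_def)
    obtain N where N: "\<And>i j. i \<ge> N \<Longrightarrow> j \<ge> N \<Longrightarrow> (\<integral>x. (u i x - u j x)\<^sup>2 \<partial>M) < c * e"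
      using C[of "c * e"] c e by auto
    have "(LINT x|M. norm (w x * u i x - w x * u j x)) < e" if "i \<ge> N" "j \<ge> N" for i j
    proof -
      have iu: "integrable M (\<lambda>x. (u i x - u j x)\<^sup>2)" by (rule L2D(2)[OF L2_diff[OF us us]])
      have iw: "integrable M (\<lambda>x. (w x)\<^sup>2)" by (rule L2D(2)[OF w_L2])
      \<comment> \<open>AM-GM: \<open>2 w d \<le> c w\<^sup>2 + d\<^sup>2 / c\<close>\<close>
      have "(LINT x|M. norm (w x * u i x - w x * u j x)) \<le> (LINT x|M. c/2 * (w x)\<^sup>2 + 1/(2*c) * (u i x - u j x)\<^sup>2)"
      proof (rule integral_mono)
        show "integrable M (\<lambda>x. norm (w x * u i x - w x * u j x))"
          using L2_mult[OF w_L2 us] by (intro integrable_norm Bochner_Integration.integrable_diff)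
        show "integrable M (\<lambda>x. c/2 * (w x)\<^sup>2 + 1/(2*c) * (u i x - u j x)\<^sup>2)" using iu iw by simp
        fix x
        define d where "d = \<bar>u i x - u j x\<bar>"
        have "0 \<le> (c * w x - d)\<^sup>2" by simp
        then have "2 * c * (w x * d) \<le> c * c * (w x)\<^sup>2 + d\<^sup>2" by (simp add: power2_eq_square algebra_simps)
        then have "w x * d \<le> c/2 * (w x)\<^sup>2 + 1/(2*c) * d\<^sup>2" using c by (simp add: field_simps)
        moreover have "norm (w x * u i x - w x * u j x) = w x * d"
          using w_nonneg[of x] by (simp add: d_def right_diff_distrib[symmetric] abs_mult)
        ultimately show "norm (w x * u i x - w x * u j x) \<le> c/2 * (w x)\<^sup>2 + 1/(2*c) * (u i x - u j x)\<^sup>2"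
          by (simp add: d_def)
      qed
      also have "\<dots> = c/2 * W + 1/(2*c) * (\<integral>x. (u i x - u j x)\<^sup>2 \<partial>M)" using iu iw by (simp add: W_def)
      also have "\<dots> < e/2 + e/2"
      proof (rule add_le_less_mono)
        show "c/2 * W \<le> e/2" using W e by (simp add: c_def field_simps)
        show "1/(2*c) * (\<integral>x. (u i x - u j x)\<^sup>2 \<partial>M) < e/2" using N[OF that] c by (simp add: field_simps)
      qed
      finally show ?thesis by simp
    qed
    then show "\<exists>N. \<forall>i\<ge>N. \<forall>j\<ge>N. (LINT x|M. norm (w x * u i x - w x * u j x)) < e" by blast
  qed
  define v where "v x = lim (\<lambda>n. u (r n) x)" for x
  have [measurable]: "v \<in> borel_measurable M" unfolding v_def by measurable
  have "AE x in M. (\<lambda>n. u (r n) x) \<longlonglongrightarrow> v x"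
    using \<open>AE x in M. Cauchy (\<lambda>i. w x * u (r i) x)\<close> AE_space
  proof eventually_elim
    case (elim x)
    then have "convergent (\<lambda>i. w x * u (r i) x)" by (simp add: Cauchy_convergent_iff)
    then obtain l where "(\<lambda>i. w x * u (r i) x) \<longlonglongrightarrow> l" by (auto simp: convergent_def)
    then have "(\<lambda>i. (1 / w x) * (w x * u (r i) x)) \<longlonglongrightarrow> (1 / w x) * l" by (intro tendsto_mult_left)
    then have "(\<lambda>i. u (r i) x) \<longlonglongrightarrow> l / w x" using w_pos[OF elim(2)] by simp
    then show ?case unfolding v_def by (simp add: convergent_LIMSEQ_iff[symmetric] convergent_def) blast
  qed
  with r show ?thesis by (intro that) auto
qed

end

section \<open>The extended form and resolvents\<close>

locale extended_form = weighted_measure M w for M :: "'a measure" and w +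
  fixes E :: "('a \<Rightarrow> real) \<Rightarrow> ennreal"
  assumes form: "nonlinear_order_preserving_form M E" and ext: "extended_form_exists M E"
begin

abbreviation Ee :: "('a \<Rightarrow> real) \<Rightarrow> ennreal" where "Ee \<equiv> E_ext M E"

lemma form_outside: "f \<notin> L2 M \<Longrightarrow> E f = \<infinity>"
  using form unfolding nonlinear_order_preserving_form_def by blast

lemma form_finite_L2: "E f < \<infinity> \<Longrightarrow> f \<in> L2 M"
  using form_outside by fastforce

lemma form_minus: "E (\<lambda>x. - f x) = E f"
  using form unfolding nonlinear_order_preserving_form_def by blast

lemma form_zero: "E (\<lambda>x. 0) = 0"
  using form unfolding nonlinear_order_preserving_form_def by blast

text \<open>Off L2 the right-hand side is infinite only for \<open>0 < t < 1\<close>: in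
  \<open>ennreal\<close> the product of 0 and infinity is 0, so the endpoints are treated
  apart.\<close>

lemma form_convex:
  assumes t: "0 \<le> t" "t \<le> 1"
  shows "E (\<lambda>x. t * f x + (1 - t) * g x) \<le> ennreal t * E f + ennreal (1 - t) * E g"
proof -
  consider "t = 0" | "t = 1" | "0 < t" "t < 1" using t by linarith
  then show ?thesis
  proof cases
    case 3
    show ?thesis
    proof (cases "f \<in> L2 M \<and> g \<in> L2 M")
      case True
      then show ?thesis using form t unfolding nonlinear_order_preserving_form_def by blast
    next
      case False
      then have "E f = \<infinity> \<or> E g = \<infinity>" using form_outside by blast
      then have "ennreal t * E f + ennreal (1 - t) * E g = \<infinity>"
        using 3 by (auto simp: ennreal_mult_top)
      then show ?thesis by (metis infinity_ennreal_def top_greatest)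
    qed
  qed auto
qed

lemma form_order:
  assumes "f \<in> L2 M" "g \<in> L2 M"
  shows "E (\<lambda>x. f x + \<bar>g x\<bar>) + E (\<lambda>x. f x - \<bar>g x\<bar>) \<le> E (\<lambda>x. f x + g x) + E (\<lambda>x. f x - g x)"
  using form assms unfolding nonlinear_order_preserving_form_def by blast

text \<open>The order preserving inequality at \<open>(f + g)/2\<close> and \<open>(f - g)/2\<close>
  is exactly submodularity.\<close>

lemma form_min_max: "E (\<lambda>x. min (f x) (g x)) + E (\<lambda>x. max (f x) (g x)) \<le> E f + E g"
proof (cases "f \<in> L2 M \<and> g \<in> L2 M")
  case True
  let ?a = "\<lambda>x. (f x + g x) / 2" and ?b = "\<lambda>x. (f x - g x) / 2"
  have "?a \<in> L2 M" "?b \<in> L2 M" using True by (auto intro: L2_add L2_diff L2_divide)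
  from form_order[OF this] have "E (\<lambda>x. ?a x + \<bar>?b x\<bar>) + E (\<lambda>x. ?a x - \<bar>?b x\<bar>) \<le> E (\<lambda>x. ?a x + ?b x) + E (\<lambda>x. ?a x - ?b x)" .
  moreover have "(\<lambda>x. ?a x + ?b x) = f" "(\<lambda>x. ?a x - ?b x) = g" by (auto simp: field_simps)
  ultimately show ?thesis unfolding min_max_real by (simp add: add.commute)
next
  case False
  then have "E f = \<infinity> \<or> E g = \<infinity>" using form_outside by blast
  then show ?thesis by auto
qed

text \<open>Submodularity for \<open>f\<close> and \<open>-f\<close>, whose minimum is
  \<open>-|f|\<close>; by evenness both sides are doubled.\<close>

lemma form_abs: "E (\<lambda>x. \<bar>f x\<bar>) \<le> E f"
proof -
  have "E (\<lambda>x. min (f x) (- f x)) + E (\<lambda>x. max (f x) (- f x)) \<le> E f + E (\<lambda>x. - f x)"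
    by (rule form_min_max)
  moreover have "(\<lambda>x. max (f x) (- f x)) = (\<lambda>x. \<bar>f x\<bar>)" "(\<lambda>x. min (f x) (- f x)) = (\<lambda>x. - \<bar>f x\<bar>)"
    by (auto simp: min_def max_def)
  ultimately have "E (\<lambda>x. \<bar>f x\<bar>) + E (\<lambda>x. \<bar>f x\<bar>) \<le> E f + E f"
    using form_minus[of f] form_minus[of "\<lambda>x. \<bar>f x\<bar>"] by simp
  then have "2 * E (\<lambda>x. \<bar>f x\<bar>) \<le> 2 * E f" by (simp add: mult_2)
  then show ?thesis by (subst (asm) ennreal_mult_le_mult_iff) auto
qed

section \<open>The relaxed form: recovery sequences, semicontinuity and lattice inequalities\<close>

lemma Ee_L2: "f \<in> L2 M \<Longrightarrow> Ee f = E f"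
  using ext by (simp add: extended_form_exists_def)

lemma Ee_outside: "f \<notin> borel_measurable M \<Longrightarrow> Ee f = \<infinity>"
  by (simp add: E_ext_def)

lemma Ee_finite_measurable: "Ee f < \<infinity> \<Longrightarrow> f \<in> borel_measurable M"
  using Ee_outside by fastforce

lemma Ee_le_liminf:
  assumes "\<And>n. gs n \<in> borel_measurable M" "f \<in> borel_measurable M"
    and "AE x in M. (\<lambda>n. gs n x) \<longlonglongrightarrow> f x"
  shows "Ee f \<le> liminf (\<lambda>n. E (gs n))"
  unfolding E_ext_def using assms AE_imp_loc_conv_in_measure[OF assms]
  by (auto intro!: Inf_lower)

text \<open>A lower limit below \<open>c\<close> leaves infinitely many good indices, and
  \<open>rho\<close> yields an almost everywhere convergent subsequence of them. Finite energy puts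
  its members in L2.\<close>

lemma Ee_approx:
  assumes "Ee f < c"
  obtains gs where "\<And>n. gs n \<in> L2 M" "\<And>n. E (gs n) < c" "AE x in M. (\<lambda>n. gs n x) \<longlonglongrightarrow> f x"
proof -
  have "Ee f < \<infinity>" using order_less_le_trans[OF assms top_greatest] by simp
  then have f [measurable]: "f \<in> borel_measurable M" by (rule Ee_finite_measurable)
  then obtain gs where gs [measurable]: "\<And>n. gs n \<in> borel_measurable M" and lc: "loc_conv_in_measure M gs f"
    and li: "liminf (\<lambda>n. E (gs n)) < c"
    using assms by (auto simp: E_ext_def Inf_less_iff)
  have "\<exists>m\<ge>n. E (gs m) < c" for n
  proof (rule ccontr)
    assume "\<not> ?thesis"
    then have "eventually (\<lambda>m. c \<le> E (gs m)) sequentially"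
      by (auto simp: eventually_sequentially not_less)
    then have "c \<le> liminf (\<lambda>n. E (gs n))" by (rule Liminf_bounded)
    then show False using li by simp
  qed
  then obtain s where s: "\<And>n. s n \<ge> n" "\<And>n. E (gs (s n)) < c" by metis
  have "filterlim s at_top sequentially"
    using s(1) by (intro filterlim_at_top_mono[OF filterlim_ident]) auto
  then have "(\<lambda>n. rho (\<lambda>x. gs (s n) x - f x)) \<longlonglongrightarrow> 0"
    using loc_conv_imp_rho_tendsto[OF gs f lc] by (rule filterlim_compose[rotated])
  then obtain r :: "nat \<Rightarrow> nat" where "AE x in M. (\<lambda>n. gs (s (r n)) x - f x) \<longlonglongrightarrow> 0"
    using rho_tendsto_imp_AE_subseq[of "\<lambda>n x. gs (s n) x - f x"] by auto
  then have "AE x in M. (\<lambda>n. gs (s (r n)) x) \<longlonglongrightarrow> f x"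
    by eventually_elim (simp add: Lim_null[symmetric])
  moreover have "gs (s (r n)) \<in> L2 M" for n
    using order_less_le_trans[OF s(2) top_greatest] by (intro form_finite_L2) simp
  ultimately show ?thesis using s(2) by (intro that[of "\<lambda>n. gs (s (r n))"]) auto
qed

text \<open>Diagonal argument: each \<open>fs n\<close> is replaced by an L2 function of energy
  below \<open>c'\<close> with \<open>rho\<close> of the difference below
  \<open>1 / (n + 1)\<close>.\<close>

lemma Ee_lsc:
  assumes f [measurable]: "f \<in> borel_measurable M" and le: "\<And>n. Ee (fs n) \<le> c"
    and lim: "AE x in M. (\<lambda>n. fs n x) \<longlonglongrightarrow> f x"
  shows "Ee f \<le> c"
proof (rule dense_ge)
  fix c' assume c': "c < c'"
  have "\<exists>g. g \<in> L2 M \<and> E g < c' \<and> fs n \<in> borel_measurable M \<and> rho (\<lambda>x. g x - fs n x) < 1 / real (Suc n)" for n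
  proof -
    have lt: "Ee (fs n) < c'" using le[of n] c' by simp
    have fm [measurable]: "fs n \<in> borel_measurable M"
      using lt Ee_outside[of "fs n"] by (cases "fs n \<in> borel_measurable M") auto
    obtain gs where gs: "\<And>k. gs k \<in> L2 M" "\<And>k. E (gs k) < c'" "AE x in M. (\<lambda>k. gs k x) \<longlonglongrightarrow> fs n x"
      using Ee_approx[OF lt] by blast
    have [measurable]: "\<And>k. gs k \<in> borel_measurable M" using gs(1) L2D by blast
    have "(\<lambda>k. rho (\<lambda>x. gs k x - fs n x)) \<longlonglongrightarrow> 0"
    proof (rule AE_imp_rho_tendsto)
      show "AE x in M. (\<lambda>k. gs k x - fs n x) \<longlonglongrightarrow> 0"
        using gs(3) by eventually_elim (simp add: Lim_null[symmetric])
    qed simp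
    then have "eventually (\<lambda>k. rho (\<lambda>x. gs k x - fs n x) < 1 / real (Suc n)) sequentially"
      by (rule order_tendstoD) simp
    then show ?thesis using gs(1,2) fm by (auto simp: eventually_sequentially)
  qed
  then obtain g where g: "\<And>n. g n \<in> L2 M" "\<And>n. E (g n) < c'" "\<And>n. fs n \<in> borel_measurable M"
    "\<And>n. rho (\<lambda>x. g n x - fs n x) < 1 / real (Suc n)" by metis
  have [measurable]: "\<And>n. g n \<in> borel_measurable M" using g(1) L2D by blast
  note g(3)[measurable]
  have "(\<lambda>n. rho (\<lambda>x. g n x - fs n x)) \<longlonglongrightarrow> 0"
  proof (rule tendsto_sandwich[of "\<lambda>n. 0" _ _ "\<lambda>n. 1 / real (Suc n)"])
    show "(\<lambda>n. 1 / real (Suc n)) \<longlonglongrightarrow> 0" by (rule LIMSEQ_Suc[OF lim_1_over_n])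
  qed (use rho_nonneg less_imp_le[OF g(4)] in simp_all)
  then obtain r :: "nat \<Rightarrow> nat" where r: "strict_mono r" "AE x in M. (\<lambda>n. g (r n) x - fs (r n) x) \<longlonglongrightarrow> 0"
    using rho_tendsto_imp_AE_subseq[of "\<lambda>n x. g n x - fs n x"] by auto
  from r(2) lim have "AE x in M. (\<lambda>n. g (r n) x) \<longlonglongrightarrow> f x"
  proof eventually_elim
    case (elim x)
    have "(\<lambda>n. fs (r n) x) \<longlonglongrightarrow> f x" using LIMSEQ_subseq_LIMSEQ[OF elim(2) r(1)] by (simp add: o_def)
    from tendsto_add[OF elim(1) this] show ?case by simp
  qed
  then have "Ee f \<le> liminf (\<lambda>n. E (g (r n)))" by (intro Ee_le_liminf) auto
  also have "\<dots> \<le> c'" using g(2) less_imp_le by (intro liminf_le_const) blast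
  finally show "Ee f \<le> c'" .
qed

lemma Ee_zero: "Ee (\<lambda>x. 0) = 0"
  by (simp add: Ee_L2 L2_zero form_zero)

text \<open>A transformation that is continuous at each point preserves almost everywhere limits, so
  its energy bound passes to the relaxation. Used for negation, doubling and truncation.\<close>

lemma Ee_superposition_le:
  assumes meas: "\<And>g. g \<in> borel_measurable M \<Longrightarrow> (\<lambda>x. \<tau> x (g x)) \<in> borel_measurable M"
    and cont: "\<And>x y. isCont (\<tau> x) y" and k: "1 \<le> k"
    and le: "\<And>g. E (\<lambda>x. \<tau> x (g x)) \<le> ennreal k * E g"
  shows "Ee (\<lambda>x. \<tau> x (f x)) \<le> ennreal k * Ee f"
proof (cases "Ee f < \<infinity>")
  case True
  show ?thesis
  proof (rule ennreal_le_epsilon)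
    fix e :: real assume e: "0 < e"
    have lt: "Ee f < Ee f + ennreal (e / k)" using True e k by simp
    obtain gs where gs: "\<And>n. gs n \<in> L2 M" "\<And>n. E (gs n) < Ee f + ennreal (e / k)" "AE x in M. (\<lambda>n. gs n x) \<longlonglongrightarrow> f x"
      using Ee_approx[OF lt] by blast
    have "Ee (\<lambda>x. \<tau> x (f x)) \<le> liminf (\<lambda>n. E (\<lambda>x. \<tau> x (gs n x)))"
    proof (rule Ee_le_liminf)
      show "AE x in M. (\<lambda>n. \<tau> x (gs n x)) \<longlonglongrightarrow> \<tau> x (f x)"
        using gs(3) by eventually_elim (rule isCont_tendsto_compose[OF cont])
    qed (intro meas L2D(1) gs(1) Ee_finite_measurable True)+
    also have "\<dots> \<le> ennreal k * (Ee f + ennreal (e / k))"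
      by (intro liminf_le_const order_trans[OF le] mult_left_mono less_imp_le[OF gs(2)]) simp
    also have "\<dots> = ennreal k * Ee f + ennreal e"
      using e k by (simp add: distrib_left ennreal_mult[symmetric])
    finally show "Ee (\<lambda>x. \<tau> x (f x)) \<le> ennreal k * Ee f + ennreal e" .
  qed
next
  case False
  then have "Ee f = top" by (simp add: less_top[symmetric])
  then show ?thesis using k by (simp add: ennreal_mult_top)
qed

lemma Ee_minus: "Ee (\<lambda>x. - f x) = Ee f"
proof -
  have "Ee (\<lambda>x. - f x) \<le> Ee f" for f
    using Ee_superposition_le[of "\<lambda>x y. - y" 1 f] by (simp add: form_minus)
  from this[of f] this[of "\<lambda>x. - f x"] show ?thesis by simp
qed

lemma Ee_convex:
  assumes t: "0 \<le> t" "t \<le> 1"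
  shows "Ee (\<lambda>x. t * f x + (1 - t) * g x) \<le> ennreal t * Ee f + ennreal (1 - t) * Ee g"
proof -
  consider "t = 0" | "t = 1" | "0 < t" "t < 1" using t by linarith
  then show ?thesis
  proof cases
    case 3
    show ?thesis
    proof (cases "Ee f < \<infinity> \<and> Ee g < \<infinity>")
      case True
      then have [measurable]: "f \<in> borel_measurable M" "g \<in> borel_measurable M"
        using Ee_finite_measurable by auto
      show ?thesis
      proof (rule ennreal_le_epsilon)
        fix e :: real assume e: "0 < e"
        have lt: "Ee f < Ee f + ennreal e" "Ee g < Ee g + ennreal e" using True e by auto
        obtain fs where fs: "\<And>k. fs k \<in> L2 M" "\<And>k. E (fs k) < Ee f + ennreal e" "AE x in M. (\<lambda>k. fs k x) \<longlonglongrightarrow> f x"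
          using Ee_approx[OF lt(1)] by blast
        obtain gs where gs: "\<And>k. gs k \<in> L2 M" "\<And>k. E (gs k) < Ee g + ennreal e" "AE x in M. (\<lambda>k. gs k x) \<longlonglongrightarrow> g x"
          using Ee_approx[OF lt(2)] by blast
        have [measurable]: "\<And>k. fs k \<in> borel_measurable M" "\<And>k. gs k \<in> borel_measurable M" using gs(1) fs(1) L2D by blast+
        have "Ee (\<lambda>x. t * f x + (1 - t) * g x) \<le> liminf (\<lambda>k. E (\<lambda>x. t * fs k x + (1 - t) * gs k x))"
        proof (rule Ee_le_liminf)
          show "AE x in M. (\<lambda>k. t * fs k x + (1 - t) * gs k x) \<longlonglongrightarrow> t * f x + (1 - t) * g x"
            using fs(3) gs(3) by eventually_elim (intro tendsto_intros)
        qed auto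
        also have "\<dots> \<le> ennreal t * (Ee f + ennreal e) + ennreal (1 - t) * (Ee g + ennreal e)"
        proof (rule liminf_le_const)
          fix k
          have "E (\<lambda>x. t * fs k x + (1 - t) * gs k x) \<le> ennreal t * E (fs k) + ennreal (1 - t) * E (gs k)"
            by (rule form_convex[OF t])
          also have "\<dots> \<le> ennreal t * (Ee f + ennreal e) + ennreal (1 - t) * (Ee g + ennreal e)"
            by (intro add_mono mult_left_mono less_imp_le[OF fs(2)] less_imp_le[OF gs(2)]) auto
          finally show "E (\<lambda>x. t * fs k x + (1 - t) * gs k x) \<le> \<dots>" .
        qed
        also have "\<dots> = ennreal t * Ee f + ennreal (1 - t) * Ee g + (ennreal t + ennreal (1 - t)) * ennreal e"
          by (simp add: algebra_simps)
        also have "ennreal t + ennreal (1 - t) = 1" using t by (simp add: ennreal_plus[symmetric] del: ennreal_plus)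
        finally show "Ee (\<lambda>x. t * f x + (1 - t) * g x) \<le> ennreal t * Ee f + ennreal (1 - t) * Ee g + ennreal e" by simp
      qed
    next
      case False
      then have "ennreal t * Ee f + ennreal (1 - t) * Ee g = \<infinity>"
        using 3 by (auto simp: ennreal_mult_top less_top[symmetric])
      then show ?thesis by (metis infinity_ennreal_def top_greatest)
    qed
  qed auto
qed

text \<open>Minima and maxima of recovery sequences converge again, and superadditivity of the lower
  limit bounds the two limit energies jointly.\<close>

lemma Ee_min_max: "Ee (\<lambda>x. min (f x) (g x)) + Ee (\<lambda>x. max (f x) (g x)) \<le> Ee f + Ee g"
proof (cases "Ee f < \<infinity> \<and> Ee g < \<infinity>")
  case True
  then have [measurable]: "f \<in> borel_measurable M" "g \<in> borel_measurable M"
    using Ee_finite_measurable by auto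
  show ?thesis
  proof (rule ennreal_le_epsilon)
    fix e :: real assume e: "0 < e"
    have lt: "Ee f < Ee f + ennreal (e/2)" "Ee g < Ee g + ennreal (e/2)" using True e by auto
    obtain fs where fs: "\<And>k. fs k \<in> L2 M" "\<And>k. E (fs k) < Ee f + ennreal (e/2)" "AE x in M. (\<lambda>k. fs k x) \<longlonglongrightarrow> f x"
      using Ee_approx[OF lt(1)] by blast
    obtain gs where gs: "\<And>k. gs k \<in> L2 M" "\<And>k. E (gs k) < Ee g + ennreal (e/2)" "AE x in M. (\<lambda>k. gs k x) \<longlonglongrightarrow> g x"
      using Ee_approx[OF lt(2)] by blast
    have [measurable]: "\<And>k. fs k \<in> borel_measurable M" "\<And>k. gs k \<in> borel_measurable M" using gs(1) fs(1) L2D by blast+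
    have "Ee (\<lambda>x. min (f x) (g x)) \<le> liminf (\<lambda>k. E (\<lambda>x. min (fs k x) (gs k x)))"
    proof (rule Ee_le_liminf)
      show "AE x in M. (\<lambda>k. min (fs k x) (gs k x)) \<longlonglongrightarrow> min (f x) (g x)"
        using fs(3) gs(3) by eventually_elim (intro tendsto_intros)
    qed auto
    moreover have "Ee (\<lambda>x. max (f x) (g x)) \<le> liminf (\<lambda>k. E (\<lambda>x. max (fs k x) (gs k x)))"
    proof (rule Ee_le_liminf)
      show "AE x in M. (\<lambda>k. max (fs k x) (gs k x)) \<longlonglongrightarrow> max (f x) (g x)"
        using fs(3) gs(3) by eventually_elim (intro tendsto_intros)
    qed auto
    moreover have "liminf (\<lambda>k. E (\<lambda>x. min (fs k x) (gs k x))) + liminf (\<lambda>k. E (\<lambda>x. max (fs k x) (gs k x)))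
        \<le> (Ee f + ennreal (e/2)) + (Ee g + ennreal (e/2))"
    proof (rule ennreal_liminf_superadd)
      fix k
      show "E (\<lambda>x. min (fs k x) (gs k x)) + E (\<lambda>x. max (fs k x) (gs k x)) \<le> (Ee f + ennreal (e/2)) + (Ee g + ennreal (e/2))"
        by (rule order_trans[OF form_min_max]) (intro add_mono less_imp_le[OF fs(2)] less_imp_le[OF gs(2)])
    qed
    ultimately have "Ee (\<lambda>x. min (f x) (g x)) + Ee (\<lambda>x. max (f x) (g x)) \<le> (Ee f + ennreal (e/2)) + (Ee g + ennreal (e/2))"
      by (meson add_mono order_trans)
    also have "\<dots> = Ee f + Ee g + (ennreal (e/2) + ennreal (e/2))" by (simp add: ac_simps)
    also have "ennreal (e/2) + ennreal (e/2) = ennreal e" using e by (simp add: ennreal_plus[symmetric] del: ennreal_plus)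
    finally show "Ee (\<lambda>x. min (f x) (g x)) + Ee (\<lambda>x. max (f x) (g x)) \<le> Ee f + Ee g + ennreal e" .
  qed
next
  case False
  then show ?thesis by (auto simp: less_top[symmetric])
qed

lemma Ee_max_le: "Ee (\<lambda>x. max (f x) (g x)) \<le> Ee f + Ee g"
  by (rule order_trans[OF _ Ee_min_max[of f g]]) simp

lemma Ee_pos_part: "Ee (\<lambda>x. max (f x) 0) \<le> Ee f"
  using Ee_max_le[of f "\<lambda>x. 0"] by (simp add: Ee_zero)

lemma Ee_scale_le: "0 \<le> t \<Longrightarrow> t \<le> 1 \<Longrightarrow> Ee (\<lambda>x. t * f x) \<le> ennreal t * Ee f"
  using Ee_convex[of t f "\<lambda>x. 0"] by (simp add: Ee_zero)

section \<open>Resolvents on L2\<close>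

lemma resolvent_finite:
  assumes "is_resolvent M E \<alpha> f g"
  shows "E g < \<infinity>"
proof -
  have "E g + ennreal (\<alpha> / 2 * integral\<^sup>L M (\<lambda>x. (g x - f x / \<alpha>)\<^sup>2))
      \<le> E (\<lambda>x. 0) + ennreal (\<alpha> / 2 * integral\<^sup>L M (\<lambda>x. (0 - f x / \<alpha>)\<^sup>2))"
    using assms L2_zero unfolding is_resolvent_def by blast
  also have "\<dots> < \<infinity>" by (simp add: form_zero)
  finally have "E g + ennreal (\<alpha> / 2 * integral\<^sup>L M (\<lambda>x. (g x - f x / \<alpha>)\<^sup>2)) < \<infinity>" .
  then show ?thesis by (simp add: less_top)
qed

text \<open>Compare the minimizer \<open>g\<close> with \<open>t * u + (1 - t) * g\<close>:
  convexity handles the energy and the square is expanded; divide by \<open>t\<close> and let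
  \<open>t\<close> tend to 0.\<close>

lemma resolvent_variational:
  assumes \<alpha>: "\<alpha> > 0" and f: "f \<in> L2 M" and g: "is_resolvent M E \<alpha> f g" and u: "E u < \<infinity>"
  shows "enn2real (E g) \<le> enn2real (E u) + (\<integral>x. (\<alpha> * g x - f x) * (u x - g x) \<partial>M)"
proof -
  have gL: "g \<in> L2 M" using g by (simp add: is_resolvent_def)
  have uL: "u \<in> L2 M" by (rule form_finite_L2[OF u])
  have Eg: "E g < \<infinity>" by (rule resolvent_finite[OF g])
  define a b where "a = enn2real (E g)" and "b = enn2real (E u)"
  have ab: "E g = ennreal a" "E u = ennreal b" "0 \<le> a" "0 \<le> b" using Eg u by (auto simp: a_def b_def)
  define p where "p x = g x - f x / \<alpha>" for x
  define q where "q x = u x - g x" for x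
  have pL: "p \<in> L2 M" unfolding p_def by (intro L2_diff L2_divide gL f)
  have qL: "q \<in> L2 M" unfolding q_def by (intro L2_diff gL uL)
  define I D N where "I = (\<integral>x. p x * q x \<partial>M)" and "D = (\<integral>x. (q x)\<^sup>2 \<partial>M)" and "N = (\<integral>x. (p x)\<^sup>2 \<partial>M)"
  have "a \<le> (b + \<alpha> * I) + t * (\<alpha> / 2 * D)" if t: "0 < t" "t \<le> 1" for t
  proof -
    let ?v = "\<lambda>x. t * u x + (1 - t) * g x"
    have vL: "?v \<in> L2 M" by (rule L2_lin[OF uL gL])
    have Nv: "integral\<^sup>L M (\<lambda>x. (?v x - f x / \<alpha>)\<^sup>2) = N + 2 * t * I + t\<^sup>2 * D"
    proof -
      have "(\<lambda>x. (?v x - f x / \<alpha>)\<^sup>2) = (\<lambda>x. (p x)\<^sup>2 + (2 * t) * (p x * q x) + t\<^sup>2 * (q x)\<^sup>2)"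
        by (auto simp: p_def q_def power2_eq_square algebra_simps)
      then show ?thesis
        using L2_mult[OF pL qL] L2D(2)[OF pL] L2D(2)[OF qL] by (simp add: N_def I_def D_def)
    qed
    have "ennreal (a + \<alpha> / 2 * N) = E g + ennreal (\<alpha> / 2 * N)"
      using ab \<alpha> by (simp add: N_def ennreal_plus)
    also have "\<dots> \<le> E ?v + ennreal (\<alpha> / 2 * (N + 2 * t * I + t\<^sup>2 * D))"

    proof -
      have "E g + ennreal (\<alpha> / 2 * integral\<^sup>L M (\<lambda>x. (g x - f x / \<alpha>)\<^sup>2))
          \<le> E ?v + ennreal (\<alpha> / 2 * integral\<^sup>L M (\<lambda>x. (?v x - f x / \<alpha>)\<^sup>2))"
        using g vL unfolding is_resolvent_def by blast
      then show ?thesis unfolding Nv by (simp add: N_def p_def)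
    qed
    also have "\<dots> \<le> (ennreal t * E u + ennreal (1 - t) * E g) + ennreal (\<alpha> / 2 * (N + 2 * t * I + t\<^sup>2 * D))"
      using t by (intro add_right_mono form_convex) auto
    also have "\<dots> = ennreal (t * b + (1 - t) * a + \<alpha> / 2 * (N + 2 * t * I + t\<^sup>2 * D))"
    proof -
      have "0 \<le> N + 2 * t * I + t\<^sup>2 * D" unfolding Nv[symmetric] by simp
      then show ?thesis using t ab \<alpha> by (simp add: ennreal_mult ennreal_plus)
    qed
    finally have "a + \<alpha> / 2 * N \<le> t * b + (1 - t) * a + \<alpha> / 2 * (N + 2 * t * I + t\<^sup>2 * D)"
      using \<alpha> t ab
    proof (subst (asm) ennreal_le_iff)
      have "0 \<le> N + 2 * t * I + t\<^sup>2 * D" unfolding Nv[symmetric] by simp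
      then show "0 \<le> t * b + (1 - t) * a + \<alpha> / 2 * (N + 2 * t * I + t\<^sup>2 * D)"
        using mult_nonneg_nonneg[of "\<alpha> / 2" "N + 2 * t * I + t\<^sup>2 * D"]
          mult_nonneg_nonneg[of t b] mult_nonneg_nonneg[of "1 - t" a] \<alpha> t ab by linarith
    qed
    then have "t * a \<le> t * (b + \<alpha> * I + t * (\<alpha> / 2 * D))"
      by (simp add: power2_eq_square algebra_simps)
    then show ?thesis using t by simp
  qed
  then have "a \<le> b + \<alpha> * I" by (rule le_of_le_add_small)
  also have "\<alpha> * I = (\<integral>x. (\<alpha> * g x - f x) * (u x - g x) \<partial>M)"
    unfolding I_def integral_mult_right_zero[symmetric]
    using \<alpha> by (intro Bochner_Integration.integral_cong) (auto simp: p_def q_def field_simps)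
  finally show ?thesis by (simp add: a_def b_def)
qed

text \<open>Direct method: the parallelogram identity makes a minimizing sequence Cauchy. Along an
  almost everywhere convergent subsequence, lower semicontinuity controls the energy and Fatou's
  lemma the quadratic term.\<close>

lemma resolvent_exists:
  assumes \<alpha>: "\<alpha> > 0" and f: "f \<in> L2 M"
  obtains g where "is_resolvent M E \<alpha> f g"
proof -
  define N where "N u = integral\<^sup>L M (\<lambda>x. (u x - f x / \<alpha>)\<^sup>2)" for u
  define J where "J u = E u + ennreal (\<alpha> / 2 * N u)" for u
  define I where "I = (INF u\<in>L2 M. J u)"
  have N0: "0 \<le> N u" for u by (simp add: N_def)
  have "I \<le> J (\<lambda>x. 0)" unfolding I_def by (intro INF_lower L2_zero)
  also have "\<dots> < \<infinity>" by (simp add: J_def form_zero)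
  finally have Ifin: "I < \<infinity>" .
  define i where "i = enn2real I"
  have i: "I = ennreal i" "0 \<le> i" using Ifin by (auto simp: i_def)
  have "\<exists>u. u \<in> L2 M \<and> J u < I + ennreal (1 / real (Suc n))" for n
  proof -
    have "I < I + ennreal (1 / real (Suc n))" using Ifin by (simp add: ennreal_add_left_cancel_less)
    then show ?thesis unfolding I_def INF_less_iff by blast
  qed
  then obtain u where u: "\<And>n. u n \<in> L2 M" "\<And>n. J (u n) < I + ennreal (1 / real (Suc n))" by metis
  note [measurable] = L2D(1)[OF u(1)] L2D(1)[OF f]
  define c where "c n = enn2real (E (u n))" for n
  have Ju: "E (u n) = ennreal (c n)" "0 \<le> c n" "c n + \<alpha> / 2 * N (u n) < i + 1 / real (Suc n)" for n
  proof -
    have "J (u n) < \<infinity>" using order_less_le_trans[OF u(2) top_greatest] by simp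
    then have "E (u n) < \<infinity>" by (simp add: J_def less_top)
    then show e: "E (u n) = ennreal (c n)" "0 \<le> c n" by (auto simp: c_def)
    have "ennreal (c n + \<alpha> / 2 * N (u n)) < ennreal (i + 1 / real (Suc n))"
      using u(2)[of n] e i \<alpha> N0 unfolding J_def by (simp add: ennreal_plus)
    then show "c n + \<alpha> / 2 * N (u n) < i + 1 / real (Suc n)"
      using e \<alpha> N0 by (subst (asm) ennreal_less_iff) auto
  qed
  have dist: "\<alpha> / 8 * (\<integral>x. (u n x - u m x)\<^sup>2 \<partial>M) \<le> (1 / real (Suc n) + 1 / real (Suc m)) / 2" for n m
  proof -
    \<comment> \<open>At the midpoint the quadratic term \<open>N\<close> drops by a quarter of the
      squared distance, yet the cost stays at least \<open>i\<close>; hence the distance is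
      small.\<close>
    let ?m = "\<lambda>x. (1/2) * u n x + (1 - 1/2) * u m x"
    have mL: "?m \<in> L2 M" by (rule L2_lin[OF u(1) u(1)])
    have Em: "E ?m \<le> ennreal ((1/2) * c n + (1/2) * c m)"
    proof -
      have "E ?m \<le> ennreal (1/2) * E (u n) + ennreal (1 - 1/2) * E (u m)" by (rule form_convex) auto
      also have "\<dots> = ennreal ((1/2) * c n + (1 - 1/2) * c m)"
        unfolding Ju(1) by (rule ennreal_lincomb) (auto intro: Ju(2))
      also have "(1/2) * c n + (1 - 1/2) * c m = (1/2) * c n + (1/2) * c m" by simp
      finally show ?thesis .
    qed
    let ?p = "\<lambda>x. u n x - f x / \<alpha>" and ?q = "\<lambda>x. u m x - f x / \<alpha>" and ?d = "\<lambda>x. u n x - u m x"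
    have L: "?p \<in> L2 M" "?q \<in> L2 M" "?d \<in> L2 M" by (intro L2_diff L2_divide u f)+
    have Nm: "N ?m = (1/2) * N (u n) + (1/2) * N (u m) - (1/4) * (\<integral>x. (?d x)\<^sup>2 \<partial>M)"
    proof -
      have "(\<lambda>x. (?m x - f x / \<alpha>)\<^sup>2) = (\<lambda>x. (1/2) * (?p x)\<^sup>2 + (1/2) * (?q x)\<^sup>2 - (1/4) * (?d x)\<^sup>2)"
        by (auto simp: power2_eq_square algebra_simps)
      then show ?thesis using L2D(2)[OF L(1)] L2D(2)[OF L(2)] L2D(2)[OF L(3)] by (simp add: N_def)
    qed
    have "ennreal i \<le> J ?m" unfolding i(1)[symmetric] I_def by (rule INF_lower[OF mL])
    also have "\<dots> \<le> ennreal ((1/2) * c n + (1/2) * c m) + ennreal (\<alpha> / 2 * N ?m)"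
      unfolding J_def by (rule add_right_mono[OF Em])
    also have "\<dots> = ennreal ((1/2) * c n + (1/2) * c m + \<alpha> / 2 * N ?m)"
      using Ju(2) \<alpha> N0 by (subst ennreal_plus[symmetric]) auto
    finally have "i \<le> (1/2) * c n + (1/2) * c m + \<alpha> / 2 * N ?m"
      using Ju(2) \<alpha> N0 by (subst (asm) ennreal_le_iff) (auto intro!: add_nonneg_nonneg)
    then have "i \<le> (1/2) * (c n + \<alpha> / 2 * N (u n)) + (1/2) * (c m + \<alpha> / 2 * N (u m)) - \<alpha> / 8 * (\<integral>x. (?d x)\<^sup>2 \<partial>M)"
      unfolding Nm by (simp add: algebra_simps)
    with Ju(3)[of n] Ju(3)[of m] show ?thesis by argo
  qed
  obtain r v where r: "strict_mono r" and v [measurable]: "v \<in> borel_measurable M"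
    and lim: "AE x in M. (\<lambda>n. u (r n) x) \<longlonglongrightarrow> v x"
  proof (rule L2_Cauchy_AE_subseq[of u])
    show "u n \<in> L2 M" for n by (rule u)
    fix e :: real assume e: "e > 0"
    obtain K where K: "1 / real (Suc K) < \<alpha> / 8 * e"
      using nat_approx_posE[of "\<alpha> / 8 * e"] \<alpha> e by auto
    have "(\<integral>x. (u n x - u m x)\<^sup>2 \<partial>M) < e" if "n \<ge> K" "m \<ge> K" for n m
    proof -
      have "1 / real (Suc n) \<le> 1 / real (Suc K)" "1 / real (Suc m) \<le> 1 / real (Suc K)"
        using that by (auto intro!: divide_left_mono)
      then have "\<alpha> / 8 * (\<integral>x. (u n x - u m x)\<^sup>2 \<partial>M) < \<alpha> / 8 * e" using dist[of n m] K by argo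
      then show ?thesis using \<alpha> by simp
    qed
    then show "\<exists>N. \<forall>i\<ge>N. \<forall>j\<ge>N. (\<integral>x. (u i x - u j x)\<^sup>2 \<partial>M) < e" by blast
  qed blast
  define Q where "Q u = (\<integral>\<^sup>+x. ennreal (\<alpha> / 2 * (u x - f x / \<alpha>)\<^sup>2) \<partial>M)" for u
  define P where "P = Q v"
  \<comment> \<open>Starting the subsequence at \<open>k\<close> leaves the excess
    \<open>1 / (k + 1)\<close>, because \<open>r (n + k) \<ge> k\<close>; the excess is removed in
    \<open>le\<close>.\<close>
  have bound: "Ee v + P \<le> I + ennreal (1 / real (Suc k))" for k
  proof -
    define s where "s n = u (r (n + k))" for n
    have sL: "s n \<in> L2 M" for n unfolding s_def by (rule u)
    note [measurable] = L2D(1)[OF sL]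
    have lim': "AE x in M. (\<lambda>n. s n x) \<longlonglongrightarrow> v x"
      unfolding s_def using lim by eventually_elim (rule LIMSEQ_ignore_initial_segment)
    have "Ee v \<le> liminf (\<lambda>n. E (s n))" by (rule Ee_le_liminf[OF _ v lim']) simp
    moreover have "P \<le> liminf (\<lambda>n. Q (s n))"
    proof -
      have "P = (\<integral>\<^sup>+x. liminf (\<lambda>n. ennreal (\<alpha> / 2 * (s n x - f x / \<alpha>)\<^sup>2)) \<partial>M)"
        unfolding P_def Q_def
      proof (rule nn_integral_cong_AE)
        show "AE x in M. ennreal (\<alpha> / 2 * (v x - f x / \<alpha>)\<^sup>2) = liminf (\<lambda>n. ennreal (\<alpha> / 2 * (s n x - f x / \<alpha>)\<^sup>2))"
          using lim'
        proof eventually_elim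
          case (elim x)
          have "(\<lambda>n. ennreal (\<alpha> / 2 * (s n x - f x / \<alpha>)\<^sup>2)) \<longlonglongrightarrow> ennreal (\<alpha> / 2 * (v x - f x / \<alpha>)\<^sup>2)"
            by (intro tendsto_intros elim)
          then show ?case by (simp add: lim_imp_Liminf)
        qed
      qed
      also have "\<dots> \<le> liminf (\<lambda>n. Q (s n))" unfolding Q_def by (rule nn_integral_liminf) simp
      finally show ?thesis .
    qed
    ultimately have "Ee v + P \<le> liminf (\<lambda>n. E (s n)) + liminf (\<lambda>n. Q (s n))" by (rule add_mono)
    also have "\<dots> \<le> I + ennreal (1 / real (Suc k))"
    proof (rule ennreal_liminf_superadd)
      fix n
      have "integrable M (\<lambda>x. (s n x - f x / \<alpha>)\<^sup>2)" by (intro L2D(2) L2_diff L2_divide sL f)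
      then have "Q (s n) = ennreal (\<alpha> / 2 * N (s n))"
        unfolding Q_def using \<alpha> by (subst nn_integral_eq_integral) (auto simp: N_def)
      then have "E (s n) + Q (s n) = J (u (r (n + k)))" by (simp add: J_def s_def)
      also have "\<dots> \<le> I + ennreal (1 / real (Suc (r (n + k))))" using u(2) by (rule less_imp_le)
      also have "\<dots> \<le> I + ennreal (1 / real (Suc k))"
      proof (intro add_left_mono ennreal_leI divide_left_mono)
        have "k \<le> r (n + k)" using strict_mono_imp_increasing[OF r, of "n + k"] by simp
        then show "real (Suc k) \<le> real (Suc (r (n + k)))" by simp
      qed auto
      finally show "E (s n) + Q (s n) \<le> I + ennreal (1 / real (Suc k))" .
    qed
    finally show ?thesis .
  qed
  have le: "Ee v + P \<le> I"
  proof (rule ennreal_le_epsilon)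
    fix e :: real assume "0 < e"
    then obtain k where "1 / real (Suc k) < e" using nat_approx_posE by blast
    then have "I + ennreal (1 / real (Suc k)) \<le> I + ennreal e" by (intro add_left_mono ennreal_leI) simp
    with bound[of k] show "Ee v + P \<le> I + ennreal e" by (rule order_trans)
  qed
  have "P \<le> Ee v + P" by simp
  then have Pfin: "P < \<infinity>" using le Ifin by (meson order_le_less_trans)
  have int: "integrable M (\<lambda>x. \<alpha> / 2 * (v x - f x / \<alpha>)\<^sup>2)"
    by (rule integrableI_bounded) (use Pfin \<alpha> in \<open>simp_all add: P_def Q_def\<close>)
  have "integrable M (\<lambda>x. (2 / \<alpha>) * (\<alpha> / 2 * (v x - f x / \<alpha>)\<^sup>2))" by (rule integrable_mult_right[OF int])
  moreover have "(\<lambda>x. (2 / \<alpha>) * (\<alpha> / 2 * (v x - f x / \<alpha>)\<^sup>2)) = (\<lambda>x. (v x - f x / \<alpha>)\<^sup>2)" using \<alpha> by auto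
  ultimately have "(\<lambda>x. v x - f x / \<alpha>) \<in> L2 M" by (simp add: L2_def)
  from L2_add[OF this L2_divide[OF f, of \<alpha>]] have vL: "v \<in> L2 M" by simp
  have "P = ennreal (\<alpha> / 2 * N v)"
    unfolding P_def Q_def using int \<alpha> by (subst nn_integral_eq_integral) (auto simp: N_def)
  then have "J v \<le> I" using le Ee_L2[OF vL] by (simp add: J_def)
  then have "J v \<le> J u" if "u \<in> L2 M" for u
    using INF_lower[OF that, of J] unfolding I_def by (rule order_trans)
  then have "is_resolvent M E \<alpha> f v" using vL unfolding is_resolvent_def J_def N_def by blast
  then show ?thesis by (rule that)
qed

text \<open>Test \<open>g\<close> with the minimum and \<open>g'\<close> with the maximum:
  submodularity cancels all energies, and what remains forces the positive part of
  \<open>g - g'\<close> to vanish.\<close>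

lemma resolvent_mono:
  assumes \<alpha>: "\<alpha> > 0" and f: "f \<in> L2 M" "f' \<in> L2 M" and le: "AE x in M. f x \<le> f' x"
    and g: "is_resolvent M E \<alpha> f g" "is_resolvent M E \<alpha> f' g'"
  shows "AE x in M. g x \<le> g' x"
proof -
  let ?m = "\<lambda>x. min (g x) (g' x)" and ?j = "\<lambda>x. max (g x) (g' x)" and ?d = "\<lambda>x. max (g x - g' x) 0"
  have gL: "g \<in> L2 M" "g' \<in> L2 M" using g by (auto simp: is_resolvent_def)
  have dL: "?d \<in> L2 M" by (intro L2_max L2_diff L2_zero gL)
  have Eg: "E g < \<infinity>" "E g' < \<infinity>" using g resolvent_finite by auto
  have mm: "E ?m + E ?j \<le> E g + E g'" by (rule form_min_max)
  then have "E ?m + E ?j < \<infinity>" using Eg by (simp add: less_top[symmetric] top_unique) (metis Eg ennreal_add_eq_top infinity_ennreal_def less_irrefl top_unique)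
  then have fin: "E ?m < \<infinity>" "E ?j < \<infinity>" by (auto simp: less_top)
  have "enn2real (E ?m + E ?j) \<le> enn2real (E g + E g')" using mm Eg by (intro enn2real_mono) (auto simp: less_top)
  then have sum: "enn2real (E ?m) + enn2real (E ?j) \<le> enn2real (E g) + enn2real (E g')"
    using fin Eg by (simp add: enn2real_plus)
  have V1: "enn2real (E g) \<le> enn2real (E ?m) + (\<integral>x. (\<alpha> * g x - f x) * (?m x - g x) \<partial>M)"
    by (rule resolvent_variational[OF \<alpha> f(1) g(1) fin(1)])
  have V2: "enn2real (E g') \<le> enn2real (E ?j) + (\<integral>x. (\<alpha> * g' x - f' x) * (?j x - g' x) \<partial>M)"
    by (rule resolvent_variational[OF \<alpha> f(2) g(2) fin(2)])
  have i1: "integrable M (\<lambda>x. (\<alpha> * g x - f x) * (?m x - g x))"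
    and i2: "integrable M (\<lambda>x. (\<alpha> * g' x - f' x) * (?j x - g' x))"
    by (intro L2_mult L2_diff L2_scale L2_min L2_max gL f)+
  have "0 \<le> (\<integral>x. (\<alpha> * g x - f x) * (?m x - g x) \<partial>M) + (\<integral>x. (\<alpha> * g' x - f' x) * (?j x - g' x) \<partial>M)"
    using V1 V2 sum by linarith
  also have "\<dots> = (\<integral>x. (\<alpha> * g x - f x) * (?m x - g x) + (\<alpha> * g' x - f' x) * (?j x - g' x) \<partial>M)"
    using i1 i2 by simp
  also have "\<dots> \<le> (\<integral>x. - \<alpha> * (?d x)\<^sup>2 \<partial>M)"
  proof (rule integral_mono_AE)
    show "integrable M (\<lambda>x. - \<alpha> * (?d x)\<^sup>2)" using L2D(2)[OF dL] by simp
    show "AE x in M. (\<alpha> * g x - f x) * (?m x - g x) + (\<alpha> * g' x - f' x) * (?j x - g' x) \<le> - \<alpha> * (?d x)\<^sup>2"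
      using le
    proof eventually_elim
      case (elim x)
      show ?case
      proof (cases "g x \<le> g' x")
        case False
        then have "0 \<le> (f' x - f x) * (g x - g' x)" using elim by simp
        then show ?thesis using False by (simp add: min_def max_def power2_eq_square algebra_simps)
      qed (simp add: min_def max_def)
    qed
  qed (use i1 i2 in simp)
  finally have "\<alpha> * (\<integral>x. (?d x)\<^sup>2 \<partial>M) \<le> 0" using L2D(2)[OF dL] by simp
  then have "(\<integral>x. (?d x)\<^sup>2 \<partial>M) \<le> 0" using \<alpha> by (simp add: mult_le_0_iff)
  from integral_square_nonpos_imp_AE[OF dL this] show ?thesis
    by eventually_elim (auto simp: max_def split: if_splits)
qed

text \<open>Each minimizer is a competitor for the other; the energies cancel in the sum and Young's
  inequality leaves the L2 distances.\<close>

lemma resolvent_contraction: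
  assumes \<alpha>: "\<alpha> > 0" and f: "f \<in> L2 M" "f' \<in> L2 M"
    and g: "is_resolvent M E \<alpha> f g" "is_resolvent M E \<alpha> f' g'"
  shows "\<alpha>\<^sup>2 * (\<integral>x. (g x - g' x)\<^sup>2 \<partial>M) \<le> (\<integral>x. (f x - f' x)\<^sup>2 \<partial>M)"
proof -
  have gL: "g \<in> L2 M" "g' \<in> L2 M" using g by (auto simp: is_resolvent_def)
  have V1: "enn2real (E g) \<le> enn2real (E g') + (\<integral>x. (\<alpha> * g x - f x) * (g' x - g x) \<partial>M)"
    by (rule resolvent_variational[OF \<alpha> f(1) g(1) resolvent_finite[OF g(2)]])
  have V2: "enn2real (E g') \<le> enn2real (E g) + (\<integral>x. (\<alpha> * g' x - f' x) * (g x - g' x) \<partial>M)"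
    by (rule resolvent_variational[OF \<alpha> f(2) g(2) resolvent_finite[OF g(1)]])
  have i1: "integrable M (\<lambda>x. (\<alpha> * g x - f x) * (g' x - g x))"
    and i2: "integrable M (\<lambda>x. (\<alpha> * g' x - f' x) * (g x - g' x))"
    by (intro L2_mult L2_diff L2_scale gL f)+
  have j: "integrable M (\<lambda>x. (g x - g' x)\<^sup>2)" "integrable M (\<lambda>x. (f x - f' x)\<^sup>2)"
    by (intro L2D(2) L2_diff gL f)+
  have "0 \<le> (\<integral>x. (\<alpha> * g x - f x) * (g' x - g x) \<partial>M) + (\<integral>x. (\<alpha> * g' x - f' x) * (g x - g' x) \<partial>M)"
    using V1 V2 by linarith
  also have "\<dots> = (\<integral>x. (\<alpha> * g x - f x) * (g' x - g x) + (\<alpha> * g' x - f' x) * (g x - g' x) \<partial>M)"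
    using i1 i2 by simp
  also have "\<dots> \<le> (\<integral>x. 1/(2*\<alpha>) * (f x - f' x)\<^sup>2 - \<alpha>/2 * (g x - g' x)\<^sup>2 \<partial>M)"
  proof (rule integral_mono)
    fix x
    define a b where "a = f x - f' x" and "b = g x - g' x"
    have "0 \<le> (a - \<alpha> * b)\<^sup>2" by simp
    then have "2 * \<alpha> * (a * b) \<le> a\<^sup>2 + \<alpha>\<^sup>2 * b\<^sup>2" by (simp add: power2_eq_square algebra_simps)
    then have "a * b \<le> 1/(2*\<alpha>) * a\<^sup>2 + \<alpha>/2 * b\<^sup>2" using \<alpha> by (simp add: field_simps power2_eq_square)
    moreover have "(\<alpha> * g x - f x) * (g' x - g x) + (\<alpha> * g' x - f' x) * (g x - g' x) = a * b - \<alpha> * b\<^sup>2"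
      by (simp add: a_def b_def power2_eq_square algebra_simps)
    ultimately show "(\<alpha> * g x - f x) * (g' x - g x) + (\<alpha> * g' x - f' x) * (g x - g' x)
        \<le> 1/(2*\<alpha>) * (f x - f' x)\<^sup>2 - \<alpha>/2 * (g x - g' x)\<^sup>2" by (simp add: a_def b_def)
  qed (use i1 i2 j in simp_all)
  also have "\<dots> = 1/(2*\<alpha>) * (\<integral>x. (f x - f' x)\<^sup>2 \<partial>M) - \<alpha>/2 * (\<integral>x. (g x - g' x)\<^sup>2 \<partial>M)" using j by simp
  finally show ?thesis using \<alpha> by (simp add: field_simps power2_eq_square)
qed

text \<open>\<open>ext_resolvent\<close> is a choice, so its properties become available only after
  one admissible approximation is exhibited; \<open>SOME\<close> may then select another one of the
  same shape.\<close>

lemma ext_resolvent_witness: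
  assumes \<alpha>: "\<alpha> > 0" and f [measurable]: "f \<in> borel_measurable M" and nn: "AE x in M. 0 \<le> f x"
  obtains fs gs where "\<And>n. fs n \<in> L2 M" "\<And>n x. 0 \<le> fs n x"
    "AE x in M. incseq (\<lambda>n. fs n x) \<and> (\<lambda>n. fs n x) \<longlonglongrightarrow> f x"
    "\<And>n. is_resolvent M E \<alpha> (fs n) (gs n)"
    "ext_resolvent M E \<alpha> f = (\<lambda>x. SUP n. ennreal (gs n x))"
proof -
  let ?P = "\<lambda>u fs gs. (\<forall>n. fs n \<in> L2 M \<and> (\<forall>x. 0 \<le> fs n x)) \<and>
      (AE x in M. incseq (\<lambda>n. fs n x) \<and> (\<lambda>n. fs n x) \<longlonglongrightarrow> f x) \<and>
      (\<forall>n. is_resolvent M E \<alpha> (fs n) (gs n)) \<and> u = (\<lambda>x. SUP n. ennreal (gs n x))"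
  \<comment> \<open>The bound \<open>n * w\<close> keeps the truncations in L2; as
    \<open>w > 0\<close>, they equal \<open>f x\<close> from some \<open>n\<close> on.\<close>
  define fs where "fs n x = min (max (f x) 0) (real n * w x)" for n :: nat and x
  have fsL: "fs n \<in> L2 M" for n
  proof (rule L2_dominated[OF L2_scale[OF w_L2, of "real n"]])
    show "fs n \<in> borel_measurable M" unfolding fs_def by measurable
    show "AE x in M. \<bar>fs n x\<bar> \<le> \<bar>real n * w x\<bar>" using w_nonneg by (auto simp: fs_def)
  qed
  have "\<exists>g. is_resolvent M E \<alpha> (fs n) g" for n
    using resolvent_exists[OF \<alpha> fsL] by blast
  then have "\<exists>gs. \<forall>n. is_resolvent M E \<alpha> (fs n) (gs n)" by (intro choice) blast
  then obtain gs where gs: "\<And>n. is_resolvent M E \<alpha> (fs n) (gs n)" by blast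
  have "AE x in M. incseq (\<lambda>n. fs n x) \<and> (\<lambda>n. fs n x) \<longlonglongrightarrow> f x"
    using nn AE_space
  proof eventually_elim
    case (elim x)
    have "incseq (\<lambda>n. fs n x)"
      unfolding incseq_def fs_def using w_nonneg[of x] by (intro allI impI min.mono mult_right_mono) auto
    moreover have "(\<lambda>n. fs n x) \<longlonglongrightarrow> f x"
    proof (rule tendsto_eventually)
      obtain k where k: "f x < real k * w x" using ex_less_of_nat_mult[OF w_pos[OF elim(2)]] by auto
      show "eventually (\<lambda>n. fs n x = f x) sequentially"
      proof (rule eventually_sequentiallyI)
        fix n assume "k \<le> n"
        then have "real k * w x \<le> real n * w x" using w_nonneg[of x] by (intro mult_right_mono) auto
        then show "fs n x = f x" using k elim by (simp add: fs_def)
      qed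
    qed
    ultimately show ?case ..
  qed
  then have "?P (\<lambda>x. SUP n. ennreal (gs n x)) fs gs"
    using fsL gs w_nonneg by (auto simp: fs_def)
  then have "\<exists>u fs gs. ?P u fs gs" by blast
  from someI_ex[OF this] obtain fs' gs' where "?P (ext_resolvent M E \<alpha> f) fs' gs'"
    unfolding ext_resolvent_def by blast
  then show ?thesis by (intro that[of fs' gs']) auto
qed

lemma form_lsc:
  assumes "f \<in> L2 M" "\<And>n. fs n \<in> L2 M" "(\<lambda>n. integral\<^sup>L M (\<lambda>x. (fs n x - f x)\<^sup>2)) \<longlonglongrightarrow> 0"
  shows "E f \<le> liminf (\<lambda>n. E (fs n))"
  using form assms unfolding nonlinear_order_preserving_form_def by blast

section \<open>Excessive functions and truncation\<close>

lemma excessiveD: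
  assumes "excessive M E h"
  shows "h \<in> borel_measurable M" "AE x in M. 0 \<le> h x"
    and "\<And>\<alpha>. \<alpha> > 0 \<Longrightarrow> AE x in M. ext_resolvent M E \<alpha> (\<lambda>y. \<alpha> * h y) x \<le> ennreal (h x)"
  using assms by (auto simp: excessive_def)

text \<open>Excessiveness controls only the resolvents \<open>gs n\<close> of the selected
  approximants. So \<open>u\<close> is cut to \<open>v n\<close> below
  \<open>fs n / \<alpha>\<close>, where monotonicity applies, and the L2 contraction carries the
  bound over to \<open>u\<close>.\<close>

lemma resolvent_le_excessive:
  assumes h: "excessive M E h" and \<alpha>: "\<alpha> > 0" and u: "u \<in> L2 M" and le: "AE x in M. u x \<le> h x"
    and z: "is_resolvent M E \<alpha> (\<lambda>x. \<alpha> * u x) z"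
  shows "AE x in M. z x \<le> h x"
proof -
  note hm [measurable] = excessiveD(1)[OF h]
  have nn: "AE x in M. 0 \<le> \<alpha> * h x" using excessiveD(2)[OF h] \<alpha> by auto
  obtain fs gs where fs: "\<And>n. fs n \<in> L2 M" "\<And>n x. 0 \<le> fs n x"
    "AE x in M. incseq (\<lambda>n. fs n x) \<and> (\<lambda>n. fs n x) \<longlonglongrightarrow> \<alpha> * h x"
    and gs: "\<And>n. is_resolvent M E \<alpha> (fs n) (gs n)"
    and eq: "ext_resolvent M E \<alpha> (\<lambda>y. \<alpha> * h y) = (\<lambda>x. SUP n. ennreal (gs n x))"
    using ext_resolvent_witness[OF \<alpha> _ nn] hm by (auto intro!: borel_measurable_times)
  have gsh: "AE x in M. gs n x \<le> h x" for n
    using excessiveD(3)[OF h \<alpha>] excessiveD(2)[OF h]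
  proof eventually_elim
    case (elim x)
    have "ennreal (gs n x) \<le> (SUP n. ennreal (gs n x))" by (rule SUP_upper) simp
    also have "\<dots> \<le> ennreal (h x)" using elim(1) by (simp add: eq)
    finally show ?case using elim(2) by simp
  qed
  define v where "v n x = min (u x) (fs n x / \<alpha>)" for n x
  have vL: "v n \<in> L2 M" for n unfolding v_def by (intro L2_min L2_divide u fs)
  have zL: "z \<in> L2 M" using z by (simp add: is_resolvent_def)
  note [measurable] = L2D(1)[OF u] L2D(1)[OF vL] L2D(1)[OF zL]
  let ?d = "\<lambda>x. max (z x - h x) 0"
  have dL: "?d \<in> L2 M"
  proof (rule L2_dominated[OF zL])
    show "AE x in M. \<bar>?d x\<bar> \<le> \<bar>z x\<bar>" using excessiveD(2)[OF h] by eventually_elim auto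
  qed simp
  have bound: "(\<integral>x. (?d x)\<^sup>2 \<partial>M) \<le> (\<integral>x. (u x - v n x)\<^sup>2 \<partial>M)" for n
  proof -
    obtain zn where zn: "is_resolvent M E \<alpha> (\<lambda>x. \<alpha> * v n x) zn"
      using resolvent_exists[OF \<alpha> L2_scale[OF vL]] by blast
    have znL: "zn \<in> L2 M" using zn by (simp add: is_resolvent_def)
    have "AE x in M. zn x \<le> gs n x"
    proof (rule resolvent_mono[OF \<alpha> L2_scale[OF vL] fs(1) _ zn gs])
      show "AE x in M. \<alpha> * v n x \<le> fs n x" using \<alpha> by (auto simp: v_def min_def field_simps)
    qed
    then have znh: "AE x in M. zn x \<le> h x" using gsh[of n] by eventually_elim simp
    have "(\<integral>x. (?d x)\<^sup>2 \<partial>M) \<le> (\<integral>x. (z x - zn x)\<^sup>2 \<partial>M)"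
    proof (rule integral_mono_AE)
      show "AE x in M. (?d x)\<^sup>2 \<le> (z x - zn x)\<^sup>2"
        using znh by eventually_elim (auto simp: max_def intro!: power_mono)
      show "integrable M (\<lambda>x. (z x - zn x)\<^sup>2)" by (intro L2D(2) L2_diff zL znL)
    qed (rule L2D(2)[OF dL])
    moreover have "\<alpha>\<^sup>2 * (\<integral>x. (z x - zn x)\<^sup>2 \<partial>M) \<le> (\<integral>x. (\<alpha> * u x - \<alpha> * v n x)\<^sup>2 \<partial>M)"
      by (rule resolvent_contraction[OF \<alpha> L2_scale[OF u] L2_scale[OF vL] z zn])
    moreover have "(\<integral>x. (\<alpha> * u x - \<alpha> * v n x)\<^sup>2 \<partial>M) = \<alpha>\<^sup>2 * (\<integral>x. (u x - v n x)\<^sup>2 \<partial>M)"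
      by (simp add: right_diff_distrib[symmetric] power_mult_distrib)
    ultimately show ?thesis using \<alpha> by simp
  qed
  have "(\<lambda>n. \<integral>x. (u x - v n x)\<^sup>2 \<partial>M) \<longlonglongrightarrow> (\<integral>x. 0 \<partial>M)"
  proof (rule integral_dominated_convergence[OF _ _ L2D(2)[OF u]])
    show "AE x in M. (\<lambda>n. (u x - v n x)\<^sup>2) \<longlonglongrightarrow> 0"
      using fs(3) le
    proof eventually_elim
      case (elim x)
      have "(\<lambda>n. fs n x / \<alpha>) \<longlonglongrightarrow> \<alpha> * h x / \<alpha>" using elim \<alpha> by (intro tendsto_divide) auto
      then have "(\<lambda>n. (u x - v n x)\<^sup>2) \<longlonglongrightarrow> (u x - min (u x) (h x))\<^sup>2"
        unfolding v_def using \<alpha> by (intro tendsto_intros) simp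
      then show ?case using elim by (simp add: min_def)
    qed
    show "AE x in M. norm ((u x - v n x)\<^sup>2) \<le> (u x)\<^sup>2" for n
    proof (rule AE_I2)
      fix x
      have "0 \<le> fs n x / \<alpha>" using fs(2) \<alpha> by simp
      then have "\<bar>u x - v n x\<bar> \<le> \<bar>u x\<bar>" by (auto simp: v_def min_def)
      then show "norm ((u x - v n x)\<^sup>2) \<le> (u x)\<^sup>2" by (simp add: abs_le_square_iff)
    qed
  qed simp_all
  then have "(\<integral>x. (?d x)\<^sup>2 \<partial>M) \<le> 0" using bound by (intro LIMSEQ_le_const) auto
  from integral_square_nonpos_imp_AE[OF dL this] show ?thesis
    by eventually_elim (auto simp: max_def split: if_splits)
qed

text \<open>The resolvents \<open>z n\<close> of \<open>\<alpha> n * y\<close>, where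
  \<open>y\<close> is the truncation, stay below \<open>h\<close>. Testing with \<open>f\<close>
  bounds both \<open>E (z n)\<close> and \<open>\<alpha> n\<close> times the squared distance to
  \<open>y\<close> by \<open>E f\<close>; as \<open>\<alpha> n\<close> grows, \<open>z n\<close>
  tends to \<open>y\<close> and lower semicontinuity applies.\<close>

lemma form_min_excessive:
  assumes h: "excessive M E h"
  shows "E (\<lambda>x. min (f x) (h x)) \<le> E f"
proof (cases "E f < \<infinity>")
  case True
  note hm [measurable] = excessiveD(1)[OF h]
  have fL: "f \<in> L2 M" by (rule form_finite_L2[OF True])
  note [measurable] = L2D(1)[OF fL]
  define y where "y x = min (f x) (h x)" for x
  have yL: "y \<in> L2 M"
  proof (rule L2_dominated[OF fL])
    show "y \<in> borel_measurable M" unfolding y_def by measurable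
    show "AE x in M. \<bar>y x\<bar> \<le> \<bar>f x\<bar>" using excessiveD(2)[OF h] by eventually_elim (auto simp: y_def min_def)
  qed
  define \<alpha> where "\<alpha> n = real (Suc n)" for n
  have \<alpha>: "\<alpha> n > 0" for n by (simp add: \<alpha>_def)
  have "\<exists>z. is_resolvent M E (\<alpha> n) (\<lambda>x. \<alpha> n * y x) z" for n
    using resolvent_exists[OF \<alpha> L2_scale[OF yL]] by blast
  then obtain z where z: "\<And>n. is_resolvent M E (\<alpha> n) (\<lambda>x. \<alpha> n * y x) (z n)" by metis
  have zL: "z n \<in> L2 M" for n using z[of n] by (simp add: is_resolvent_def)
  have key: "enn2real (E (z n)) + \<alpha> n * (\<integral>x. (z n x - y x)\<^sup>2 \<partial>M) \<le> enn2real (E f)" for n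
  proof -
    have "AE x in M. z n x \<le> h x"
      by (rule resolvent_le_excessive[OF h \<alpha> yL _ z]) (simp add: y_def)
    then have le: "AE x in M. (\<alpha> n * z n x - \<alpha> n * y x) * (f x - z n x) \<le> - \<alpha> n * (z n x - y x)\<^sup>2"
    proof eventually_elim
      case (elim x)
      \<comment> \<open>Where \<open>f \<le> h\<close> the second factor is 0; where
        \<open>f > h\<close>, \<open>y\<close> equals \<open>h\<close>, so the first factor is
        nonpositive and the second positive.\<close>
      have "(z n x - y x) * (f x - y x) \<le> 0"
        using elim by (auto simp: y_def min_def mult_le_0_iff)
      then have "\<alpha> n * ((z n x - y x) * (f x - y x)) \<le> 0" using \<alpha>[of n] by (simp add: mult_le_0_iff)
      then show ?case by (simp add: power2_eq_square algebra_simps)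
    qed
    have i: "integrable M (\<lambda>x. (z n x - y x)\<^sup>2)" by (intro L2D(2) L2_diff zL yL)
    have "enn2real (E (z n)) \<le> enn2real (E f) + (\<integral>x. (\<alpha> n * z n x - \<alpha> n * y x) * (f x - z n x) \<partial>M)"
      by (rule resolvent_variational[OF \<alpha> L2_scale[OF yL] z True])
    also have "(\<integral>x. (\<alpha> n * z n x - \<alpha> n * y x) * (f x - z n x) \<partial>M) \<le> (\<integral>x. - \<alpha> n * (z n x - y x)\<^sup>2 \<partial>M)"
    proof (rule integral_mono_AE[OF _ _ le])
      show "integrable M (\<lambda>x. (\<alpha> n * z n x - \<alpha> n * y x) * (f x - z n x))"
        by (intro L2_mult L2_diff L2_scale zL yL fL)
      show "integrable M (\<lambda>x. - \<alpha> n * (z n x - y x)\<^sup>2)" using i by simp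
    qed
    finally show ?thesis using i by simp
  qed
  have "(\<lambda>n. \<integral>x. (z n x - y x)\<^sup>2 \<partial>M) \<longlonglongrightarrow> 0"
  proof (rule tendsto_sandwich[of "\<lambda>n. 0" _ _ "\<lambda>n. enn2real (E f) * (1 / real (Suc n))"])
    have "(\<lambda>n. enn2real (E f) * (1 / real (Suc n))) \<longlonglongrightarrow> enn2real (E f) * 0"
      by (rule tendsto_mult_left[OF one_over_Suc_tendsto])
    then show "(\<lambda>n. enn2real (E f) * (1 / real (Suc n))) \<longlonglongrightarrow> 0" by simp
    show "eventually (\<lambda>n. (\<integral>x. (z n x - y x)\<^sup>2 \<partial>M) \<le> enn2real (E f) * (1 / real (Suc n))) sequentially"
    proof (rule always_eventually, rule allI)
      fix n
      have "\<alpha> n * (\<integral>x. (z n x - y x)\<^sup>2 \<partial>M) \<le> enn2real (E f)"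
        using key[of n] enn2real_nonneg[of "E (z n)"] by linarith
      then show "(\<integral>x. (z n x - y x)\<^sup>2 \<partial>M) \<le> enn2real (E f) * (1 / real (Suc n))"
        by (simp add: \<alpha>_def field_simps)
    qed
  qed simp_all
  then have "E y \<le> liminf (\<lambda>n. E (z n))" by (rule form_lsc[OF yL zL])
  also have "\<dots> \<le> E f"
  proof (rule liminf_le_const)
    fix n
    have "0 \<le> \<alpha> n * (\<integral>x. (z n x - y x)\<^sup>2 \<partial>M)" using \<alpha>[of n] by simp
    then have "enn2real (E (z n)) \<le> enn2real (E f)" using key[of n] by linarith
    then have "ennreal (enn2real (E (z n))) \<le> ennreal (enn2real (E f))" by (rule ennreal_leI)
    then show "E (z n) \<le> E f" 
      using True resolvent_finite[OF z[of n]] by (simp only: ennreal_enn2real infinity_ennreal_def)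
  qed
  finally show ?thesis by (simp add: y_def[abs_def])
next
  case False
  then have "E f = top" by (simp add: less_top[symmetric])
  then show ?thesis by simp
qed

lemma Ee_min_excessive:
  assumes h: "excessive M E h"
  shows "Ee (\<lambda>x. min (f x) (h x)) \<le> Ee f"
proof -
  have "Ee (\<lambda>x. min (f x) (h x)) \<le> ennreal 1 * Ee f"
  proof (rule Ee_superposition_le)
    show "(\<lambda>x. min (g x) (h x)) \<in> borel_measurable M" if "g \<in> borel_measurable M" for g
      using that excessiveD(1)[OF h] by measurable
    show "isCont (\<lambda>y. min y (h x)) y" for x y by (intro continuous_intros)
  qed (simp_all add: form_min_excessive[OF h])
  then show ?thesis by simp
qed

text \<open>Replacing \<open>gs n\<close> by its minimum with \<open>r\<close> does not raise the
  energy, but would strictly lower the quadratic term where \<open>gs n > r\<close>, since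
  \<open>fs n \<le> \<alpha> * r\<close>. Minimality excludes this.\<close>

lemma excessiveI:
  assumes r [measurable]: "r \<in> borel_measurable M" and nn: "AE x in M. 0 \<le> r x"
    and cut: "\<And>f. Ee (\<lambda>x. min (f x) (r x)) \<le> Ee f"
  shows "excessive M E r"
  unfolding excessive_def
proof (intro conjI r nn allI impI)
  fix \<alpha> :: real assume \<alpha>: "\<alpha> > 0"
  have nn': "AE x in M. 0 \<le> \<alpha> * r x" using nn \<alpha> by auto
  obtain fs gs where fs: "\<And>n. fs n \<in> L2 M" "\<And>n x. 0 \<le> fs n x"
    "AE x in M. incseq (\<lambda>n. fs n x) \<and> (\<lambda>n. fs n x) \<longlonglongrightarrow> \<alpha> * r x"
    and gs: "\<And>n. is_resolvent M E \<alpha> (fs n) (gs n)"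
    and eq: "ext_resolvent M E \<alpha> (\<lambda>y. \<alpha> * r y) = (\<lambda>x. SUP n. ennreal (gs n x))"
    using ext_resolvent_witness[OF \<alpha> _ nn'] by (auto intro!: borel_measurable_times)
  have "AE x in M. gs n x \<le> r x" for n
  proof -
    let ?z = "gs n" and ?m = "\<lambda>x. min (gs n x) (r x)" and ?d = "\<lambda>x. max (gs n x - r x) 0"
    have zL: "?z \<in> L2 M" using gs[of n] by (simp add: is_resolvent_def)
    note [measurable] = L2D(1)[OF zL] L2D(1)[OF fs(1)]
    have mL: "?m \<in> L2 M"
    proof (rule L2_dominated[OF zL])
      show "AE x in M. \<bar>?m x\<bar> \<le> \<bar>?z x\<bar>" using nn by eventually_elim (auto simp: min_def)
    qed simp
    have dL: "?d \<in> L2 M"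
    proof (rule L2_dominated[OF zL])
      show "AE x in M. \<bar>?d x\<bar> \<le> \<bar>?z x\<bar>" using nn by eventually_elim auto
    qed simp
    have zfin: "E ?z < \<infinity>" by (rule resolvent_finite[OF gs])
    have mz: "E ?m \<le> E ?z" using cut[of ?z] by (simp add: Ee_L2[OF zL] Ee_L2[OF mL])
    have mfin: "E ?m < \<infinity>" using mz zfin by (rule order_le_less_trans)
    have "enn2real (E ?m) \<le> enn2real (E ?z)" using mz zfin by (intro enn2real_mono) auto
    moreover have "enn2real (E ?z) \<le> enn2real (E ?m) + (\<integral>x. (\<alpha> * ?z x - fs n x) * (?m x - ?z x) \<partial>M)"
      by (rule resolvent_variational[OF \<alpha> fs(1) gs mfin])
    moreover have "(\<integral>x. (\<alpha> * ?z x - fs n x) * (?m x - ?z x) \<partial>M) \<le> (\<integral>x. - \<alpha> * (?d x)\<^sup>2 \<partial>M)"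
    proof (rule integral_mono_AE)
      show "integrable M (\<lambda>x. (\<alpha> * ?z x - fs n x) * (?m x - ?z x))"
        by (intro L2_mult L2_diff L2_scale zL fs mL)
      show "integrable M (\<lambda>x. - \<alpha> * (?d x)\<^sup>2)" using L2D(2)[OF dL] by simp
      show "AE x in M. (\<alpha> * ?z x - fs n x) * (?m x - ?z x) \<le> - \<alpha> * (?d x)\<^sup>2"
        using fs(3)
      proof eventually_elim
        case (elim x)
        then have le: "fs n x \<le> \<alpha> * r x" using incseq_le by blast
        show ?case
        proof (cases "?z x \<le> r x")
          case False
          then have "0 \<le> (\<alpha> * r x - fs n x) * (?z x - r x)" using le by simp
          then show ?thesis using False by (simp add: min_def max_def power2_eq_square algebra_simps)
        qed (simp add: min_def max_def)
      qed
    qed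
    ultimately have "\<alpha> * (\<integral>x. (?d x)\<^sup>2 \<partial>M) \<le> 0" using L2D(2)[OF dL] by simp
    then have "(\<integral>x. (?d x)\<^sup>2 \<partial>M) \<le> 0" using \<alpha> by (simp add: mult_le_0_iff)
    from integral_square_nonpos_imp_AE[OF dL this] show ?thesis
      by eventually_elim (auto simp: max_def split: if_splits)
  qed
  then have "AE x in M. \<forall>n. gs n x \<le> r x" by (simp add: AE_all_countable)
  then show "AE x in M. ext_resolvent M E \<alpha> (\<lambda>y. \<alpha> * r y) x \<le> ennreal (r x)"
    unfolding eq by eventually_elim (auto intro!: SUP_least ennreal_leI)
qed

text \<open>If \<open>\<phi>\<close> is small against the Green function \<open>g\<close>,
  resolvents of functions below \<open>\<phi>\<close> pair with them to at most \<open>C\<close>.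
  Comparison of the resolvent with \<open>v\<close> in its minimization problem bounds the pairing
  of \<open>\<phi>\<close> with \<open>v\<close> up to \<open>\<alpha>/2\<close> times a squared
  norm, and \<open>\<alpha>\<close> tends to 0.\<close>

lemma subcritical_L2_bound:
  assumes "subcritical M E"
  obtains \<phi> C where "\<phi> \<in> L2 M" "\<And>x. 0 \<le> \<phi> x" "AE x in M. 0 < \<phi> x" "0 \<le> C"
    "\<And>v. E v < \<infinity> \<Longrightarrow> (\<integral>x. \<phi> x * v x \<partial>M) \<le> C + enn2real (E v)"
proof -
  obtain f where f [measurable]: "f \<in> borel_measurable M" and fpos: "AE x in M. 0 < f x"
    and fin: "AE x in M. green_op M E f x < \<infinity>" using assms by (auto simp: subcritical_def)
  have nn: "AE x in M. 0 \<le> f x" using fpos by eventually_elim simp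
  define \<alpha> where "\<alpha> n = 1 / real (Suc n)" for n
  have \<alpha>: "\<alpha> n > 0" for n by (simp add: \<alpha>_def)
  let ?P = "\<lambda>n fs gs. (\<forall>k. fs k \<in> L2 M) \<and> (\<forall>k x. 0 \<le> fs k x) \<and>
      (AE x in M. incseq (\<lambda>k. fs k x) \<and> (\<lambda>k. fs k x) \<longlonglongrightarrow> f x) \<and>
      (\<forall>k. is_resolvent M E (\<alpha> n) (fs k) (gs k)) \<and>
      ext_resolvent M E (\<alpha> n) f = (\<lambda>x. SUP k. ennreal (gs k x))"
  have "\<exists>fs gs. ?P n fs gs" for n
    by (rule ext_resolvent_witness[OF \<alpha>[of n] f nn]) blast
  then have "\<forall>n. \<exists>fs gs. ?P n fs gs" ..
  from choice[OF this] obtain fs where "\<forall>n. \<exists>gs. ?P n (fs n) gs" ..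
  from choice[OF this] obtain gs where P: "\<forall>n. ?P n (fs n) (gs n)" ..
  then have fs: "\<And>n k. fs n k \<in> L2 M" "\<And>n k x. 0 \<le> fs n k x"
      "\<And>n. AE x in M. incseq (\<lambda>k. fs n k x) \<and> (\<lambda>k. fs n k x) \<longlonglongrightarrow> f x"
    and gs: "\<And>n k. is_resolvent M E (\<alpha> n) (fs n k) (gs n k)"
    and eq: "\<And>n. ext_resolvent M E (\<alpha> n) f = (\<lambda>x. SUP k. ennreal (gs n k x))" by simp_all
  have gsL: "gs n k \<in> L2 M" for n k using gs[of n k] by (simp add: is_resolvent_def)
  note [measurable] = L2D(1)[OF gsL] L2D(1)[OF fs(1)]
  define g where "g x = enn2real (green_op M E f x)" for x
  have green: "green_op M E f = (\<lambda>x. SUP n. SUP k. ennreal (gs n k x))"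
    unfolding green_op_def using eq by (simp add: \<alpha>_def)
  have [measurable]: "g \<in> borel_measurable M" unfolding g_def green by measurable
  have g0: "0 \<le> g x" for x by (simp add: g_def)
  have gsg: "AE x in M. gs n k x \<le> g x" for n k
    using fin
  proof eventually_elim
    case (elim x)
    have "ennreal (gs n k x) \<le> (SUP k. ennreal (gs n k x))" by (rule SUP_upper) simp
    also have "\<dots> \<le> green_op M E f x" unfolding green by (rule SUP_upper) simp
    also have "\<dots> = ennreal (g x)" using elim by (simp add: g_def)
    finally show ?case using g0 by simp
  qed
  \<comment> \<open>The denominator gives both \<open>\<phi> \<le> w\<close> (square integrability)
    and \<open>\<phi> * g \<le> w\<close> (bounded pairing); the minimum with \<open>f\<close> makes
    resolvents comparable with those of \<open>f\<close>.\<close>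
  define \<phi> where "\<phi> x = min (max (f x) 0) (w x / (1 + g x))" for x
  have \<phi>0: "0 \<le> \<phi> x" for x using w_nonneg g0[of x] by (auto simp: \<phi>_def)
  have \<phi>w: "\<phi> x \<le> w x" "\<phi> x * g x \<le> w x" for x
  proof -
    have "\<phi> x \<le> w x / (1 + g x)" by (simp add: \<phi>_def)
    then have "\<phi> x * (1 + g x) \<le> w x" using g0[of x] by (simp add: field_simps)
    moreover have "0 \<le> \<phi> x * g x" using \<phi>0 g0 by simp
    ultimately show "\<phi> x \<le> w x" "\<phi> x * g x \<le> w x" using \<phi>0[of x] by (auto simp: distrib_left)
  qed
  have [measurable]: "\<phi> \<in> borel_measurable M" unfolding \<phi>_def by measurable
  have \<phi>L: "\<phi> \<in> L2 M"
    by (rule L2_dominated[OF w_L2]) (use \<phi>0 \<phi>w w_nonneg in auto)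
  have \<phi>pos: "AE x in M. 0 < \<phi> x"
    using fpos AE_space
  proof eventually_elim
    case (elim x)
    then show ?case using w_pos[OF elim(2)] g0[of x] by (auto simp: \<phi>_def)
  qed
  define C where "C = (\<integral>x. w x \<partial>M)"
  have C0: "0 \<le> C" unfolding C_def using w_nonneg by simp
  have main: "(\<integral>x. \<phi> x * v x \<partial>M) \<le> C + enn2real (E v) + \<alpha> n / 2 * (\<integral>x. (v x)\<^sup>2 \<partial>M)"
    if v: "E v < \<infinity>" for v n
  proof -
    have vL: "v \<in> L2 M" by (rule form_finite_L2[OF v])
    note [measurable] = L2D(1)[OF vL]
    \<comment> \<open>The approximants of \<open>f\<close> depend on \<open>\<alpha> n\<close>.
      Below them the resolvent is dominated by \<open>gs n k\<close>; afterwards \<open>k\<close>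
      tends to infinity.\<close>
    define p where "p k x = min (\<phi> x) (fs n k x)" for k x
    have pL: "p k \<in> L2 M" for k unfolding p_def by (intro L2_min \<phi>L fs)
    note [measurable] = L2D(1)[OF pL]
    have p0: "0 \<le> p k x" for k x using \<phi>0 fs(2) by (simp add: p_def)
    have b: "(\<integral>x. p k x * v x \<partial>M) \<le> C + enn2real (E v) + \<alpha> n / 2 * (\<integral>x. (v x)\<^sup>2 \<partial>M)" for k
    proof -
      obtain z where z: "is_resolvent M E (\<alpha> n) (p k) z" using resolvent_exists[OF \<alpha> pL] by blast
      have zL: "z \<in> L2 M" using z by (simp add: is_resolvent_def)
      have "AE x in M. z x \<le> gs n k x"
        by (rule resolvent_mono[OF \<alpha> pL fs(1) _ z gs]) (simp add: p_def)
      then have zp: "AE x in M. z x * p k x \<le> w x"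
        using gsg[of n k]
      proof eventually_elim
        case (elim x)
        have "z x * p k x \<le> g x * \<phi> x"
          using elim p0[of k x] g0[of x] by (intro mult_mono) (auto simp: p_def)
        then show ?case using \<phi>w(2)[of x] by (simp add: mult.commute)
      qed
      have ex: "\<alpha> n / 2 * (\<integral>x. (u x - p k x / \<alpha> n)\<^sup>2 \<partial>M)
          = \<alpha> n / 2 * (\<integral>x. (u x)\<^sup>2 \<partial>M) - (\<integral>x. u x * p k x \<partial>M) + \<alpha> n / 2 * (\<integral>x. (p k x / \<alpha> n)\<^sup>2 \<partial>M)"
        if u: "u \<in> L2 M" for u
      proof -
        have "(\<lambda>x. (u x - p k x / \<alpha> n)\<^sup>2) = (\<lambda>x. (u x)\<^sup>2 - 2 / \<alpha> n * (u x * p k x) + (p k x / \<alpha> n)\<^sup>2)"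
          by (auto simp: power2_eq_square algebra_simps)
        then have "(\<integral>x. (u x - p k x / \<alpha> n)\<^sup>2 \<partial>M)
            = (\<integral>x. (u x)\<^sup>2 \<partial>M) - 2 / \<alpha> n * (\<integral>x. u x * p k x \<partial>M) + (\<integral>x. (p k x / \<alpha> n)\<^sup>2 \<partial>M)"
          using L2D(2)[OF u] L2_mult[OF u pL[of k]] L2D(2)[OF L2_divide[OF pL[of k], of "\<alpha> n"]] by simp
        then show ?thesis using \<alpha>[of n] by (simp add: distrib_left right_diff_distrib)
      qed
      have "ennreal (enn2real (E z) + \<alpha> n / 2 * (\<integral>x. (z x - p k x / \<alpha> n)\<^sup>2 \<partial>M))
          = E z + ennreal (\<alpha> n / 2 * (\<integral>x. (z x - p k x / \<alpha> n)\<^sup>2 \<partial>M))"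
        using resolvent_finite[OF z] \<alpha>[of n] by (simp add: ennreal_plus)
      also have "\<dots> \<le> E v + ennreal (\<alpha> n / 2 * (\<integral>x. (v x - p k x / \<alpha> n)\<^sup>2 \<partial>M))"
        using z vL by (simp add: is_resolvent_def)
      also have "\<dots> = ennreal (enn2real (E v) + \<alpha> n / 2 * (\<integral>x. (v x - p k x / \<alpha> n)\<^sup>2 \<partial>M))"
        using v \<alpha>[of n] by (simp add: ennreal_plus)
      finally have "enn2real (E z) + \<alpha> n / 2 * (\<integral>x. (z x - p k x / \<alpha> n)\<^sup>2 \<partial>M)
          \<le> enn2real (E v) + \<alpha> n / 2 * (\<integral>x. (v x - p k x / \<alpha> n)\<^sup>2 \<partial>M)"
        using \<alpha>[of n] by (subst (asm) ennreal_le_iff) auto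
      then have "\<alpha> n / 2 * (\<integral>x. (z x)\<^sup>2 \<partial>M) - (\<integral>x. z x * p k x \<partial>M) + enn2real (E z)
          \<le> enn2real (E v) + \<alpha> n / 2 * (\<integral>x. (v x)\<^sup>2 \<partial>M) - (\<integral>x. v x * p k x \<partial>M)"
        unfolding ex[OF zL] ex[OF vL] by linarith
      moreover have "0 \<le> \<alpha> n / 2 * (\<integral>x. (z x)\<^sup>2 \<partial>M)" using \<alpha>[of n] by simp
      moreover have "0 \<le> enn2real (E z)" by simp
      moreover have "(\<integral>x. z x * p k x \<partial>M) \<le> C"
        unfolding C_def by (rule integral_mono_AE[OF L2_mult[OF zL pL] w_int zp])
      ultimately have "(\<integral>x. v x * p k x \<partial>M) \<le> C + enn2real (E v) + \<alpha> n / 2 * (\<integral>x. (v x)\<^sup>2 \<partial>M)" by linarith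
      then show ?thesis by (simp add: mult.commute)
    qed
    have "(\<lambda>k. \<integral>x. p k x * v x \<partial>M) \<longlonglongrightarrow> (\<integral>x. \<phi> x * v x \<partial>M)"
    proof (rule integral_dominated_convergence)
      show "integrable M (\<lambda>x. \<phi> x * \<bar>v x\<bar>)" by (rule L2_mult[OF \<phi>L L2_abs[OF vL]])
      show "AE x in M. (\<lambda>k. p k x * v x) \<longlonglongrightarrow> \<phi> x * v x"
        using fs(3)[of n] fpos
      proof eventually_elim
        case (elim x)
        have "(\<lambda>k. p k x * v x) \<longlonglongrightarrow> min (\<phi> x) (f x) * v x"
          unfolding p_def by (intro tendsto_intros) (use elim in auto)
        moreover have "\<phi> x \<le> f x" using elim by (simp add: \<phi>_def)
        ultimately show ?case by (simp add: min_def)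
      qed
      show "AE x in M. norm (p k x * v x) \<le> \<phi> x * \<bar>v x\<bar>" for k
        using p0 by (intro AE_I2) (auto simp: abs_mult p_def intro!: mult_right_mono)
    qed simp_all
    then show ?thesis using b by (intro LIMSEQ_le_const2) auto
  qed
  have "(\<integral>x. \<phi> x * v x \<partial>M) \<le> C + enn2real (E v)" if v: "E v < \<infinity>" for v
  proof (rule LIMSEQ_le_const)
    have "(\<lambda>n. C + enn2real (E v) + (1 / real (Suc n)) * ((\<integral>x. (v x)\<^sup>2 \<partial>M) / 2)) \<longlonglongrightarrow> C + enn2real (E v) + 0 * ((\<integral>x. (v x)\<^sup>2 \<partial>M) / 2)"
      by (intro tendsto_add tendsto_mult_right tendsto_const one_over_Suc_tendsto)
    then show "(\<lambda>n. C + enn2real (E v) + \<alpha> n / 2 * (\<integral>x. (v x)\<^sup>2 \<partial>M)) \<longlonglongrightarrow> C + enn2real (E v)"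
      by (simp add: \<alpha>_def)
  qed (use main[OF v] in auto)
  with \<phi>L \<phi>0 \<phi>pos C0 show ?thesis by (rule that)
qed

text \<open>\<open>form_abs\<close> admits the absolute value under the integral, and Fatou's lemma
  along a recovery sequence extends the bound to \<open>Ee\<close>.\<close>

lemma subcritical_bound:
  assumes "subcritical M E"
  obtains \<phi> C where "\<phi> \<in> borel_measurable M" "\<And>x. 0 \<le> \<phi> x" "AE x in M. 0 < \<phi> x" "0 \<le> C"
    "\<And>v. (\<integral>\<^sup>+x. ennreal (\<phi> x * \<bar>v x\<bar>) \<partial>M) \<le> ennreal C + Ee v"
proof -
  obtain \<phi> C where \<phi>: "\<phi> \<in> L2 M" "\<And>x. 0 \<le> \<phi> x" "AE x in M. 0 < \<phi> x" and C: "0 \<le> C"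
    and bd: "\<And>v. E v < \<infinity> \<Longrightarrow> (\<integral>x. \<phi> x * v x \<partial>M) \<le> C + enn2real (E v)"
    using subcritical_L2_bound[OF assms] by blast
  note [measurable] = L2D(1)[OF \<phi>(1)]
  have L2: "(\<integral>\<^sup>+x. ennreal (\<phi> x * \<bar>v x\<bar>) \<partial>M) \<le> ennreal C + E v" if v: "E v < \<infinity>" for v
  proof -
    have vL: "v \<in> L2 M" by (rule form_finite_L2[OF v])
    have av: "E (\<lambda>x. \<bar>v x\<bar>) < \<infinity>" using form_abs v by (rule order_le_less_trans)
    have "(\<integral>\<^sup>+x. ennreal (\<phi> x * \<bar>v x\<bar>) \<partial>M) = ennreal (\<integral>x. \<phi> x * \<bar>v x\<bar> \<partial>M)"
      using L2_mult[OF \<phi>(1) L2_abs[OF vL]] \<phi>(2) by (intro nn_integral_eq_integral) auto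
    also have "\<dots> \<le> ennreal (C + enn2real (E (\<lambda>x. \<bar>v x\<bar>)))" by (intro ennreal_leI bd av)
    also have "\<dots> = ennreal C + E (\<lambda>x. \<bar>v x\<bar>)" using C av by (simp add: ennreal_plus)
    also have "\<dots> \<le> ennreal C + E v" by (intro add_left_mono form_abs)
    finally show ?thesis .
  qed
  have "(\<integral>\<^sup>+x. ennreal (\<phi> x * \<bar>v x\<bar>) \<partial>M) \<le> ennreal C + Ee v" for v
  proof (cases "Ee v < \<infinity>")
    case True
    show ?thesis
    proof (rule ennreal_le_epsilon)
      fix e :: real assume e: "0 < e"
      have lt: "Ee v < Ee v + ennreal e" using True e by simp
      obtain gs where gs: "\<And>k. gs k \<in> L2 M" "\<And>k. E (gs k) < Ee v + ennreal e" "AE x in M. (\<lambda>k. gs k x) \<longlonglongrightarrow> v x"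
        using Ee_approx[OF lt] by blast
      have [measurable]: "\<And>k. gs k \<in> borel_measurable M" using gs(1) L2D by blast
      have "(\<integral>\<^sup>+x. ennreal (\<phi> x * \<bar>v x\<bar>) \<partial>M) = (\<integral>\<^sup>+x. liminf (\<lambda>k. ennreal (\<phi> x * \<bar>gs k x\<bar>)) \<partial>M)"
      proof (rule nn_integral_cong_AE)
        show "AE x in M. ennreal (\<phi> x * \<bar>v x\<bar>) = liminf (\<lambda>k. ennreal (\<phi> x * \<bar>gs k x\<bar>))"
          using gs(3)
        proof eventually_elim
          case (elim x)
          have "(\<lambda>k. ennreal (\<phi> x * \<bar>gs k x\<bar>)) \<longlonglongrightarrow> ennreal (\<phi> x * \<bar>v x\<bar>)"
            by (intro tendsto_intros elim)
          then show ?case by (simp add: lim_imp_Liminf)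
        qed
      qed
      also have "\<dots> \<le> liminf (\<lambda>k. \<integral>\<^sup>+x. ennreal (\<phi> x * \<bar>gs k x\<bar>) \<partial>M)"
        by (rule nn_integral_liminf) simp
      also have "\<dots> \<le> ennreal C + (Ee v + ennreal e)"
      proof (rule liminf_le_const)
        fix k
        have "E (gs k) < \<infinity>" using order_less_le_trans[OF gs(2) top_greatest] by simp
        from L2[OF this] show "(\<integral>\<^sup>+x. ennreal (\<phi> x * \<bar>gs k x\<bar>) \<partial>M) \<le> ennreal C + (Ee v + ennreal e)"
          by (rule order_trans) (intro add_left_mono less_imp_le[OF gs(2)])
      qed
      finally show "(\<integral>\<^sup>+x. ennreal (\<phi> x * \<bar>v x\<bar>) \<partial>M) \<le> ennreal C + Ee v + ennreal e" by (simp add: ac_simps)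
    qed
  next
    case False
    then have "Ee v = top" by (simp add: less_top[symmetric])
    then show ?thesis by simp
  qed
  with L2D(1)[OF \<phi>(1)] \<phi>(2,3) C show ?thesis by (rule that)
qed

end

section \<open>The Delta-two condition and reflexivity\<close>

text \<open>Iterated doubling reaches a power of 2 above \<open>|a|\<close>; convexity scales back
  down.\<close>

lemma doubling_scale_bound:
  fixes F :: "('b \<Rightarrow> real) \<Rightarrow> ennreal"
  assumes dbl: "\<And>f. F (\<lambda>x. 2 * f x) \<le> ennreal K * F f"
    and conv: "\<And>f t. 0 \<le> t \<Longrightarrow> t \<le> 1 \<Longrightarrow> F (\<lambda>x. t * f x) \<le> ennreal t * F f"
    and sym: "\<And>f. F (\<lambda>x. - f x) = F f"
  obtains B where "0 \<le> B" "\<And>f. F (\<lambda>x. a * f x) \<le> ennreal B * F f"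
proof -
  obtain m :: nat where m: "\<bar>a\<bar> < 2 ^ m" using real_arch_pow[of 2 "\<bar>a\<bar>"] by auto
  \<comment> \<open>\<open>max K 0\<close> has the same \<open>ennreal\<close> value as
    \<open>K\<close> and is nonnegative, as \<open>ennreal_power\<close> demands.\<close>
  have pow: "F (\<lambda>x. 2 ^ m * f x) \<le> ennreal (max K 0) ^ m * F f" for f
  proof (induction m arbitrary: f)
    case (Suc m)
    have "F (\<lambda>x. 2 ^ Suc m * f x) = F (\<lambda>x. 2 ^ m * (2 * f x))" by (simp add: mult.assoc mult.left_commute)
    also have "\<dots> \<le> ennreal (max K 0) ^ m * F (\<lambda>x. 2 * f x)" by (rule Suc)
    also have "\<dots> \<le> ennreal (max K 0) ^ m * (ennreal (max K 0) * F f)"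
      by (rule mult_left_mono[OF order_trans[OF dbl mult_right_mono]]) (auto intro!: ennreal_leI)
    finally show ?case by (simp add: ac_simps)
  qed simp
  have "F (\<lambda>x. a * f x) \<le> ennreal (max K 0 ^ m) * F f" for f
  proof -
    have "F (\<lambda>x. a * f x) = F (\<lambda>x. \<bar>a\<bar> * f x)"
    proof (cases "a \<ge> 0")
      case False then show ?thesis using sym[of "\<lambda>x. a * f x"] by simp
    qed simp
    also have "(\<lambda>x. \<bar>a\<bar> * f x) = (\<lambda>x. (\<bar>a\<bar> / 2 ^ m) * (2 ^ m * f x))" by simp
    also have "F \<dots> \<le> ennreal (\<bar>a\<bar> / 2 ^ m) * F (\<lambda>x. 2 ^ m * f x)" using m by (intro conv) auto
    also have "\<dots> \<le> 1 * F (\<lambda>x. 2 ^ m * f x)" using m by (intro mult_right_mono) (auto simp: ennreal_le_1)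
    also have "\<dots> \<le> ennreal (max K 0) ^ m * F f" unfolding mult_1 by (rule pow)
    also have "ennreal (max K 0) ^ m = ennreal (max K 0 ^ m)" by (rule ennreal_power) simp
    finally show ?thesis .
  qed
  then show ?thesis by (intro that[of "max K 0 ^ m"]) auto
qed

text \<open>The scaling bound carries finiteness from one small multiple back to \<open>f\<close>;
  conversely, convexity gives the decay at 0.\<close>

lemma modular_space_eq_domain:
  fixes F :: "('b \<Rightarrow> real) \<Rightarrow> ennreal"
  assumes conv: "\<And>f t. 0 \<le> t \<Longrightarrow> t \<le> 1 \<Longrightarrow> F (\<lambda>x. t * f x) \<le> ennreal t * F f"
    and scale: "\<And>a. \<exists>B\<ge>0. \<forall>f. F (\<lambda>x. a * f x) \<le> ennreal B * F f"
  shows "modular_space F = {f. F f < \<infinity>}"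
proof (intro set_eqI iffI CollectI)
  fix f assume "f \<in> modular_space F"
  then have "eventually (\<lambda>t::real. F (\<lambda>x. t * f x) < 1) (at_right 0)"
    unfolding modular_space_def mem_Collect_eq by (rule order_tendstoD) simp
  then obtain b :: real where b: "b > 0" "\<And>t. 0 < t \<Longrightarrow> t < b \<Longrightarrow> F (\<lambda>x. t * f x) < 1"
    unfolding eventually_at_right_field by auto
  define t where "t = b / 2"
  have t: "t > 0" "t < b" using b by (auto simp: t_def)
  note t = t(1) b(2)[OF t]
  obtain B where B: "B \<ge> 0" "\<And>f. F (\<lambda>x. (1/t) * f x) \<le> ennreal B * F f" using scale[of "1/t"] by blast
  have "F f = F (\<lambda>x. (1/t) * (t * f x))" using t by simp
  also have "\<dots> \<le> ennreal B * F (\<lambda>x. t * f x)" by (rule B)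
  also have "\<dots> \<le> ennreal B * 1" using t by (intro mult_left_mono) auto
  also have "\<dots> < \<infinity>" by simp
  finally show "F f < \<infinity>" .
next
  fix f assume "f \<in> {f. F f < \<infinity>}"
  then have "F f = ennreal (enn2real (F f))" by simp
  then obtain c where c: "F f = ennreal c" "0 \<le> c" by (metis enn2real_nonneg)
  have "((\<lambda>t::real. F (\<lambda>x. t * f x)) \<longlongrightarrow> 0) (at_right 0)"
  proof (rule tendsto_sandwich[of "\<lambda>t. 0" _ _ "\<lambda>t. ennreal (t * c)"])
    show "eventually (\<lambda>t. F (\<lambda>x. t * f x) \<le> ennreal (t * c)) (at_right 0)"
      unfolding eventually_at_right_field
    proof (intro exI[of _ 1] conjI allI impI)
      fix t :: real assume "0 < t" "t < 1"
      then show "F (\<lambda>x. t * f x) \<le> ennreal (t * c)" using conv[of t f] c by (simp add: ennreal_mult)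
    qed simp
    have "((\<lambda>t. ennreal (t * c)) \<longlongrightarrow> ennreal (0 * c)) (at_right 0)" by (intro tendsto_intros)
    then show "((\<lambda>t. ennreal (t * c)) \<longlongrightarrow> 0) (at_right 0)" by simp
  qed auto
  then show "f \<in> modular_space F" by (simp add: modular_space_def)
qed

lemma domain_subspace:
  fixes F :: "('b \<Rightarrow> real) \<Rightarrow> ennreal"
  assumes conv: "\<And>t f g. 0 \<le> t \<Longrightarrow> t \<le> 1 \<Longrightarrow>
        F (\<lambda>x. t * f x + (1 - t) * g x) \<le> ennreal t * F f + ennreal (1 - t) * F g"
    and scale: "\<And>a. \<exists>B\<ge>0. \<forall>f. F (\<lambda>x. a * f x) \<le> ennreal B * F f" and zero: "F (\<lambda>x. 0) = 0"
  shows "fun_subspace {f. F f < \<infinity>}"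
  unfolding fun_subspace_def mem_Collect_eq
proof (intro conjI allI impI ballI)
  fix f g a b assume f: "f \<in> {f. F f < \<infinity>}" and g: "g \<in> {f. F f < \<infinity>}"
  obtain A B where A: "\<And>f. F (\<lambda>x. (2*a) * f x) \<le> ennreal A * F f" and B: "\<And>f. F (\<lambda>x. (2*b) * f x) \<le> ennreal B * F f"
    using scale by meson
  have "F (\<lambda>x. a * f x + b * g x) = F (\<lambda>x. (1/2) * ((2*a) * f x) + (1 - 1/2) * ((2*b) * g x))" by simp
  also have "\<dots> \<le> ennreal (1/2) * F (\<lambda>x. (2*a) * f x) + ennreal (1 - 1/2) * F (\<lambda>x. (2*b) * g x)"
    by (rule conv) auto
  also have "\<dots> \<le> 1 * (ennreal A * F f) + 1 * (ennreal B * F g)"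
    by (intro add_mono mult_mono A B) (auto simp: ennreal_le_1 simp del: ennreal_half)
  also have "\<dots> < \<infinity>" using f g by (auto simp: ennreal_mult_eq_top_iff less_top[symmetric])
  finally show "F (\<lambda>x. a * f x + b * g x) < \<infinity>" .
qed (simp add: zero)

section \<open>The Luxemburg seminorm, its dual and reflexivity\<close>

lemma luxemburg_le: "0 < l \<Longrightarrow> F (\<lambda>x. f x / l) \<le> 1 \<Longrightarrow> luxemburg F f \<le> ennreal l"
  unfolding luxemburg_def by (rule Inf_lower) auto

lemma luxemburg_less_imp:
  assumes conv: "\<And>f t. 0 \<le> t \<Longrightarrow> t \<le> 1 \<Longrightarrow> F (\<lambda>x. t * f x) \<le> ennreal t * F f"
    and "luxemburg F f < ennreal l"
  shows "F (\<lambda>x. f x / l) \<le> 1"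
proof -
  obtain k where k: "0 < k" "F (\<lambda>x. f x / k) \<le> 1" "ennreal k < ennreal l"
    using assms(2) unfolding luxemburg_def Inf_less_iff by auto
  then have kl: "k < l" by (simp add: ennreal_less_iff)
  have "F (\<lambda>x. f x / l) = F (\<lambda>x. (k / l) * (f x / k))" using k kl by simp
  also have "\<dots> \<le> ennreal (k / l) * F (\<lambda>x. f x / k)" using k kl by (intro conv) auto
  also have "\<dots> \<le> 1 * 1" using k kl by (intro mult_mono) (auto simp: ennreal_le_1)
  finally show ?thesis by simp
qed

locale delta2_form = extended_form M w E for M :: "'a measure" and w E +
  assumes d2: "delta2_condition E"
begin

lemma E_scale_le: "0 \<le> t \<Longrightarrow> t \<le> 1 \<Longrightarrow> E (\<lambda>x. t * f x) \<le> ennreal t * E f"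
  using form_convex[of t f "\<lambda>x. 0"] by (simp add: form_zero)

lemma E_scale_bound: "\<exists>B\<ge>0. \<forall>f. E (\<lambda>x. a * f x) \<le> ennreal B * E f"
proof -
  obtain K where "\<And>f. E (\<lambda>x. 2 * f x) \<le> ennreal K * E f" using d2 by (auto simp: delta2_condition_def)
  from doubling_scale_bound[where F = E, OF this E_scale_le form_minus] show ?thesis by metis
qed

lemma Ee_scale_bound: "\<exists>B\<ge>0. \<forall>f. Ee (\<lambda>x. a * f x) \<le> ennreal B * Ee f"
proof -
  obtain K0 where K0: "\<And>f. E (\<lambda>x. 2 * f x) \<le> ennreal K0 * E f" using d2 by (auto simp: delta2_condition_def)
  define K where "K = max K0 1"
  have K: "E (\<lambda>x. 2 * f x) \<le> ennreal K * E f" for f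
    by (rule order_trans[OF K0]) (auto simp: K_def intro!: mult_right_mono ennreal_leI)
  have "K \<ge> 1" by (simp add: K_def)
  then have "Ee (\<lambda>x. 2 * f x) \<le> ennreal K * Ee f" for f
    using Ee_superposition_le[of "\<lambda>x y. 2 * y" K f] K by simp
  from doubling_scale_bound[where F = Ee, OF this Ee_scale_le Ee_minus] show ?thesis by metis
qed

lemma Ee_add_bound: "\<exists>B\<ge>0. \<forall>f g. Ee (\<lambda>x. f x + g x) \<le> ennreal B * (Ee f + Ee g)"
proof -
  obtain B where B: "B \<ge> 0" "\<And>f. Ee (\<lambda>x. 2 * f x) \<le> ennreal B * Ee f" using Ee_scale_bound[of 2] by blast
  have "Ee (\<lambda>x. f x + g x) \<le> ennreal B * (Ee f + Ee g)" for f g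
  proof -
    have "Ee (\<lambda>x. f x + g x) = Ee (\<lambda>x. (1/2) * (2 * f x) + (1 - 1/2) * (2 * g x))" by simp
    also have "\<dots> \<le> ennreal (1/2) * Ee (\<lambda>x. 2 * f x) + ennreal (1 - 1/2) * Ee (\<lambda>x. 2 * g x)"
      by (rule Ee_convex) auto
    also have "\<dots> \<le> 1 * (ennreal B * Ee f) + 1 * (ennreal B * Ee g)"
      by (intro add_mono mult_mono B) (auto simp: ennreal_le_1 simp del: ennreal_half)
    finally show ?thesis by (simp add: distrib_left)
  qed
  then show ?thesis using B(1) by blast
qed

lemma modular_E: "modular_space E = {f. E f < \<infinity>}"
  using E_scale_le E_scale_bound by (rule modular_space_eq_domain[where F = E])

lemma modular_Ee: "modular_space Ee = {f. Ee f < \<infinity>}"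
  using Ee_scale_le Ee_scale_bound by (rule modular_space_eq_domain[where F = Ee])

lemma modular_E_subspace: "fun_subspace (modular_space E)"
  unfolding modular_E using form_convex E_scale_bound form_zero by (rule domain_subspace)

lemma modular_Ee_subspace: "fun_subspace (modular_space Ee)"
  unfolding modular_Ee using Ee_convex Ee_scale_bound Ee_zero by (rule domain_subspace)

text \<open>\<open>max 1 c\<close> and not \<open>c\<close>, because convexity gives the scaling
  inequality for factors at most 1.\<close>

lemma E_luxemburg_bound:
  assumes "E f \<le> ennreal c"
  shows "luxemburg E f \<le> ennreal (max 1 c)"
proof (rule luxemburg_le[where F = E])
  have "E (\<lambda>x. f x / max 1 c) = E (\<lambda>x. (1 / max 1 c) * f x)" by simp
  also have "\<dots> \<le> ennreal (1 / max 1 c) * E f" by (intro E_scale_le) auto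
  also have "\<dots> \<le> ennreal (1 / max 1 c) * ennreal (max 1 c)"
    by (intro mult_left_mono order_trans[OF assms] ennreal_leI) auto
  also have "\<dots> = 1" by (subst ennreal_mult[symmetric]) auto
  finally show "E (\<lambda>x. f x / max 1 c) \<le> 1" .
qed simp

text \<open>\<open>enn2real\<close> sends infinity to 0, so \<open>lux\<close> is meaningful on the
  modular space, where \<open>luxemburg_finite\<close> applies.\<close>

definition lux :: "('a \<Rightarrow> real) \<Rightarrow> real" where "lux f = enn2real (luxemburg E f)"

lemma luxemburg_finite:
  assumes "f \<in> modular_space E"
  shows "luxemburg E f = ennreal (lux f)"
proof -
  have "E f \<le> ennreal (enn2real (E f))" using assms by (simp add: modular_E)
  from le_less_trans[OF E_luxemburg_bound[OF this] ennreal_less_top] have "luxemburg E f < top" .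
  then show ?thesis by (simp add: lux_def)
qed

lemma lux_le:
  assumes "f \<in> modular_space E" "0 < l" "E (\<lambda>x. f x / l) \<le> 1"
  shows "lux f \<le> l"
proof -
  have "luxemburg E f \<le> ennreal l" by (rule luxemburg_le[where F = E and f = f]) (fact assms)+
  then have "enn2real (luxemburg E f) \<le> enn2real (ennreal l)" by (rule enn2real_mono) simp
  then show ?thesis using assms(2) by (simp add: lux_def)
qed

lemma lux_nonneg: "0 \<le> lux f"
  by (simp add: lux_def)

lemma lux_less_imp:
  assumes "f \<in> modular_space E" "lux f < l"
  shows "E (\<lambda>x. f x / l) \<le> 1"
proof (rule luxemburg_less_imp[where F = E and f = f])
  have "luxemburg E f = ennreal (lux f)" by (rule luxemburg_finite[OF assms(1)])
  also have "\<dots> < ennreal l" by (rule ennreal_lessI) (use assms(2) lux_nonneg[of f] in auto)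
  finally show "luxemburg E f < ennreal l" .
qed (rule E_scale_le)

lemma lux_sublinear: "sublinear_on (modular_space E) lux"
proof (rule sublinear_onI[OF modular_E_subspace])
  have "lux (\<lambda>x. 0) \<le> 0"
    by (rule dense_ge, rule lux_le[OF fun_subspace_zero[OF modular_E_subspace]]) (simp_all add: form_zero)
  then show "lux (\<lambda>x. 0) = 0" using lux_nonneg[of "\<lambda>x. 0"] by simp
next
  note V = modular_E_subspace
  fix f g assume f: "f \<in> modular_space E" and g: "g \<in> modular_space E"
  have "lux (\<lambda>x. f x + g x) \<le> l + k" if l: "lux f < l" and k: "lux g < k" for l k
  proof -
    have pos: "l > 0" "k > 0" using l k lux_nonneg[of f] lux_nonneg[of g] by linarith+
    \<comment> \<open>The normalized sum is a convex combination of \<open>f / l\<close> and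
      \<open>g / k\<close>; here convexity becomes the triangle inequality.\<close>
    have "E (\<lambda>x. (f x + g x) / (l + k)) = E (\<lambda>x. (l / (l + k)) * (f x / l) + (1 - l / (l + k)) * (g x / k))"
    proof -
      have "1 - l / (l + k) = k / (l + k)" using pos by (simp add: field_simps)
      then show ?thesis using pos by (simp add: add_divide_distrib)
    qed
    also have "\<dots> \<le> ennreal (l / (l + k)) * E (\<lambda>x. f x / l) + ennreal (1 - l / (l + k)) * E (\<lambda>x. g x / k)"
      using pos by (intro form_convex) auto
    also have "\<dots> \<le> ennreal (l / (l + k)) * 1 + ennreal (1 - l / (l + k)) * 1"
      by (intro add_mono mult_left_mono lux_less_imp f g l k) auto
    also have "\<dots> = 1" using pos by (simp add: ennreal_plus[symmetric] del: ennreal_plus)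
    finally show ?thesis using pos by (intro lux_le fun_subspace_add[OF V f g]) auto
  qed
  note add = this
  have "lux (\<lambda>x. f x + g x) - k \<le> lux f" if k: "lux g < k" for k
  proof (rule dense_ge)
    fix l assume "lux f < l"
    from add[OF this k] show "lux (\<lambda>x. f x + g x) - k \<le> l" by simp
  qed
  note diff = this
  have "lux (\<lambda>x. f x + g x) - lux f \<le> lux g"
  proof (rule dense_ge)
    fix k assume "lux g < k"
    from diff[OF this] show "lux (\<lambda>x. f x + g x) - lux f \<le> k" by simp
  qed
  then show "lux (\<lambda>x. f x + g x) \<le> lux f + lux g" by simp
next
  note V = modular_E_subspace
  fix f and u :: real assume f: "f \<in> modular_space E" and u: "0 < u"
  have "lux (\<lambda>x. u * f x) / u \<le> lux f"
  proof (rule dense_ge)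
    fix l assume l: "lux f < l"
    have "l > 0" using l lux_nonneg[of f] by linarith
    have "E (\<lambda>x. u * f x / (u * l)) \<le> 1" using lux_less_imp[OF f l] u by simp
    then have "lux (\<lambda>x. u * f x) \<le> u * l"
      using u \<open>l > 0\<close> by (intro lux_le fun_subspace_scale[OF V f]) auto
    then show "lux (\<lambda>x. u * f x) / u \<le> l" using u by (simp add: field_simps)
  qed
  then show "lux (\<lambda>x. u * f x) \<le> u * lux f" using u by (simp add: field_simps)
qed

lemma lux_minus: "lux (\<lambda>x. - f x) = lux f"
proof -
  have "E (\<lambda>x. - f x / l) = E (\<lambda>x. f x / l)" for l using form_minus[of "\<lambda>x. f x / l"] by simp
  then show ?thesis unfolding lux_def luxemburg_def by simp
qed

text \<open>Gives a functional dominated by \<open>lux\<close> the shape demanded by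
  \<open>dual_space\<close>, with value 0 off the modular space, so that separating functionals can
  be fed into reflexivity.\<close>

lemma dual_spaceI:
  assumes lin: "linear_fun_on (modular_space E) \<phi>" and le: "\<And>f. f \<in> modular_space E \<Longrightarrow> \<phi> f \<le> lux f"
  shows "(\<lambda>f. if f \<in> modular_space E then \<phi> f else 0) \<in> dual_space E"
    and "dual_norm E (\<lambda>f. if f \<in> modular_space E then \<phi> f else 0) \<le> 1"
proof -
  let ?\<phi> = "\<lambda>f. if f \<in> modular_space E then \<phi> f else 0"
  note V = modular_E_subspace
  have abs: "\<bar>\<phi> f\<bar> \<le> lux f" if f: "f \<in> modular_space E" for f
  proof -
    have "\<phi> (\<lambda>x. (-1) * f x + 0 * f x) = (-1) * \<phi> f + 0 * \<phi> f"
      using lin f unfolding linear_fun_on_def by blast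
    then have "- \<phi> f \<le> lux f" using le[OF fun_subspace_minus[OF V f]] by (simp add: lux_minus)
    then show ?thesis using le[OF f] by simp
  qed
  show "?\<phi> \<in> dual_space E"
    unfolding dual_space_def mem_Collect_eq
  proof (intro conjI)
    show "\<forall>f\<in>modular_space E. \<forall>g\<in>modular_space E. \<forall>a b.
        ?\<phi> (\<lambda>x. a * f x + b * g x) = a * ?\<phi> f + b * ?\<phi> g"
      using lin fun_subspace_lin[OF V] by (simp add: linear_fun_on_def)
    show "\<exists>C. \<forall>f\<in>modular_space E. \<bar>?\<phi> f\<bar> \<le> C * enn2real (luxemburg E f)"
      using abs by (intro exI[of _ 1]) (simp add: lux_def)
  qed simp
  show "dual_norm E ?\<phi> \<le> 1"
    unfolding dual_norm_def
  proof (rule cSup_least)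
    have "luxemburg E (\<lambda>x. 0) \<le> 1" using luxemburg_le[of 1 E "\<lambda>x. 0"] by (simp add: form_zero)
    then show "{\<bar>?\<phi> f\<bar> | f. f \<in> modular_space E \<and> luxemburg E f \<le> 1} \<noteq> {}"
      using fun_subspace_zero[OF V] by blast
    fix y assume "y \<in> {\<bar>?\<phi> f\<bar> | f. f \<in> modular_space E \<and> luxemburg E f \<le> 1}"
    then obtain f where f: "f \<in> modular_space E" "luxemburg E f \<le> 1" "y = \<bar>\<phi> f\<bar>" by auto
    have "lux f \<le> 1" using f(1,2) by (simp add: luxemburg_finite ennreal_le_1)
    then show "y \<le> 1" using abs[OF f(1)] f(3) by simp
  qed
qed

lemma dual_space_bounded:
  assumes "\<phi> \<in> dual_space E"
  shows "\<exists>C. \<forall>f\<in>modular_space E. \<bar>\<phi> f\<bar> \<le> C * enn2real (luxemburg E f)"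
  using assms unfolding dual_space_def by blast

lemma dual_space_lin:
  assumes \<phi>: "\<phi> \<in> dual_space E" and \<psi>: "\<psi> \<in> dual_space E"
  shows "(\<lambda>f. a * \<phi> f + b * \<psi> f) \<in> dual_space E"
  unfolding dual_space_def mem_Collect_eq
proof (intro conjI)
  show "\<forall>f\<in>modular_space E. \<forall>g\<in>modular_space E. \<forall>c d.
      a * \<phi> (\<lambda>x. c * f x + d * g x) + b * \<psi> (\<lambda>x. c * f x + d * g x)
        = c * (a * \<phi> f + b * \<psi> f) + d * (a * \<phi> g + b * \<psi> g)"
    using \<phi> \<psi> by (auto simp: dual_space_def algebra_simps)
  obtain C where C: "\<And>f. f \<in> modular_space E \<Longrightarrow> \<bar>\<phi> f\<bar> \<le> C * enn2real (luxemburg E f)"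
    using dual_space_bounded[OF \<phi>] by blast
  obtain D where D: "\<And>f. f \<in> modular_space E \<Longrightarrow> \<bar>\<psi> f\<bar> \<le> D * enn2real (luxemburg E f)"
    using dual_space_bounded[OF \<psi>] by blast
  show "\<exists>C. \<forall>f\<in>modular_space E. \<bar>a * \<phi> f + b * \<psi> f\<bar> \<le> C * enn2real (luxemburg E f)"
  proof (intro exI[of _ "\<bar>a\<bar> * C + \<bar>b\<bar> * D"] ballI)
    fix f assume f: "f \<in> modular_space E"
    have "\<bar>a * \<phi> f + b * \<psi> f\<bar> \<le> \<bar>a\<bar> * \<bar>\<phi> f\<bar> + \<bar>b\<bar> * \<bar>\<psi> f\<bar>"
      using abs_triangle_ineq[of "a * \<phi> f" "b * \<psi> f"] by (simp add: abs_mult)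
    also have "\<dots> \<le> \<bar>a\<bar> * (C * enn2real (luxemburg E f)) + \<bar>b\<bar> * (D * enn2real (luxemburg E f))"
      by (intro add_mono mult_left_mono C D f) auto
    finally show "\<bar>a * \<phi> f + b * \<psi> f\<bar> \<le> (\<bar>a\<bar> * C + \<bar>b\<bar> * D) * enn2real (luxemburg E f)"
      by (simp add: algebra_simps)
  qed
  show "\<forall>f. f \<notin> modular_space E \<longrightarrow> a * \<phi> f + b * \<psi> f = 0"
    using \<phi> \<psi> by (auto simp: dual_space_def)
qed

text \<open>Division by \<open>max 1 c\<close> moves \<open>u\<close> into the Luxemburg unit ball.
  The constant \<open>C\<close> shows that the real supremum is taken over a bounded set.\<close>

lemma dual_norm_bound:
  assumes \<phi>: "\<phi> \<in> dual_space E" and u: "E u \<le> ennreal c"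
  shows "\<bar>\<phi> u\<bar> \<le> max 1 c * dual_norm E \<phi>"
proof -
  note V = modular_E_subspace
  have uV: "u \<in> modular_space E" using u le_less_trans by (fastforce simp: modular_E)
  let ?v = "\<lambda>x. (1 / max 1 c) * u x"
  have vV: "?v \<in> modular_space E" by (rule fun_subspace_scale[OF V uV])
  have "E (\<lambda>x. ?v x / 1) \<le> 1"
  proof -
    have "E ?v \<le> ennreal (1 / max 1 c) * E u" by (intro E_scale_le) auto
    also have "\<dots> \<le> ennreal (1 / max 1 c) * ennreal (max 1 c)"
      by (intro mult_left_mono order_trans[OF u] ennreal_leI) auto
    also have "\<dots> = 1" by (subst ennreal_mult[symmetric]) auto
    finally show ?thesis by simp
  qed
  then have vl: "luxemburg E ?v \<le> 1" using luxemburg_le[of 1 E ?v] by simp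
  obtain C where C: "\<And>f. f \<in> modular_space E \<Longrightarrow> \<bar>\<phi> f\<bar> \<le> C * enn2real (luxemburg E f)"
    using dual_space_bounded[OF \<phi>] by blast
  have "\<bar>\<phi> ?v\<bar> \<le> dual_norm E \<phi>"
    unfolding dual_norm_def
  proof (rule cSup_upper)
    show "bdd_above {\<bar>\<phi> f\<bar> | f. f \<in> modular_space E \<and> luxemburg E f \<le> 1}"
    proof (rule bdd_aboveI)
      fix y assume "y \<in> {\<bar>\<phi> f\<bar> | f. f \<in> modular_space E \<and> luxemburg E f \<le> 1}"
      then obtain f where f: "f \<in> modular_space E" "luxemburg E f \<le> 1" "y = \<bar>\<phi> f\<bar>" by auto
      have l: "lux f \<le> 1" using f(1,2) by (simp add: luxemburg_finite ennreal_le_1)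
      have "y \<le> C * lux f" using C[OF f(1)] f(3) by (simp add: lux_def)
      also have "\<dots> \<le> \<bar>C\<bar> * 1" using l lux_nonneg[of f] by (intro mult_mono) auto
      finally show "y \<le> \<bar>C\<bar>" by simp
    qed
  qed (use vV vl in blast)
  moreover have "\<phi> (\<lambda>x. (1 / max 1 c) * u x + 0 * u x) = (1 / max 1 c) * \<phi> u + 0 * \<phi> u"
    using \<phi> uV unfolding dual_space_def by blast
  ultimately have "\<bar>(1 / max 1 c) * \<phi> u\<bar> \<le> dual_norm E \<phi>" by simp
  then have "\<bar>\<phi> u\<bar> / max 1 c \<le> dual_norm E \<phi>" by (simp add: abs_mult)
  then show ?thesis by (simp add: pos_divide_le_eq mult.commute)
qed

lemma E_cvx_hull_le:
  assumes "f \<in> cvx_hull S" "\<And>s. s \<in> S \<Longrightarrow> E s \<le> c"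
  shows "E f \<le> c"
  using assms(1)
proof induction
  case (step a b t)
  have "E (\<lambda>x. t * a x + (1 - t) * b x) \<le> ennreal t * E a + ennreal (1 - t) * E b"
    using step by (intro form_convex)
  also have "\<dots> \<le> ennreal t * c + ennreal (1 - t) * c" using step by (intro add_mono mult_left_mono) auto
  also have "\<dots> = (ennreal t + ennreal (1 - t)) * c" by (simp add: distrib_right)
  also have "ennreal t + ennreal (1 - t) = 1" using step by (simp add: ennreal_plus[symmetric] del: ennreal_plus)
  finally show ?case by simp
qed (rule assms(2))

text \<open>A weak-star cluster point of the sequence \<open>u\<close> in the bidual is, up to \<open>\<epsilon>\<close>, an element
  \<open>v\<^sub>0\<close> of the modular space; by separation every tail of \<open>u\<close> has convex combinations close to
  \<open>v\<^sub>0\<close>, and lower semicontinuity then forces \<open>v\<^sub>0\<close> to be close to the pointwise limit.\<close>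

lemma reflexive_convex_approx:
  assumes refl: "reflexive_form E"
    and u: "\<And>n. E (u n) \<le> ennreal c" and v [measurable]: "v \<in> borel_measurable M"
    and lim: "AE x in M. (\<lambda>n. u n x) \<longlonglongrightarrow> v x" and \<delta>: "0 < \<delta>"
  obtains g where "g \<in> cvx_hull (range u)" "Ee (\<lambda>x. v x - g x) \<le> ennreal \<delta>"
proof -
  note V = modular_E_subspace
  \<comment> \<open>The limit \<open>v\<close> and the combination both lie within
    \<open>2 * \<epsilon>\<close> of \<open>v0\<close>, hence within \<open>4 * \<epsilon>\<close>
    of each other; \<open>4 * \<epsilon> \<le> 1\<close> lets convexity convert this into energy at
    most \<open>\<delta>\<close>.\<close>
  define \<epsilon> where "\<epsilon> = min 1 \<delta> / 4"
  have \<epsilon>: "0 < \<epsilon>" "4 * \<epsilon> \<le> 1" "4 * \<epsilon> \<le> \<delta>" using \<delta> by (auto simp: \<epsilon>_def)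
  obtain L where L: "linear_fun_on bounded_seqs L"
    and Lup: "\<And>x c. x \<in> bounded_seqs \<Longrightarrow> eventually (\<lambda>n. x n \<le> c) sequentially \<Longrightarrow> L x \<le> c"
    and Llow: "\<And>x c. x \<in> bounded_seqs \<Longrightarrow> eventually (\<lambda>n. c \<le> x n) sequentially \<Longrightarrow> c \<le> L x"
    using generalized_limit by blast
  have bs: "(\<lambda>n. \<phi> (u n)) \<in> bounded_seqs" if "\<phi> \<in> dual_space E" for \<phi>
    unfolding bounded_seqs_def using dual_norm_bound[OF that u] by blast
  \<comment> \<open>The cluster point in the bidual: the generalized limit of the functionals along
    \<open>u\<close>, set to 0 off the dual as \<open>bidual_space\<close> demands.\<close>
  define \<Phi> where "\<Phi> \<phi> = (if \<phi> \<in> dual_space E then L (\<lambda>n. \<phi> (u n)) else 0)" for \<phi>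
  have "\<Phi> \<in> bidual_space E"
    unfolding bidual_space_def mem_Collect_eq
  proof (intro conjI)
    show "\<forall>\<phi>\<in>dual_space E. \<forall>\<psi>\<in>dual_space E. \<forall>a b. \<Phi> (\<lambda>f. a * \<phi> f + b * \<psi> f) = a * \<Phi> \<phi> + b * \<Phi> \<psi>"
      using L bs by (simp add: \<Phi>_def dual_space_lin linear_fun_on_def)
    show "\<exists>C. \<forall>\<phi>\<in>dual_space E. \<bar>\<Phi> \<phi>\<bar> \<le> C * dual_norm E \<phi>"
    proof (intro exI ballI)
      fix \<phi> assume \<phi>: "\<phi> \<in> dual_space E"
      have "\<phi> (u n) \<le> max 1 c * dual_norm E \<phi>" "- (max 1 c * dual_norm E \<phi>) \<le> \<phi> (u n)" for n
        using dual_norm_bound[OF \<phi> u[of n]] by auto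
      then have "L (\<lambda>n. \<phi> (u n)) \<le> max 1 c * dual_norm E \<phi>" "- (max 1 c * dual_norm E \<phi>) \<le> L (\<lambda>n. \<phi> (u n))"
        by (intro Lup Llow bs \<phi> always_eventually allI; simp)+
      then show "\<bar>\<Phi> \<phi>\<bar> \<le> max 1 c * dual_norm E \<phi>" using \<phi> by (simp add: \<Phi>_def)
    qed
  qed (simp add: \<Phi>_def)
  then obtain v0 where v0: "v0 \<in> modular_space E"
    and near: "\<And>\<phi>. \<phi> \<in> dual_space E \<Longrightarrow> \<bar>\<Phi> \<phi> - \<phi> v0\<bar> \<le> \<epsilon> * dual_norm E \<phi>"
    using refl \<epsilon>(1) unfolding reflexive_form_def by blast
  have uV: "u n \<in> modular_space E" for n using u[of n] le_less_trans by (fastforce simp: modular_E)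
  have hullV: "g \<in> modular_space E" if "g \<in> cvx_hull (range u)" for g
  proof -
    have "E g \<le> ennreal c" by (rule E_cvx_hull_le[OF that]) (use u in auto)
    then show ?thesis using le_less_trans by (fastforce simp: modular_E)
  qed
  \<comment> \<open>Otherwise a functional of norm at most 1 separates \<open>v0\<close> from the
    hull of a tail by \<open>2 * \<epsilon>\<close>; applying \<open>L\<close> contradicts the error
    \<open>\<epsilon>\<close> between \<open>\<Phi>\<close> and \<open>v0\<close>.\<close>
  have "\<exists>g. g \<in> cvx_hull (u ` {j..}) \<and> lux (\<lambda>x. g x - v0 x) < 2 * \<epsilon>" for j
  proof (rule ccontr)
    assume "\<not> ?thesis"
    then have far: "2 * \<epsilon> \<le> lux (\<lambda>x. g x - v0 x)" if "g \<in> cvx_hull (u ` {j..})" for g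
      using that not_less by blast
    define K where "K = {\<lambda>x. g x - v0 x | g. g \<in> cvx_hull (u ` {j..})}"
    have uj: "u n \<in> cvx_hull (u ` {j..})" if "n \<ge> j" for n using that by (intro cvx_hull.base) auto
    obtain \<phi> where lin: "linear_fun_on (modular_space E) \<phi>"
      and dom: "\<And>f. f \<in> modular_space E \<Longrightarrow> \<phi> f \<le> lux f" and sep: "\<And>f. f \<in> K \<Longrightarrow> 2 * \<epsilon> \<le> \<phi> f"
    proof (rule hahn_banach_separation[OF V lux_sublinear, of K "2 * \<epsilon>"])
      show "K \<subseteq> modular_space E"
        unfolding K_def using fun_subspace_diff[OF V hullV v0] cvx_hull_mono by blast
      show "K \<noteq> {}" using uj[of j] by (auto simp: K_def)
      show "(\<lambda>x. t * f x + (1 - t) * g x) \<in> K"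
        if f: "f \<in> K" and g: "g \<in> K" and t: "0 \<le> t" "t \<le> 1" for f g t
      proof -
        obtain a b where a: "a \<in> cvx_hull (u ` {j..})" "f = (\<lambda>x. a x - v0 x)"
          and b: "b \<in> cvx_hull (u ` {j..})" "g = (\<lambda>x. b x - v0 x)" using f g by (auto simp: K_def)
        have "(\<lambda>x. t * f x + (1 - t) * g x) = (\<lambda>x. (t * a x + (1 - t) * b x) - v0 x)"
          by (auto simp: a b algebra_simps)
        moreover have "(\<lambda>x. t * a x + (1 - t) * b x) \<in> cvx_hull (u ` {j..})"
          using a b t by (intro cvx_hull.step)
        ultimately show ?thesis by (auto simp: K_def)
      qed
      show "2 * \<epsilon> \<le> lux f" if "f \<in> K" for f using that far by (auto simp: K_def)
    qed blast
    let ?\<phi> = "\<lambda>f. if f \<in> modular_space E then \<phi> f else 0"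
    have d: "?\<phi> \<in> dual_space E" "dual_norm E ?\<phi> \<le> 1"
      by (rule dual_spaceI[OF lin], rule dom, assumption)+
    have "2 * \<epsilon> + \<phi> v0 \<le> ?\<phi> (u n)" if "n \<ge> j" for n
    proof -
      have "2 * \<epsilon> \<le> \<phi> (\<lambda>x. 1 * u n x + (-1) * v0 x)" using uj[OF that] by (intro sep) (auto simp: K_def)
      also have "\<dots> = 1 * \<phi> (u n) + (-1) * \<phi> v0" using lin uV v0 unfolding linear_fun_on_def by blast
      finally show ?thesis using uV by simp
    qed
    then have "2 * \<epsilon> + \<phi> v0 \<le> L (\<lambda>n. ?\<phi> (u n))"
      by (intro Llow bs d(1) eventually_sequentiallyI[of j])
    then have "2 * \<epsilon> + \<phi> v0 \<le> \<Phi> ?\<phi>" using d(1) by (simp add: \<Phi>_def)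
    moreover have "\<bar>\<Phi> ?\<phi> - ?\<phi> v0\<bar> \<le> \<epsilon> * 1"
      by (rule order_trans[OF near[OF d(1)] mult_left_mono[OF d(2)]]) (use \<epsilon>(1) in simp)
    ultimately show False using v0 \<epsilon>(1) by (simp add: abs_le_iff)
  qed
  then obtain g where g: "\<And>j. g j \<in> cvx_hull (u ` {j..})" "\<And>j. lux (\<lambda>x. g j x - v0 x) < 2 * \<epsilon>" by metis
  have gh: "g j \<in> cvx_hull (range u)" for j using g(1)[of j] by (rule cvx_hull_mono) auto
  have v0L: "v0 \<in> L2 M" using v0 form_finite_L2 by (simp add: modular_E)
  have gL: "g j \<in> L2 M" for j using hullV[OF gh[of j]] form_finite_L2 by (simp add: modular_E)
  note [measurable] = L2D(1)[OF v0L] L2D(1)[OF gL]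
  have near_g: "Ee (\<lambda>x. (g j x - v0 x) / (2 * \<epsilon>)) \<le> 1" for j
  proof -
    have "E (\<lambda>x. (g j x - v0 x) / (2 * \<epsilon>)) \<le> 1"
      by (rule lux_less_imp[OF fun_subspace_diff[OF V hullV[OF gh] v0] g(2)])
    then show ?thesis by (subst Ee_L2) (intro L2_divide L2_diff gL v0L)
  qed
  \<comment> \<open>Since \<open>g j\<close> combines only members of index at least
    \<open>j\<close>, it inherits the pointwise limit of \<open>u\<close>.\<close>
  have "AE x in M. (\<lambda>j. g j x) \<longlonglongrightarrow> v x"
    using lim
  proof eventually_elim
    case (elim x)
    show ?case
    proof (rule LIMSEQ_I)
      fix e :: real assume e: "0 < e"
      have "0 < e / 2" using e by simp
      from LIMSEQ_D[OF elim this] obtain N where N: "\<And>n. n \<ge> N \<Longrightarrow> \<bar>u n x - v x\<bar> < e / 2" by auto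
      have "norm (g j x - v x) < e" if j: "j \<ge> N" for j
      proof -
        have "\<bar>g j x - v x\<bar> \<le> e / 2"
        proof (rule cvx_hull_near[OF g(1)])
          fix s assume "s \<in> u ` {j..}"
          then obtain n where "n \<ge> j" "s = u n" by auto
          then show "\<bar>s x - v x\<bar> \<le> e / 2" using N[of n] j by simp
        qed
        then show ?thesis using e by simp
      qed
      then show "\<exists>no. \<forall>n\<ge>no. norm (g n x - v x) < e" by blast
    qed
  qed
  then have "AE x in M. (\<lambda>j. (g j x - v0 x) / (2 * \<epsilon>)) \<longlonglongrightarrow> (v x - v0 x) / (2 * \<epsilon>)"
    by eventually_elim (use \<epsilon> in \<open>intro tendsto_divide tendsto_diff tendsto_const; simp\<close>)
  then have near_v: "Ee (\<lambda>x. (v x - v0 x) / (2 * \<epsilon>)) \<le> 1" by (rule Ee_lsc[OF _ near_g, rotated]) simp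
  have "Ee (\<lambda>x. (v x - g 0 x) / (4 * \<epsilon>)) \<le> 1"
  proof -
    have "Ee (\<lambda>x. (v x - g 0 x) / (4 * \<epsilon>))
        = Ee (\<lambda>x. (1/2) * ((v x - v0 x) / (2 * \<epsilon>)) + (1 - 1/2) * (- ((g 0 x - v0 x) / (2 * \<epsilon>))))"
      using \<epsilon> by (intro arg_cong[of _ _ Ee] ext) (simp add: field_simps)
    also have "\<dots> \<le> ennreal (1/2) * Ee (\<lambda>x. (v x - v0 x) / (2 * \<epsilon>)) + ennreal (1 - 1/2) * Ee (\<lambda>x. - ((g 0 x - v0 x) / (2 * \<epsilon>)))"
      by (rule Ee_convex) auto
    also have "\<dots> \<le> ennreal (1/2) * 1 + ennreal (1 - 1/2) * 1"
      by (intro add_mono mult_left_mono near_v) (simp_all only: Ee_minus near_g zero_le)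
    also have "\<dots> = 1" by (simp add: ennreal_plus[symmetric] del: ennreal_plus ennreal_half)
    finally show ?thesis .
  qed
  note le1 = this
  have "Ee (\<lambda>x. v x - g 0 x) = Ee (\<lambda>x. (4 * \<epsilon>) * ((v x - g 0 x) / (4 * \<epsilon>)))" using \<epsilon> by simp
  also have "\<dots> \<le> ennreal (4 * \<epsilon>) * Ee (\<lambda>x. (v x - g 0 x) / (4 * \<epsilon>))"
    using \<epsilon> by (intro Ee_scale_le) auto
  also have "\<dots> \<le> ennreal (4 * \<epsilon>) * 1" by (rule mult_left_mono[OF le1]) simp
  also have "\<dots> \<le> ennreal \<delta>" using \<epsilon> by (simp add: ennreal_leI)
  finally show ?thesis using gh by (intro that)
qed

end

section \<open>Obstacle problems\<close>

lemma half_power_tendsto: "(\<lambda>n. 2 * (1/2) ^ n :: real) \<longlonglongrightarrow> 0"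
  using tendsto_mult_left[OF LIMSEQ_realpow_zero[of "1/2::real"], of 2] by simp

lemma half_power_less:
  assumes "0 < e"
  shows "\<exists>n. 2 * (1/2) ^ n < (e::real)"
  using order_tendstoD(2)[OF half_power_tendsto assms] by (auto simp: eventually_sequentially)

lemma ennreal_le_of_le_half_powers:
  fixes a b :: ennreal
  assumes "\<And>n. a \<le> b + ennreal (2 * (1/2) ^ n)"
  shows "a \<le> b"
proof (rule ennreal_le_epsilon)
  fix e :: real assume "0 < e"
  then obtain n where "2 * (1/2) ^ n < e" using half_power_less by blast
  then have "b + ennreal (2 * (1/2) ^ n) \<le> b + ennreal e" by (intro add_left_mono ennreal_leI) simp
  with assms[of n] show "a \<le> b + ennreal e" by (rule order_trans)
qed

text \<open>Cancellation in the shape needed for the obstacle problem: there \<open>b\<close> is the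
  energy of a maximum and \<open>d\<close> a finite lower bound for it.\<close>

lemma ennreal_le_of_add_le:
  fixes a b c d :: ennreal
  assumes "a + b \<le> c + d" "d \<le> b" "d < \<infinity>"
  shows "a \<le> c"
proof -
  have "a + d \<le> c + d" using add_left_mono[OF assms(2), of a] assms(1) by (rule order_trans)
  then have "d + a \<le> d + c" by (simp add: add.commute)
  then show ?thesis using assms(3) by (subst (asm) ennreal_add_left_cancel_le) auto
qed

text \<open>Members are added one at a time because submodularity compares two functions at once;
  the limit in \<open>p\<close> is the infimum of a tail.\<close>

primrec run_min :: "(nat \<Rightarrow> 'a \<Rightarrow> real) \<Rightarrow> nat \<Rightarrow> nat \<Rightarrow> 'a \<Rightarrow> real" where
  "run_min v n 0 = v n"
| "run_min v n (Suc p) = (\<lambda>x. min (run_min v n p x) (v (n + Suc p) x))"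

text \<open>The left minimum has the additional member \<open>v n\<close>; in the limit, tail infima
  increase with \<open>n\<close>.\<close>

lemma run_min_shift: "run_min v n (Suc p) x \<le> run_min v (Suc n) p x"
  by (induction p) auto

lemma run_min_ge: "(\<And>k. c \<le> v k x) \<Longrightarrow> c \<le> run_min v n p x"
  by (induction p) auto

lemma run_min_measurable: "(\<And>k. v k \<in> borel_measurable M) \<Longrightarrow> run_min v n p \<in> borel_measurable M"
  by (induction p) auto

lemma run_min_tendsto:
  assumes "\<And>k. c \<le> v k x"
  shows "(\<lambda>p. run_min v n p x) \<longlonglongrightarrow> lim (\<lambda>p. run_min v n p x)"
proof -
  have "decseq (\<lambda>p. run_min v n p x)" by (rule decseq_SucI) simp
  then obtain L where "(\<lambda>p. run_min v n p x) \<longlonglongrightarrow> L"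
    by (rule decseq_convergent[of _ c]) (auto intro: run_min_ge assms)
  then have "convergent (\<lambda>p. run_min v n p x)" by (rule convergentI)
  then show ?thesis by (simp add: convergent_LIMSEQ_iff)
qed

primrec run_max :: "(nat \<Rightarrow> 'a \<Rightarrow> real) \<Rightarrow> nat \<Rightarrow> nat \<Rightarrow> 'a \<Rightarrow> real" where
  "run_max v n 0 = v n"
| "run_max v n (Suc p) = (\<lambda>x. max (run_max v n p x) (v (n + Suc p) x))"

lemma run_max_shift: "run_max v (Suc n) p x \<le> run_max v n (Suc p) x"
  by (induction p) auto

lemma run_max_le: "(\<And>k. v k x \<le> c) \<Longrightarrow> run_max v n p x \<le> c"
  by (induction p) auto

lemma run_max_ge: "v (n + p) x \<le> run_max v n p x"
  by (cases p) auto

lemma run_max_measurable: "(\<And>k. v k \<in> borel_measurable M) \<Longrightarrow> run_max v n p \<in> borel_measurable M"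
  by (induction p) auto

lemma run_max_incseq: "incseq (\<lambda>p. run_max v n p x)"
  by (rule incseq_SucI) simp

lemma run_max_tendsto:
  assumes "\<And>k. v k x \<le> c"
  shows "(\<lambda>p. run_max v n p x) \<longlonglongrightarrow> lim (\<lambda>p. run_max v n p x)"
proof -
  obtain L where "(\<lambda>p. run_max v n p x) \<longlonglongrightarrow> L"
    by (rule incseq_convergent[OF run_max_incseq, of v n x c]) (auto intro: run_max_le assms)
  then have "convergent (\<lambda>p. run_max v n p x)" by (rule convergentI)
  then show ?thesis by (simp add: convergent_LIMSEQ_iff)
qed

locale subcritical_form = delta2_form M w E for M :: "'a measure" and w E +
  assumes subcrit: "subcritical M E"
begin

text \<open>By the doubling condition all multiples of \<open>u\<close> have energy 0, so the
  subcritical bound keeps \<open>n\<close> times the weighted integral of \<open>|u|\<close> below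
  the fixed \<open>C\<close>.\<close>

lemma Ee_kernel_trivial:
  assumes u: "Ee u = 0"
  shows "AE x in M. u x = 0"
proof -
  have [measurable]: "u \<in> borel_measurable M" using u by (intro Ee_finite_measurable) simp
  obtain \<phi> C where \<phi> [measurable]: "\<phi> \<in> borel_measurable M" and \<phi>0: "\<And>x. 0 \<le> \<phi> x"
    and \<phi>pos: "AE x in M. 0 < \<phi> x" and C: "0 \<le> C"
    and bd: "\<And>v. (\<integral>\<^sup>+x. ennreal (\<phi> x * \<bar>v x\<bar>) \<partial>M) \<le> ennreal C + Ee v"
    using subcritical_bound[OF subcrit] by blast
  define X where "X = (\<integral>\<^sup>+x. ennreal (\<phi> x * \<bar>u x\<bar>) \<partial>M)"
  have le: "ennreal (real n) * X \<le> ennreal C" for n :: nat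
  proof -
    obtain B where B: "\<And>f. Ee (\<lambda>x. real n * f x) \<le> ennreal B * Ee f" using Ee_scale_bound[of "real n"] by blast
    have "Ee (\<lambda>x. real n * u x) = 0" using B[of u] u by simp
    have "ennreal (real n) * X = (\<integral>\<^sup>+x. ennreal (real n) * ennreal (\<phi> x * \<bar>u x\<bar>) \<partial>M)"
      unfolding X_def by (rule nn_integral_cmult[symmetric]) simp
    also have "\<dots> = (\<integral>\<^sup>+x. ennreal (\<phi> x * \<bar>real n * u x\<bar>) \<partial>M)"
      using \<phi>0 by (intro nn_integral_cong) (simp add: ennreal_mult[symmetric] abs_mult mult.left_commute)
    also have "\<dots> \<le> ennreal C + Ee (\<lambda>x. real n * u x)" by (rule bd)
    finally show ?thesis using \<open>Ee (\<lambda>x. real n * u x) = 0\<close> by simp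
  qed
  have "X < top" using le[of 1] by (simp add: le_less_trans)
  then obtain r where r: "X = ennreal r" "0 \<le> r" by (cases X) auto
  have "r = 0"
  proof (rule ccontr)
    assume "r \<noteq> 0"
    then have "r > 0" using r by simp
    then obtain n where n: "C < real n * r" using ex_less_of_nat_mult by blast
    have "ennreal (real n * r) \<le> ennreal C" using le[of n] r by (simp add: ennreal_mult)
    then show False using n C by simp
  qed
  then have "(\<integral>\<^sup>+x. ennreal (\<phi> x * \<bar>u x\<bar>) \<partial>M) = 0" using r by (simp add: X_def)
  then have "AE x in M. ennreal (\<phi> x * \<bar>u x\<bar>) = 0" by (subst (asm) nn_integral_0_iff_AE) auto
  then show ?thesis using \<phi>pos
  proof eventually_elim
    case (elim x)
    then have "\<phi> x * \<bar>u x\<bar> \<le> 0" by (simp add: ennreal_eq_0_iff)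
    then show ?case using elim(2) by (simp add: mult_le_0_iff)
  qed
qed

text \<open>Monotone convergence under the subcritical bound keeps the supremum of the sequence
  finite almost everywhere.\<close>

lemma AE_convergent_of_Ee_bounded:
  assumes w [measurable]: "\<And>n. v n \<in> borel_measurable M" and bd: "\<And>n. Ee (v n) \<le> ennreal c"
    and inc: "AE x in M. incseq (\<lambda>n. v n x)" and nn: "AE x in M. 0 \<le> v 0 x"
  shows "AE x in M. (\<lambda>n. v n x) \<longlonglongrightarrow> lim (\<lambda>n. v n x)"
proof -
  obtain \<phi> C where \<phi> [measurable]: "\<phi> \<in> borel_measurable M" and \<phi>0: "\<And>x. 0 \<le> \<phi> x"
    and \<phi>pos: "AE x in M. 0 < \<phi> x" and C: "0 \<le> C"
    and sub: "\<And>v. (\<integral>\<^sup>+x. ennreal (\<phi> x * \<bar>v x\<bar>) \<partial>M) \<le> ennreal C + Ee v"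
    using subcritical_bound[OF subcrit] by blast
  have nnn: "AE x in M. \<forall>n. 0 \<le> v n x"
    using inc nn
  proof eventually_elim
    case (elim x)
    show ?case using incseqD[OF elim(1), of 0] elim(2) by (auto intro: order_trans)
  qed
  have "(\<integral>\<^sup>+x. (SUP n. ennreal (\<phi> x * \<bar>v n x\<bar>)) \<partial>M) = (SUP n. \<integral>\<^sup>+x. ennreal (\<phi> x * \<bar>v n x\<bar>) \<partial>M)"
  proof (rule nn_integral_monotone_convergence_SUP_AE)
    fix n
    show "AE x in M. ennreal (\<phi> x * \<bar>v n x\<bar>) \<le> ennreal (\<phi> x * \<bar>v (Suc n) x\<bar>)"
      using inc nnn
    proof eventually_elim
      case (elim x)
      have "v n x \<le> v (Suc n) x" using incseqD[OF elim(1), of n "Suc n"] by simp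
      then show ?case using elim(2) \<phi>0[of x] by (intro ennreal_leI mult_left_mono) auto
    qed
  qed simp
  also have "\<dots> \<le> ennreal C + ennreal c" using sub bd by (intro SUP_least) (meson add_left_mono order_trans)
  also have "\<dots> < \<infinity>" by simp
  finally have "AE x in M. (SUP n. ennreal (\<phi> x * \<bar>v n x\<bar>)) \<noteq> \<infinity>"
    by (intro nn_integral_noteq_infinite) auto
  then show ?thesis using inc nnn \<phi>pos
  proof eventually_elim
    case (elim x)
    then obtain r where r: "(SUP n. ennreal (\<phi> x * \<bar>v n x\<bar>)) = ennreal r" "0 \<le> r"
      by (cases "SUP n. ennreal (\<phi> x * \<bar>v n x\<bar>)") auto
    have "v n x \<le> r / \<phi> x" for n
    proof -
      have "ennreal (\<phi> x * \<bar>v n x\<bar>) \<le> ennreal r" unfolding r(1)[symmetric] by (rule SUP_upper) simp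
      then have "\<phi> x * v n x \<le> r" using elim r by simp
      then show ?thesis using elim by (simp add: field_simps)
    qed
    then have "\<forall>n. v n x \<le> r / \<phi> x" ..
    from incseq_convergent[OF elim(2) this] obtain L where "(\<lambda>n. v n x) \<longlonglongrightarrow> L" by blast
    then have "convergent (\<lambda>n. v n x)" by (rule convergentI)
    then show ?case by (simp add: convergent_LIMSEQ_iff)
  qed
qed

text \<open>The minimizer of the obstacle problem over \<open>\<psi>\<close> is obtained from a minimizing sequence by lattice
  operations alone: submodularity bounds the energy of the infima of its tails, and these increase.\<close>

lemma excessive_majorant:
  assumes \<psi> [measurable]: "\<psi> \<in> borel_measurable M" and nn: "AE x in M. 0 \<le> \<psi> x" and fin: "Ee \<psi> < \<infinity>"
  obtains r where "excessive M E r" "Ee r < \<infinity>" "AE x in M. \<psi> x \<le> r x"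
proof -
  define S where "S = {v \<in> borel_measurable M. AE x in M. \<psi> x \<le> v x}"
  define I where "I = (INF v\<in>S. Ee v)"
  have "I \<le> Ee \<psi>" unfolding I_def by (rule INF_lower) (simp add: S_def)
  then have Ifin: "I < \<infinity>" using fin by (rule order_le_less_trans)
  have "\<exists>v. v \<in> S \<and> Ee v < I + ennreal ((1/2) ^ k)" for k :: nat
  proof -
    have "I < I + ennreal ((1/2) ^ k)" using Ifin by (simp add: ennreal_add_left_cancel_less)
    then show ?thesis unfolding I_def INF_less_iff by blast
  qed
  then obtain v where v: "\<And>k. v k \<in> S" "\<And>k. Ee (v k) < I + ennreal ((1/2) ^ k)" by metis
  have vm [measurable]: "\<And>k. v k \<in> borel_measurable M" using v(1) by (simp add: S_def)
  note [measurable] = run_min_measurable[of v M, OF vm]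
  have v\<psi>: "AE x in M. \<forall>k. \<psi> x \<le> v k x" using v(1) by (simp add: S_def AE_all_countable)
  have mS: "run_min v n p \<in> S" for n p
  proof -
    have "AE x in M. \<psi> x \<le> run_min v n p x" using v\<psi> by eventually_elim (rule run_min_ge, blast)
    then show ?thesis by (simp add: S_def)
  qed
  \<comment> \<open>Each maximum lies above the obstacle, so its energy is at least \<open>I\<close>
    and cancels. The errors \<open>(1/2)^n + ... + (1/2)^(n+p)\<close> sum to the closed
    form.\<close>
  have mE: "Ee (run_min v n p) \<le> I + ennreal (2 * (1/2) ^ n - (1/2) ^ (n + p))" for n p
  proof (induction p)
    case 0
    show ?case using less_imp_le[OF v(2)[of n]] by simp
  next
    case (Suc p)
    let ?a = "run_min v n p" and ?b = "v (n + Suc p)"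
    have pw: "(1/2::real) ^ (n + p) \<le> (1/2) ^ n" by (intro power_decreasing) auto
    have "Ee (\<lambda>x. min (?a x) (?b x)) + Ee (\<lambda>x. max (?a x) (?b x)) \<le> Ee ?a + Ee ?b" by (rule Ee_min_max)
    also have "\<dots> \<le> (I + ennreal (2 * (1/2) ^ n - (1/2) ^ (n + p))) + (I + ennreal ((1/2) ^ (n + Suc p)))"
      by (intro add_mono Suc.IH less_imp_le[OF v(2)])
    also have "\<dots> = (I + (ennreal (2 * (1/2) ^ n - (1/2) ^ (n + p)) + ennreal ((1/2) ^ (n + Suc p)))) + I"
      by (simp add: ac_simps)
    also have "ennreal (2 * (1/2) ^ n - (1/2) ^ (n + p)) + ennreal ((1/2) ^ (n + Suc p))
        = ennreal (2 * (1/2) ^ n - (1/2) ^ (n + Suc p))"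
    proof (subst ennreal_plus[symmetric])
      show "0 \<le> 2 * (1/2) ^ n - (1/2::real) ^ (n + p)" using pw zero_le_power[of "1/2::real" n] by linarith
    qed simp_all
    finally have le: "Ee (\<lambda>x. min (?a x) (?b x)) + Ee (\<lambda>x. max (?a x) (?b x))
        \<le> (I + ennreal (2 * (1/2) ^ n - (1/2) ^ (n + Suc p))) + I" .
    have "(\<lambda>x. max (?a x) (?b x)) \<in> S"
    proof -
      have "AE x in M. \<psi> x \<le> ?a x" using mS[of n p] by (simp add: S_def)
      then have "AE x in M. \<psi> x \<le> max (?a x) (?b x)" by eventually_elim (simp add: max.coboundedI1)
      then show ?thesis by (simp add: S_def)
    qed
    then have "I \<le> Ee (\<lambda>x. max (?a x) (?b x))" unfolding I_def by (rule INF_lower)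
    from ennreal_le_of_add_le[OF le this Ifin] show ?case by simp
  qed
  define u where "u n x = lim (\<lambda>p. run_min v n p x)" for n x
  have [measurable]: "u n \<in> borel_measurable M" for n unfolding u_def by measurable
  have ulim: "AE x in M. \<forall>n. (\<lambda>p. run_min v n p x) \<longlonglongrightarrow> u n x"
    using v\<psi> unfolding u_def by eventually_elim (rule allI, rule run_min_tendsto, blast)
  have uE: "Ee (u n) \<le> I + ennreal (2 * (1/2) ^ n)" for n
  proof (rule Ee_lsc)
    show "AE x in M. (\<lambda>p. run_min v n p x) \<longlonglongrightarrow> u n x" using ulim by eventually_elim blast
    show "Ee (run_min v n p) \<le> I + ennreal (2 * (1/2) ^ n)" for p
      by (rule order_trans[OF mE]) (intro add_left_mono ennreal_leI, simp)
  qed simp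
  have u\<psi>: "AE x in M. \<forall>n. \<psi> x \<le> u n x"
    using ulim v\<psi>
  proof eventually_elim
    case (elim x)
    show ?case
    proof
      fix n
      have "(\<lambda>p. run_min v n p x) \<longlonglongrightarrow> u n x" using elim(1) by blast
      then show "\<psi> x \<le> u n x" 
        by (rule LIMSEQ_le_const) (intro exI allI impI run_min_ge, use elim(2) in blast)
    qed
  qed
  have uinc: "AE x in M. incseq (\<lambda>n. u n x)"
    using ulim
  proof eventually_elim
    case (elim x)
    show ?case
    proof (rule incseq_SucI)
      fix n
      have "(\<lambda>p. run_min v n (Suc p) x) \<longlonglongrightarrow> u n x" using elim by (intro LIMSEQ_Suc) blast
      moreover have "(\<lambda>p. run_min v (Suc n) p x) \<longlonglongrightarrow> u (Suc n) x" using elim by blast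
      ultimately show "u n x \<le> u (Suc n) x" 
        by (rule LIMSEQ_le) (intro exI allI impI run_min_shift)
    qed
  qed
  have ubd: "Ee (u n) \<le> ennreal (enn2real I + 2)" for n
  proof -
    have "Ee (u n) \<le> I + ennreal 2"
      by (rule order_trans[OF uE]) (intro add_left_mono ennreal_leI, simp add: power_le_one)
    also have "\<dots> = ennreal (enn2real I + 2)" using Ifin by (simp add: ennreal_plus)
    finally show ?thesis .
  qed
  define r where "r x = lim (\<lambda>n. u n x)" for x
  have rm [measurable]: "r \<in> borel_measurable M" unfolding r_def by measurable
  have "AE x in M. 0 \<le> u 0 x" using u\<psi> nn by eventually_elim (blast intro: order_trans)
  then have rlim: "AE x in M. (\<lambda>n. u n x) \<longlonglongrightarrow> r x"
    unfolding r_def by (intro AE_convergent_of_Ee_bounded[OF _ ubd uinc]) auto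
  have rE: "Ee r \<le> I"
  proof (rule ennreal_le_of_le_half_powers)
    fix k :: nat
    show "Ee r \<le> I + ennreal (2 * (1/2) ^ k)"
    proof (rule Ee_lsc[OF rm])
      show "AE x in M. (\<lambda>n. u (n + k) x) \<longlonglongrightarrow> r x"
        using rlim by eventually_elim (rule LIMSEQ_ignore_initial_segment)
      show "Ee (u (n + k)) \<le> I + ennreal (2 * (1/2) ^ k)" for n
        by (rule order_trans[OF uE]) (intro add_left_mono ennreal_leI mult_left_mono power_decreasing, auto)
    qed
  qed
  have r\<psi>: "AE x in M. \<psi> x \<le> r x"
    using rlim u\<psi>
  proof eventually_elim
    case (elim x)
    show ?case using elim(2) by (intro LIMSEQ_le_const[OF elim(1)]) blast
  qed
  have rfin: "Ee r < \<infinity>" using rE Ifin by (rule order_le_less_trans)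
  have "excessive M E r"
  proof (rule excessiveI[OF rm])
    show "AE x in M. 0 \<le> r x" using r\<psi> nn by eventually_elim simp
    \<comment> \<open>The maximum of \<open>f\<close> and \<open>r\<close> is admissible, so its
      energy is at least that of the minimizer \<open>r\<close>; submodularity leaves the truncation
      inequality.\<close>
    show "Ee (\<lambda>x. min (f x) (r x)) \<le> Ee f" for f
    proof (cases "Ee f < \<infinity>")
      case True
      then have [measurable]: "f \<in> borel_measurable M" by (rule Ee_finite_measurable)
      have "(\<lambda>x. max (f x) (r x)) \<in> S"
      proof -
        have "AE x in M. \<psi> x \<le> max (f x) (r x)" using r\<psi> by eventually_elim (simp add: max.coboundedI2)
        then show ?thesis by (simp add: S_def)
      qed
      then have "I \<le> Ee (\<lambda>x. max (f x) (r x))" unfolding I_def by (rule INF_lower)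
      then have "Ee r \<le> Ee (\<lambda>x. max (f x) (r x))" using rE by (rule order_trans[rotated])
      from ennreal_le_of_add_le[OF Ee_min_max this rfin] show ?thesis .
    next
      case False
      then have "Ee f = top" by (simp add: less_top[symmetric])
      then show ?thesis by simp
    qed
  qed
  then show ?thesis using rfin r\<psi> by (rule that)
qed

text \<open>Each obstacle includes the previous majorant, which forces monotonicity; multiples of
  \<open>h\<close> have finite energy by the doubling condition. The factor \<open>Suc N\<close>
  keeps even \<open>H 0\<close> above \<open>h\<close>, hence positive where \<open>h\<close>
  is.\<close>

lemma increasing_excessive_majorants:
  assumes h [measurable]: "h \<in> borel_measurable M" and nn: "AE x in M. 0 \<le> h x" and fin: "Ee h < \<infinity>"
  obtains H :: "nat \<Rightarrow> 'a \<Rightarrow> real" where "\<And>N. excessive M E (H N)" "\<And>N. Ee (H N) < \<infinity>"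
    "\<And>N. AE x in M. real (Suc N) * h x \<le> H N x" "\<And>N. AE x in M. H N x \<le> H (Suc N) x"
proof -
  have scale: "Ee (\<lambda>x. a * h x) < \<infinity>" for a
  proof -
    obtain B where "Ee (\<lambda>x. a * h x) \<le> ennreal B * Ee h" using Ee_scale_bound[of a] by blast
    also have "\<dots> < \<infinity>" using fin by (auto simp: ennreal_mult_less_top)
    finally show ?thesis .
  qed
  let ?P = "\<lambda>N r. excessive M E r \<and> Ee r < \<infinity> \<and> (AE x in M. real (Suc N) * h x \<le> r x)"
  have "\<exists>H. \<forall>N. ?P N (H N) \<and> (AE x in M. H N x \<le> H (Suc N) x)"
  proof (rule dependent_nat_choice)
    show "\<exists>r. ?P 0 r" by (rule excessive_majorant[OF h nn fin]) auto
    fix r N assume r: "?P N r"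
    let ?\<psi> = "\<lambda>x. max (real (Suc (Suc N)) * h x) (r x)"
    have [measurable]: "r \<in> borel_measurable M" using r excessiveD(1) by blast
    have "Ee ?\<psi> \<le> Ee (\<lambda>x. real (Suc (Suc N)) * h x) + Ee r" by (rule Ee_max_le)
    also have "\<dots> < \<infinity>" using r scale by (auto simp: less_top[symmetric])
    finally have \<psi>fin: "Ee ?\<psi> < \<infinity>" .
    have \<psi>nn: "AE x in M. 0 \<le> ?\<psi> x" using nn by eventually_elim (simp add: max.coboundedI1)
    have \<psi>m: "?\<psi> \<in> borel_measurable M" by measurable
    obtain r' where r': "excessive M E r'" "Ee r' < \<infinity>" "AE x in M. ?\<psi> x \<le> r' x"
      using excessive_majorant[OF \<psi>m \<psi>nn \<psi>fin] by blast
    have "AE x in M. real (Suc (Suc N)) * h x \<le> r' x" "AE x in M. r x \<le> r' x"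
      using r'(3) by (eventually_elim, simp)+
    then show "\<exists>r'. ?P (Suc N) r' \<and> (AE x in M. r x \<le> r' x)" using r' by blast
  qed
  then obtain H where "\<And>N. ?P N (H N) \<and> (AE x in M. H N x \<le> H (Suc N) x)" by blast
  then show ?thesis by (intro that[of H]) auto
qed

end

section \<open>Nests and capacities\<close>

locale nest_form = subcritical_form M w E for M :: "'a::topological_space measure" and w E +
  assumes refl: "reflexive_form E"
begin

abbreviation local_fns :: "'a set \<Rightarrow> ('a \<Rightarrow> real) set" where
  "local_fns \<equiv> local_space M (modular_space Ee)"

lemma exceptional_imp_capacity_zero:
  assumes A: "exceptional M E A" and h: "Ee h < \<infinity>"
  shows "capacity M E h A = 0"
proof -
  obtain F where nest: "is_nest M E F" and AF: "A \<subseteq> (\<Inter>n. - F n)" using A by (auto simp: exceptional_def)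
  have "capacity M E h A \<le> 0 + ennreal e" if e: "0 < e" for e :: real
  proof -
    have "h \<in> modular_space Ee" using h by (simp add: modular_Ee)
    then obtain n g where g: "g \<in> local_fns (F n)"
      and lux: "luxemburg Ee (\<lambda>x. h x - g x) < ennreal (min 1 e)"
      using nest e unfolding is_nest_def by (metis min_less_iff_conj zero_less_one)
    obtain U where U: "open U" "- F n \<subseteq> U" "AE x in M. x \<in> U \<longrightarrow> g x = 0" and gm: "g \<in> modular_space Ee"
      using g by (auto simp: local_space_def)
    \<comment> \<open>A Luxemburg distance below \<open>l\<close> gives energy at most
      \<open>l\<close> by convexity once \<open>l \<le> 1\<close>; hence the minimum with 1.\<close>
    define l where "l = min 1 e"
    have l: "0 < l" "l \<le> 1" "l \<le> e" using e by (auto simp: l_def)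
    have "Ee (\<lambda>x. (h x - g x) / l) \<le> 1"
      using Ee_scale_le lux unfolding l_def[symmetric] by (rule luxemburg_less_imp[where F = Ee])
    then have "ennreal l * Ee (\<lambda>x. (h x - g x) / l) \<le> ennreal l * 1" by (intro mult_left_mono) auto
    moreover have "Ee (\<lambda>x. l * ((h x - g x) / l)) \<le> ennreal l * Ee (\<lambda>x. (h x - g x) / l)"
      using l by (intro Ee_scale_le) auto
    ultimately have "Ee (\<lambda>x. h x - g x) \<le> ennreal l" using l by simp
    also have "\<dots> \<le> ennreal e" using l by (intro ennreal_leI)
    finally have small: "Ee (\<lambda>x. h x - g x) \<le> ennreal e" .
    have [measurable]: "h \<in> borel_measurable M" "g \<in> borel_measurable M"
      using h gm Ee_finite_measurable by (auto simp: modular_Ee)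
    have "AE x in M. x \<in> U \<longrightarrow> h x \<le> h x - g x" using U(3) by eventually_elim simp
    moreover have "A \<subseteq> U" using AF U(2) by blast
    ultimately have "capacity M E h A \<le> Ee (\<lambda>x. h x - g x)"
      unfolding capacity_def using U(1) by (intro Inf_lower) (auto intro!: exI[of _ "\<lambda>x. h x - g x"])
    then show ?thesis using small by (simp add: order_trans)
  qed
  then have "capacity M E h A \<le> 0" by (rule ennreal_le_epsilon)
  then show ?thesis by simp
qed

section \<open>Approximation by local functions, measured by energy\<close>

lemma Ee_lincomb_bound: "\<exists>D\<ge>0. \<forall>f g. Ee (\<lambda>x. a * f x + b * g x) \<le> ennreal D * (Ee f + Ee g)"
proof -
  obtain P where P: "P \<ge> 0" "\<And>f g. Ee (\<lambda>x. f x + g x) \<le> ennreal P * (Ee f + Ee g)"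
    using Ee_add_bound by blast
  obtain Q where Q: "Q \<ge> 0" "\<And>f. Ee (\<lambda>x. a * f x) \<le> ennreal Q * Ee f" using Ee_scale_bound by blast
  obtain R where R: "R \<ge> 0" "\<And>f. Ee (\<lambda>x. b * f x) \<le> ennreal R * Ee f" using Ee_scale_bound by blast
  have "Ee (\<lambda>x. a * f x + b * g x) \<le> ennreal (P * max Q R) * (Ee f + Ee g)" for f g
  proof -
    have "Ee (\<lambda>x. a * f x + b * g x) \<le> ennreal P * (Ee (\<lambda>x. a * f x) + Ee (\<lambda>x. b * g x))" by (rule P)
    also have "\<dots> \<le> ennreal P * (ennreal (max Q R) * Ee f + ennreal (max Q R) * Ee g)"
      by (intro mult_left_mono add_mono order_trans[OF Q(2)] order_trans[OF R(2)] mult_right_mono ennreal_leI) auto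
    finally show ?thesis using P(1) Q(1) by (simp add: ennreal_mult distrib_left mult.assoc)
  qed
  then show ?thesis using P Q by (intro exI[of _ "P * max Q R"]) auto
qed

text \<open>Takes the place of the triangle inequality when closeness is measured by
  \<open>Ee\<close>.\<close>

lemma Ee_lincomb_small:
  assumes \<delta>: "0 < \<delta>"
  obtains \<eta> :: real where "0 < \<eta>"
    "\<And>f g. Ee f \<le> ennreal \<eta> \<Longrightarrow> Ee g \<le> ennreal \<eta> \<Longrightarrow> Ee (\<lambda>x. a * f x + b * g x) \<le> ennreal \<delta>"
proof -
  obtain D where D: "D \<ge> 0" "\<And>f g. Ee (\<lambda>x. a * f x + b * g x) \<le> ennreal D * (Ee f + Ee g)"
    using Ee_lincomb_bound by blast
  define \<eta> where "\<eta> = \<delta> / (D + 1) / 2"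
  have \<eta>: "0 < \<eta>" using \<delta> D by (simp add: \<eta>_def)
  have "Ee (\<lambda>x. a * f x + b * g x) \<le> ennreal \<delta>" if "Ee f \<le> ennreal \<eta>" "Ee g \<le> ennreal \<eta>" for f g
  proof -
    have "Ee (\<lambda>x. a * f x + b * g x) \<le> ennreal D * (ennreal \<eta> + ennreal \<eta>)"
      by (rule order_trans[OF D(2)]) (intro mult_left_mono add_mono that, simp)
    also have "ennreal \<eta> + ennreal \<eta> = ennreal (\<eta> + \<eta>)" using \<eta> by (intro ennreal_plus[symmetric]) auto
    also have "ennreal D * ennreal (\<eta> + \<eta>) = ennreal (D * (\<eta> + \<eta>))"
      using D(1) \<eta> by (intro ennreal_mult[symmetric]) auto
    also have "\<dots> \<le> ennreal \<delta>"
    proof (rule ennreal_leI)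
      have "D * (\<eta> + \<eta>) \<le> (D + 1) * (\<eta> + \<eta>)" using \<eta> by (intro mult_right_mono) auto
      also have "\<dots> = \<delta>" unfolding \<eta>_def field_sum_of_halves using D(1) by simp
      finally show "D * (\<eta> + \<eta>) \<le> \<delta>" .
    qed
    finally show ?thesis .
  qed
  with \<eta> show ?thesis by (rule that)
qed

text \<open>The energy of the difference replaces the Luxemburg seminorm;
  \<open>is_nest_if_nest_closure\<close> translates back by means of the doubling condition.\<close>

definition nest_closure :: "(nat \<Rightarrow> 'a set) \<Rightarrow> ('a \<Rightarrow> real) set" where
  "nest_closure F = {f. Ee f < \<infinity> \<and> (\<forall>\<delta>>0. \<exists>n. \<exists>g\<in>local_fns (F n).
      Ee (\<lambda>x. f x - g x) \<le> ennreal \<delta>)}"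

lemma local_space_lin:
  assumes f: "f \<in> local_fns G" and g: "g \<in> local_fns G'"
    and sub: "G \<subseteq> H" "G' \<subseteq> H"
  shows "(\<lambda>x. a * f x + b * g x) \<in> local_fns H"
proof -
  obtain U where U: "open U" "- G \<subseteq> U" "AE x in M. x \<in> U \<longrightarrow> f x = 0" and fm: "f \<in> modular_space Ee"
    using f by (auto simp: local_space_def)
  obtain V where V: "open V" "- G' \<subseteq> V" "AE x in M. x \<in> V \<longrightarrow> g x = 0" and gm: "g \<in> modular_space Ee"
    using g by (auto simp: local_space_def)
  have "AE x in M. x \<in> U \<inter> V \<longrightarrow> a * f x + b * g x = 0" using U(3) V(3) by eventually_elim simp
  moreover have "open (U \<inter> V)" "- H \<subseteq> U \<inter> V" using U V sub by auto
  ultimately show ?thesis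
    unfolding local_space_def using fun_subspace_lin[OF modular_Ee_subspace fm gm] by blast
qed

lemma nest_closure_lin:
  assumes F: "incseq F" and f: "f \<in> nest_closure F" and g: "g \<in> nest_closure F"
  shows "(\<lambda>x. a * f x + b * g x) \<in> nest_closure F"
  unfolding nest_closure_def mem_Collect_eq
proof (intro conjI allI impI)
  show "Ee (\<lambda>x. a * f x + b * g x) < \<infinity>"
    using fun_subspace_lin[OF modular_Ee_subspace, of f g a b] f g by (simp add: modular_Ee nest_closure_def)
  fix \<delta> :: real assume "0 < \<delta>"
  then obtain \<eta> where \<eta>: "0 < \<eta>"
    and le: "\<And>f g. Ee f \<le> ennreal \<eta> \<Longrightarrow> Ee g \<le> ennreal \<eta> \<Longrightarrow> Ee (\<lambda>x. a * f x + b * g x) \<le> ennreal \<delta>"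
    using Ee_lincomb_small[of \<delta> a b] by blast
  obtain n p where p: "p \<in> local_fns (F n)" "Ee (\<lambda>x. f x - p x) \<le> ennreal \<eta>"
    using f \<eta> unfolding nest_closure_def by blast
  obtain m q where q: "q \<in> local_fns (F m)" "Ee (\<lambda>x. g x - q x) \<le> ennreal \<eta>"
    using g \<eta> unfolding nest_closure_def by blast
  have "(\<lambda>x. a * p x + b * q x) \<in> local_fns (F (max n m))"
    by (rule local_space_lin[OF p(1) q(1)]) (auto intro!: incseqD[OF F])
  moreover have "Ee (\<lambda>x. (a * f x + b * g x) - (a * p x + b * q x)) \<le> ennreal \<delta>"
    using le[OF p(2) q(2)] by (simp add: algebra_simps)
  ultimately show "\<exists>n. \<exists>r\<in>local_fns (F n). Ee (\<lambda>x. (a * f x + b * g x) - r x) \<le> ennreal \<delta>"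
    by (intro exI bexI[of _ "\<lambda>x. a * p x + b * q x"])
qed

lemma nest_closure_closed:
  assumes fin: "Ee f < \<infinity>" and near: "\<And>\<delta>. 0 < \<delta> \<Longrightarrow> \<exists>g\<in>nest_closure F. Ee (\<lambda>x. f x - g x) \<le> ennreal \<delta>"
  shows "f \<in> nest_closure F"
  unfolding nest_closure_def mem_Collect_eq
proof (intro conjI allI impI fin)
  fix \<delta> :: real assume "0 < \<delta>"
  then obtain \<eta> where \<eta>: "0 < \<eta>"
    and le: "\<And>f g. Ee f \<le> ennreal \<eta> \<Longrightarrow> Ee g \<le> ennreal \<eta> \<Longrightarrow> Ee (\<lambda>x. 1 * f x + 1 * g x) \<le> ennreal \<delta>"
    using Ee_lincomb_small[of \<delta> 1 1] by blast
  obtain g where g: "g \<in> nest_closure F" "Ee (\<lambda>x. f x - g x) \<le> ennreal \<eta>" using near[OF \<eta>] by blast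
  obtain n p where p: "p \<in> local_fns (F n)" "Ee (\<lambda>x. g x - p x) \<le> ennreal \<eta>"
    using g(1) \<eta> unfolding nest_closure_def by blast
  have "Ee (\<lambda>x. f x - p x) \<le> ennreal \<delta>" using le[OF g(2) p(2)] by simp
  then show "\<exists>n. \<exists>p\<in>local_fns (F n). Ee (\<lambda>x. f x - p x) \<le> ennreal \<delta>" using p(1) by blast
qed

lemma cvx_hull_nest_closure:
  assumes "incseq F" "f \<in> cvx_hull S" "S \<subseteq> nest_closure F"
  shows "f \<in> nest_closure F"
  using assms(2) by induction (use assms(1,3) nest_closure_lin in auto)

lemma is_nest_if_nest_closure:
  assumes "\<And>n. closed (F n)" "incseq F" and dense: "\<And>f. Ee f < \<infinity> \<Longrightarrow> f \<in> nest_closure F"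
  shows "is_nest M E F"
  unfolding is_nest_def
proof (intro conjI allI assms(1,2) ballI impI)
  fix f and \<epsilon> :: real assume f: "f \<in> modular_space Ee" and \<epsilon>: "0 < \<epsilon>"
  obtain B where B: "B \<ge> 0" "\<And>f. Ee (\<lambda>x. (1 / (\<epsilon>/2)) * f x) \<le> ennreal B * Ee f" using Ee_scale_bound by blast
  \<comment> \<open>\<open>B\<close> is the cost of scaling by \<open>2 / \<epsilon>\<close>, so
    \<open>B * \<delta> \<le> 1\<close> puts the difference into the ball of radius
    \<open>\<epsilon>/2\<close>; the half gives the strict inequality.\<close>
  define \<delta> where "\<delta> = 1 / (B + 1)"
  have "\<delta> > 0" using B by (simp add: \<delta>_def)
  moreover have "f \<in> nest_closure F" using f by (intro dense) (simp add: modular_Ee)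
  ultimately obtain n g where g: "g \<in> local_fns (F n)" "Ee (\<lambda>x. f x - g x) \<le> ennreal \<delta>"
    unfolding nest_closure_def by blast
  have "(f x - g x) / (\<epsilon>/2) = (1 / (\<epsilon>/2)) * (f x - g x)" for x by simp
  then have "Ee (\<lambda>x. (f x - g x) / (\<epsilon>/2)) \<le> ennreal B * Ee (\<lambda>x. f x - g x)"
    using B(2)[of "\<lambda>x. f x - g x"] by (simp only:)
  also have "\<dots> \<le> ennreal B * ennreal \<delta>" by (intro mult_left_mono g) simp
  also have "\<dots> = ennreal (B * \<delta>)" using B \<open>\<delta> > 0\<close> by (simp add: ennreal_mult)
  also have "\<dots> \<le> 1" using B by (simp add: \<delta>_def field_simps)
  finally have "Ee (\<lambda>x. (f x - g x) / (\<epsilon>/2)) \<le> 1" .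
  then have "luxemburg Ee (\<lambda>x. f x - g x) \<le> ennreal (\<epsilon>/2)"
    using \<epsilon> by (intro luxemburg_le[where F = Ee and f = "\<lambda>x. f x - g x"]) auto
  also have "\<dots> < ennreal \<epsilon>" using \<epsilon> by (simp add: ennreal_less_iff)
  finally show "\<exists>n. \<exists>g\<in>local_fns (F n). luxemburg Ee (\<lambda>x. f x - g x) < ennreal \<epsilon>"
    using g(1) by blast
qed

text \<open>As \<open>e\<^sub>n \<rightarrow> 0\<close>, lower semicontinuity at \<open>g\<close> bounds the energy of \<open>g \<or> e\<^sub>n\<close> from below, so
  submodularity leaves nothing for \<open>g \<and> e\<^sub>n\<close>.\<close>

lemma Ee_min_small:
  assumes g: "Ee g < \<infinity>" "AE x in M. 0 \<le> g x"
    and e: "\<And>n. Ee (e n) \<le> ennreal (2 * (1/2) ^ n)" "AE x in M. (\<lambda>n. e n x) \<longlonglongrightarrow> 0" and \<delta>: "0 < \<delta>"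
  shows "\<exists>n\<ge>N. Ee (\<lambda>x. min (g x) (e n x)) \<le> ennreal \<delta>"
proof (rule ccontr)
  assume "\<not> ?thesis"
  then have large: "ennreal \<delta> \<le> Ee (\<lambda>x. min (g x) (e n x))" if "n \<ge> N" for n
    using that by (meson le_cases)
  have gm: "g \<in> borel_measurable M" by (rule Ee_finite_measurable[OF g(1)])
  obtain c where c: "Ee g = ennreal c" "0 \<le> c" using g(1) by (cases "Ee g") auto
  have "0 < \<delta> / 2" using \<delta> by simp
  then obtain m where m: "2 * (1/2) ^ m < \<delta> / 2" using half_power_less by blast
  define k where "k = max N m"
  \<comment> \<open>From \<open>k\<close> on the energy of \<open>e n\<close> is at most
    \<open>\<delta>/2\<close>, so a minimum of energy at least \<open>\<delta>\<close> pushes that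
    of the maximum \<open>\<delta>/2\<close> below \<open>Ee g\<close>.\<close>
  have bound: "Ee (\<lambda>x. max (g x) (e n x)) + ennreal \<delta> \<le> ennreal (c + \<delta> / 2)" if n: "n \<ge> k" for n
  proof -
    have "(1/2) ^ n \<le> (1/2::real) ^ m" using n by (intro power_decreasing) (auto simp: k_def)
    then have p: "2 * (1/2) ^ n \<le> \<delta> / 2" using m by linarith
    have "Ee (\<lambda>x. max (g x) (e n x)) + ennreal \<delta> \<le> Ee (\<lambda>x. min (g x) (e n x)) + Ee (\<lambda>x. max (g x) (e n x))"
      using large[of n] n unfolding add.commute[of "Ee (\<lambda>x. max (g x) (e n x))"]
      by (intro add_right_mono) (simp add: k_def)
    also have "\<dots> \<le> Ee g + Ee (e n)" by (rule Ee_min_max)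
    also have "\<dots> \<le> ennreal c + ennreal (\<delta> / 2)"
      unfolding c(1) by (intro add_left_mono order_trans[OF e(1)] ennreal_leI p)
    also have "\<dots> = ennreal (c + \<delta> / 2)" using c \<delta> by simp
    finally show ?thesis .
  qed
  \<comment> \<open>Secures \<open>\<delta>/2 \<le> c\<close>: \<open>ennreal\<close> would truncate
    a negative \<open>c - \<delta>/2\<close> to 0.\<close>
  have "ennreal \<delta> \<le> Ee (\<lambda>x. max (g x) (e k x)) + ennreal \<delta>" by simp
  also have "\<dots> \<le> ennreal (c + \<delta> / 2)" by (rule bound) simp
  finally have "\<delta> \<le> c + \<delta> / 2" by (subst (asm) ennreal_le_iff) (use c \<delta> in auto)
  then have \<delta>c: "\<delta> / 2 \<le> c" by simp
  have "Ee (\<lambda>x. max (g x) (e (n + k) x)) \<le> ennreal (c - \<delta> / 2)" for n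
  proof (rule ennreal_le_of_add_le)
    show "Ee (\<lambda>x. max (g x) (e (n + k) x)) + ennreal \<delta> \<le> ennreal (c - \<delta> / 2) + ennreal \<delta>"
    proof -
      have "ennreal (c - \<delta> / 2) + ennreal \<delta> = ennreal (c - \<delta> / 2 + \<delta>)"
        using \<delta>c \<delta> by (intro ennreal_plus[symmetric]) auto
      also have "c - \<delta> / 2 + \<delta> = c + \<delta> / 2" by simp
      finally show ?thesis using bound[of "n + k"] by simp
    qed
  qed simp_all
  then have "Ee g \<le> ennreal (c - \<delta> / 2)"
  proof (rule Ee_lsc[OF gm])
    show "AE x in M. (\<lambda>n. max (g x) (e (n + k) x)) \<longlonglongrightarrow> g x"
      using e(2) g(2)
    proof eventually_elim
      case (elim x)
      have "(\<lambda>n. max (g x) (e (n + k) x)) \<longlonglongrightarrow> max (g x) 0"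
        by (intro tendsto_max tendsto_const LIMSEQ_ignore_initial_segment elim)
      then show ?case using elim by (simp add: max_def split: if_splits)
    qed
  qed
  then show False using c \<delta> \<delta>c by simp
qed

text \<open>All truncations lie below the one function \<open>H\<close>, so their tail suprema are
  finite, and submodularity bounds the energy of such a supremum by a geometric sum.
  \<open>N\<close> is the index from which \<open>f k\<close> dominates \<open>H\<close> on
  \<open>U k\<close>.\<close>

lemma truncated_in_nest_closure:
  assumes H: "excessive M E H"
    and f: "\<And>k. Ee (f k) \<le> ennreal ((1/2) ^ k)" and U: "\<And>k. open (U k)"
    and fU: "\<And>k. k \<ge> N \<Longrightarrow> AE x in M. x \<in> U k \<longrightarrow> H x \<le> f k x"
    and g: "Ee g < \<infinity>" "AE x in M. 0 \<le> g x" "AE x in M. g x \<le> H x"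
  shows "g \<in> nest_closure (\<lambda>n. - (\<Union>k\<in>{n..}. U k))"
proof -
  note [measurable] = excessiveD(1)[OF H] Ee_finite_measurable[OF g(1)]
  have fm [measurable]: "f k \<in> borel_measurable M" for k
    using le_less_trans[OF f[of k] ennreal_less_top] by (intro Ee_finite_measurable) simp
  \<comment> \<open>The positive part bounds the suprema below by 0, so that they decrease to a
    finite limit.\<close>
  define a where "a k x = max (min (f k x) (H x)) 0" for k x
  have am [measurable]: "a k \<in> borel_measurable M" for k unfolding a_def by measurable
  have aE: "Ee (a k) \<le> ennreal ((1/2) ^ k)" for k
    unfolding a_def by (rule order_trans[OF Ee_pos_part order_trans[OF Ee_min_excessive[OF H] f]])
  have aH: "AE x in M. \<forall>k. a k x \<le> H x"
    using excessiveD(2)[OF H] by eventually_elim (simp add: a_def)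
  have a0: "0 \<le> a k x" for k x by (simp add: a_def)
  note [measurable] = run_max_measurable[of a M, OF am]
  have sE: "Ee (run_max a n p) \<le> ennreal (2 * (1/2) ^ n - (1/2) ^ (n + p))" for n p
  proof (induction p)
    case 0 show ?case using aE[of n] by simp
  next
    case (Suc p)
    have pw: "(1/2::real) ^ (n + p) \<le> (1/2) ^ n" by (intro power_decreasing) auto
    have "Ee (run_max a n (Suc p)) \<le> Ee (run_max a n p) + Ee (a (n + Suc p))" by (simp add: Ee_max_le)
    also have "\<dots> \<le> ennreal (2 * (1/2) ^ n - (1/2) ^ (n + p)) + ennreal ((1/2) ^ (n + Suc p))"
      by (intro add_mono Suc.IH aE)
    also have "\<dots> = ennreal (2 * (1/2) ^ n - (1/2) ^ (n + Suc p))"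
    proof (subst ennreal_plus[symmetric])
      show "0 \<le> 2 * (1/2) ^ n - (1/2::real) ^ (n + p)" using pw zero_le_power[of "1/2::real" n] by linarith
    qed simp_all
    finally show ?case .
  qed
  define e where "e n x = lim (\<lambda>p. run_max a n p x)" for n x
  have em [measurable]: "e n \<in> borel_measurable M" for n unfolding e_def by measurable
  have elim: "AE x in M. \<forall>n. (\<lambda>p. run_max a n p x) \<longlonglongrightarrow> e n x"
    using aH unfolding e_def by eventually_elim (rule allI, rule run_max_tendsto, blast)
  have eE: "Ee (e n) \<le> ennreal (2 * (1/2) ^ n)" for n
  proof (rule Ee_lsc[OF em])
    show "AE x in M. (\<lambda>p. run_max a n p x) \<longlonglongrightarrow> e n x" using elim by eventually_elim blast
    show "Ee (run_max a n p) \<le> ennreal (2 * (1/2) ^ n)" for p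
      by (rule order_trans[OF sE]) (intro ennreal_leI, simp)
  qed
  have e_ge: "AE x in M. \<forall>n k. n \<le> k \<longrightarrow> a k x \<le> e n x"
    using elim
  proof eventually_elim
    case (elim x)
    show ?case
    proof (intro allI impI)
      fix n k :: nat assume "n \<le> k"
      then have "a k x \<le> run_max a n (k - n) x" using run_max_ge[of a n "k - n" x] by simp
      also have "\<dots> \<le> e n x" using elim by (intro incseq_le[OF run_max_incseq]) blast
      finally show "a k x \<le> e n x" .
    qed
  qed
  \<comment> \<open>The decreasing limit has energy 0 by semicontinuity; triviality of the kernel
    makes it 0.\<close>
  have e0: "AE x in M. (\<lambda>n. e n x) \<longlonglongrightarrow> 0"
  proof -
    define l where "l x = lim (\<lambda>n. e n x)" for x
    have lm [measurable]: "l \<in> borel_measurable M" unfolding l_def by measurable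
    have conv: "AE x in M. (\<lambda>n. e n x) \<longlonglongrightarrow> l x"
      using elim e_ge
    proof eventually_elim
      case (elim x)
      have "decseq (\<lambda>n. e n x)"
      proof (rule decseq_SucI)
        fix n
        have "(\<lambda>p. run_max a (Suc n) p x) \<longlonglongrightarrow> e (Suc n) x" using elim(1) by blast
        moreover have "(\<lambda>p. run_max a n (Suc p) x) \<longlonglongrightarrow> e n x" using elim(1) by (intro LIMSEQ_Suc) blast
        ultimately show "e (Suc n) x \<le> e n x"
          by (rule LIMSEQ_le) (intro exI allI impI run_max_shift)
      qed
      moreover have "\<forall>n. 0 \<le> e n x" using elim(2) a0 by (meson order_refl order_trans)
      ultimately obtain L where "(\<lambda>n. e n x) \<longlonglongrightarrow> L" using decseq_convergent by blast
      then have "convergent (\<lambda>n. e n x)" by (rule convergentI)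
      then show ?case unfolding l_def by (simp add: convergent_LIMSEQ_iff)
    qed
    have "Ee l \<le> 0"
    proof (rule ennreal_le_of_le_half_powers)
      fix m :: nat
      show "Ee l \<le> 0 + ennreal (2 * (1/2) ^ m)"
      proof (rule Ee_lsc[OF lm])
        show "AE x in M. (\<lambda>n. e (n + m) x) \<longlonglongrightarrow> l x"
          using conv by eventually_elim (rule LIMSEQ_ignore_initial_segment)
        have "2 * (1/2) ^ (n + m) \<le> 2 * (1/2::real) ^ m" for n
          by (intro mult_left_mono power_decreasing) auto
        then show "Ee (e (n + m)) \<le> 0 + ennreal (2 * (1/2) ^ m)" for n
          using order_trans[OF eE[of "n + m"] ennreal_leI] by simp
      qed
    qed
    then have "AE x in M. l x = 0" by (intro Ee_kernel_trivial) simp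
    with conv show ?thesis by eventually_elim simp
  qed
  \<comment> \<open>On the union some \<open>f k\<close> is above \<open>H\<close>, so
    \<open>g \<le> H \<le> e n\<close> there and \<open>g - min g (e n)\<close> vanishes.\<close>
  have eU: "AE x in M. \<forall>n\<ge>N. x \<in> (\<Union>k\<in>{n..}. U k) \<longrightarrow> H x \<le> e n x"
  proof -
    have "AE x in M. \<forall>k. k \<ge> N \<longrightarrow> x \<in> U k \<longrightarrow> H x \<le> f k x"
      using fU by (simp add: AE_all_countable)
    then show ?thesis using e_ge excessiveD(2)[OF H]
    proof eventually_elim
      case (elim x)
      show ?case
      proof (intro allI impI)
        fix n assume n: "n \<ge> N" and "x \<in> (\<Union>k\<in>{n..}. U k)"
        then obtain k where k: "k \<ge> n" "x \<in> U k" by auto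
        then have "H x \<le> f k x" using elim(1) n by auto
        then have "H x \<le> a k x" by (simp add: a_def)
        also have "\<dots> \<le> e n x" using elim(2) k by blast
        finally show "H x \<le> e n x" .
      qed
    qed
  qed
  show ?thesis
    unfolding nest_closure_def mem_Collect_eq
  proof (intro conjI allI impI g(1))
    fix \<delta> :: real assume "0 < \<delta>"
    then obtain n where n: "n \<ge> N" and small: "Ee (\<lambda>x. min (g x) (e n x)) \<le> ennreal \<delta>"
      using Ee_min_small[OF g(1,2) eE e0] by blast
    let ?V = "\<Union>k\<in>{n..}. U k" and ?l = "\<lambda>x. g x - min (g x) (e n x)"
    have "open ?V" using U by auto
    moreover have "AE x in M. x \<in> ?V \<longrightarrow> ?l x = 0"
      using eU g(3)
    proof eventually_elim
      case (elim x)
      show ?case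
      proof
        assume "x \<in> ?V"
        then have "H x \<le> e n x" using elim(1) n by blast
        then show "?l x = 0" using elim(2) by (simp add: min_def)
      qed
    qed
    moreover have "?l \<in> modular_space Ee"
      using g(1) le_less_trans[OF small ennreal_less_top]
      by (intro fun_subspace_diff[OF modular_Ee_subspace]) (simp_all add: modular_Ee)
    ultimately have "?l \<in> local_fns (- ?V)"
      unfolding local_space_def by (auto intro!: exI[of _ ?V])
    moreover have "Ee (\<lambda>x. g x - ?l x) \<le> ennreal \<delta>" using small by simp
    ultimately show "\<exists>n. \<exists>l\<in>local_fns (- (\<Union>k\<in>{n..}. U k)). Ee (\<lambda>x. g x - l x) \<le> ennreal \<delta>"
      by (intro exI bexI[of _ ?l])
  qed
qed

text \<open>One choice of \<open>f k\<close> and \<open>U k\<close> serves all levels: as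
  \<open>H\<close> increases, \<open>f k\<close> is above \<open>H N\<close> on \<open>U k\<close>
  whenever \<open>k \<ge> N\<close>. So a single nest handles every truncation.\<close>

lemma exceptional_if_small_capacities:
  assumes H: "\<And>N. excessive M E (H N)" and H_mono: "\<And>N. AE x in M. H N x \<le> H (Suc N) x"
    and H_large: "\<And>N. AE x in M. real N * h x \<le> H N x" and h: "AE x in M. 0 < h x"
    and cap: "\<And>N. capacity M E (H N) A = 0"
  shows "exceptional M E A"
proof -
  have "\<exists>f U. open U \<and> A \<subseteq> U \<and> (AE x in M. x \<in> U \<longrightarrow> H k x \<le> f x) \<and> Ee f \<le> ennreal ((1/2) ^ k)" for k
  proof -
    have "capacity M E (H k) A < ennreal ((1/2) ^ k)" by (simp add: cap)
    then obtain f U where "open U" "A \<subseteq> U" "AE x in M. x \<in> U \<longrightarrow> H k x \<le> f x" "Ee f < ennreal ((1/2) ^ k)"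
      unfolding capacity_def Inf_less_iff by auto
    then show ?thesis by (intro exI[of _ f] exI[of _ U]) auto
  qed
  then obtain f U where U: "\<And>k. open (U k)" "\<And>k. A \<subseteq> U k"
    and fU: "\<And>k. AE x in M. x \<in> U k \<longrightarrow> H k x \<le> f k x" and f: "\<And>k. Ee (f k) \<le> ennreal ((1/2) ^ k)" by metis
  note Hm [measurable] = excessiveD(1)[OF H]
  define F where "F n = - (\<Union>k\<in>{n..}. U k)" for n
  have F_closed: "closed (F n)" for n unfolding F_def using U by auto
  have F_inc: "incseq F" unfolding F_def incseq_def by fastforce
  have AF: "A \<subseteq> (\<Inter>n. - F n)" unfolding F_def using U(2) by auto
  have H_inc: "AE x in M. incseq (\<lambda>N. H N x)"
  proof -
    have "AE x in M. \<forall>N. H N x \<le> H (Suc N) x" using H_mono by (simp add: AE_all_countable)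
    then show ?thesis by eventually_elim (rule incseq_SucI, blast)
  qed
  have H0: "AE x in M. \<forall>N. 0 \<le> H N x" using excessiveD(2)[OF H] by (simp add: AE_all_countable)
  \<comment> \<open>Since \<open>h > 0\<close>, the levels eventually exceed \<open>g x\<close> and
    the truncation stops acting.\<close>
  have H_lim: "AE x in M. (\<lambda>N. min (g x) (H N x)) \<longlonglongrightarrow> g x" for g
  proof -
    have "AE x in M. \<forall>N. real N * h x \<le> H N x" using H_large by (simp add: AE_all_countable)
    then show ?thesis using h
    proof eventually_elim
      case (elim x)
      obtain k where k: "g x < real k * h x" using ex_less_of_nat_mult[OF elim(2)] by blast
      have "eventually (\<lambda>N. min (g x) (H N x) = g x) sequentially"
      proof (rule eventually_sequentiallyI)
        fix N assume "k \<le> N"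
        then have "real k * h x \<le> real N * h x" using elim(2) by (intro mult_right_mono) auto
        also have "\<dots> \<le> H N x" using elim(1) by blast
        finally show "min (g x) (H N x) = g x" using k by simp
      qed
      then show ?case by (rule tendsto_eventually)
    qed
  qed
  \<comment> \<open>For \<open>g\<close> in L2 the truncations stay in the domain of
    \<open>E\<close>, where reflexivity supplies the convex combinations.\<close>
  have nonneg: "g \<in> nest_closure F" if g: "E g < \<infinity>" "\<And>x. 0 \<le> g x" for g
  proof (rule nest_closure_closed)
    have gL: "g \<in> L2 M" by (rule form_finite_L2[OF g(1)])
    note [measurable] = L2D(1)[OF gL]
    show gfin: "Ee g < \<infinity>" using g(1) by (simp add: Ee_L2[OF gL])
    define u where "u N x = min (g x) (H N x)" for N x
    have uE: "Ee (u N) \<le> Ee g" for N unfolding u_def by (rule Ee_min_excessive[OF H])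
    have uL: "u N \<in> L2 M" for N
    proof (rule L2_dominated[OF gL])
      show "u N \<in> borel_measurable M" unfolding u_def by measurable
      show "AE x in M. \<bar>u N x\<bar> \<le> \<bar>g x\<bar>"
        using excessiveD(2)[OF H[of N]] by eventually_elim (use g(2) in \<open>auto simp: u_def min_def\<close>)
    qed
    have "u N \<in> nest_closure F" for N
      unfolding F_def
    proof (rule truncated_in_nest_closure[OF H[of N] f U(1)])
      show "Ee (u N) < \<infinity>" using uE gfin by (rule le_less_trans)
      show "AE x in M. 0 \<le> u N x"
        using excessiveD(2)[OF H[of N]] by eventually_elim (use g(2) in \<open>auto simp: u_def\<close>)
      show "AE x in M. u N x \<le> H N x" by (simp add: u_def)
      show "AE x in M. x \<in> U k \<longrightarrow> H N x \<le> f k x" if "k \<ge> N" for k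
        using fU[of k] H_inc
      proof eventually_elim
        case (elim x)
        then show ?case using incseqD[OF elim(2) that] by auto
      qed
    qed
    then have sub: "range u \<subseteq> nest_closure F" by blast
    obtain c where c: "Ee g = ennreal c" "0 \<le> c" using gfin by (cases "Ee g") auto
    fix \<delta> :: real assume \<delta>: "0 < \<delta>"
    have Eu: "E (u N) \<le> ennreal c" for N using uE[of N] by (simp add: Ee_L2[OF uL] c)
    have lim: "AE x in M. (\<lambda>N. u N x) \<longlonglongrightarrow> g x" unfolding u_def by (rule H_lim)
    obtain p where "p \<in> cvx_hull (range u)" "Ee (\<lambda>x. g x - p x) \<le> ennreal \<delta>"
      using reflexive_convex_approx[OF refl Eu L2D(1)[OF gL] lim \<delta>] by blast
    then show "\<exists>p\<in>nest_closure F. Ee (\<lambda>x. g x - p x) \<le> ennreal \<delta>"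
      using cvx_hull_nest_closure[OF F_inc _ sub] by blast
  qed
  have L2: "g \<in> nest_closure F" if g: "E g < \<infinity>" for g
  proof -
    have gL: "g \<in> L2 M" by (rule form_finite_L2[OF g])
    have pos: "E (\<lambda>x. max (k x) 0) < \<infinity>" if k: "E k < \<infinity>" for k
    proof -
      have "E (\<lambda>x. max (k x) 0) \<le> E (\<lambda>x. min (k x) 0) + E (\<lambda>x. max (k x) 0)" by simp
      also have "\<dots> \<le> E k + E (\<lambda>x. 0)" by (rule form_min_max)
      finally show ?thesis using k by (simp add: form_zero le_less_trans)
    qed
    have "(\<lambda>x. 1 * max (g x) 0 + (-1) * max (- g x) 0) \<in> nest_closure F"
      using g by (intro nest_closure_lin[OF F_inc] nonneg pos) (simp_all add: form_minus)
    moreover have "(\<lambda>x. 1 * max (g x) 0 + (-1) * max (- g x) 0) = g" by (auto simp: max_def)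
    ultimately show ?thesis by simp
  qed
  \<comment> \<open>A recovery sequence has bounded energy in L2; its convex combinations have
    finite energy \<open>E\<close> and are covered by the previous step.\<close>
  have "g \<in> nest_closure F" if g: "Ee g < \<infinity>" for g
  proof (rule nest_closure_closed[OF g])
    fix \<delta> :: real assume \<delta>: "0 < \<delta>"
    obtain c where c: "Ee g = ennreal c" "0 \<le> c" using g by (cases "Ee g") auto
    have "Ee g < ennreal (c + 1)" using c by (simp add: ennreal_less_iff)
    then obtain gs where gs: "\<And>k. gs k \<in> L2 M" "\<And>k. E (gs k) < ennreal (c + 1)" "AE x in M. (\<lambda>k. gs k x) \<longlonglongrightarrow> g x"
      using Ee_approx by blast
    obtain p where p: "p \<in> cvx_hull (range gs)" "Ee (\<lambda>x. g x - p x) \<le> ennreal \<delta>"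
      using reflexive_convex_approx[OF refl less_imp_le[OF gs(2)] Ee_finite_measurable[OF g] gs(3) \<delta>] by blast
    have "E p \<le> ennreal (c + 1)" by (rule E_cvx_hull_le[OF p(1)]) (use less_imp_le[OF gs(2)] in auto)
    then have "p \<in> nest_closure F" by (intro L2) (simp add: le_less_trans)
    with p(2) show "\<exists>p\<in>nest_closure F. Ee (\<lambda>x. g x - p x) \<le> ennreal \<delta>" by blast
  qed
  then have "is_nest M E F" by (rule is_nest_if_nest_closure[OF F_closed F_inc])
  then show ?thesis using AF unfolding exceptional_def by blast
qed

text \<open>Multiplying a competitor by \<open>a\<close> costs only a constant factor under the
  doubling condition.\<close>

lemma capacity_scale_zero:
  assumes "capacity M E h A = 0" "0 \<le> a"
  shows "capacity M E (\<lambda>x. a * h x) A = 0"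
proof -
  obtain B where B: "B \<ge> 0" "\<And>f. Ee (\<lambda>x. a * f x) \<le> ennreal B * Ee f" using Ee_scale_bound by blast
  have "capacity M E (\<lambda>x. a * h x) A \<le> 0 + ennreal e" if e: "0 < e" for e :: real
  proof -
    have "capacity M E h A < ennreal (e / (B + 1))" using assms(1) e B by simp
    then obtain f U where f [measurable]: "f \<in> borel_measurable M" and U: "open U" "A \<subseteq> U"
      and le: "AE x in M. x \<in> U \<longrightarrow> h x \<le> f x" and small: "Ee f < ennreal (e / (B + 1))"
      unfolding capacity_def Inf_less_iff by auto
    have "AE x in M. x \<in> U \<longrightarrow> a * h x \<le> a * f x"
      using le by eventually_elim (use assms(2) in \<open>auto intro: mult_left_mono\<close>)
    then have "capacity M E (\<lambda>x. a * h x) A \<le> Ee (\<lambda>x. a * f x)"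
      unfolding capacity_def using U by (intro Inf_lower) (auto intro!: exI[of _ "\<lambda>x. a * f x"])
    also have "\<dots> \<le> ennreal B * ennreal (e / (B + 1))"
      by (rule order_trans[OF B(2)]) (intro mult_left_mono less_imp_le[OF small], simp)
    also have "\<dots> = ennreal (B * (e / (B + 1)))" using B e by (intro ennreal_mult[symmetric]) auto
    also have "\<dots> \<le> ennreal e" using B e by (intro ennreal_leI) (simp add: field_simps)
    finally show ?thesis by simp
  qed
  then have "capacity M E (\<lambda>x. a * h x) A \<le> 0" by (rule ennreal_le_epsilon)
  then show ?thesis by simp
qed

end

theorem theorem5p7:
  fixes M :: "'a::t2_space measure"
    and E :: "('a \<Rightarrow> real) \<Rightarrow> ennreal"
    and h :: "'a \<Rightarrow> real"
    and A :: "'a set"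
  assumes borel: "sets M = sets borel"
    and sfin: "sigma_finite_measure M"
    and form: "nonlinear_order_preserving_form M E"
    and ext: "extended_form_exists M E"
    and refl: "reflexive_form E"
    and subcrit: "subcritical M E"
    and d2: "delta2_condition E"
    and h_exc: "excessive M E h"
    and h_dom: "h \<in> dom_ext M E"
    and h_pos: "AE x in M. 0 < h x"
  shows "(exceptional M E A \<longleftrightarrow>
            (\<forall>h'. excessive M E h' \<and> h' \<in> dom_ext M E \<and> (AE x in M. 0 < h' x)
                   \<longrightarrow> capacity M E h' A = 0))
       \<and> ((\<forall>N::nat. excessive M E (\<lambda>x. real N * h x)) \<longrightarrow>
            (exceptional M E A \<longleftrightarrow> capacity M E h A = 0))"
proof -
  obtain w :: "'a \<Rightarrow> real" where w: "w \<in> borel_measurable M" "\<And>x. 0 \<le> w x" "\<And>x. w x \<le> 1"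
    "\<And>x. x \<in> space M \<Longrightarrow> 0 < w x" "integrable M w"
    using sigma_finite_measure.obtain_weight[OF sfin] by blast
  interpret nest_form M w E
    by unfold_locales (fact w form ext d2 subcrit refl)+
  have hm: "h \<in> borel_measurable M" and hfin: "E_ext M E h < \<infinity>" using h_dom by (auto simp: dom_ext_def)
  note h0 = excessiveD(2)[OF h_exc]
  have cap: "capacity M E h' A = 0" if "exceptional M E A" "h' \<in> dom_ext M E" for h'
    using exceptional_imp_capacity_zero[OF that(1)] that(2) by (simp add: dom_ext_def)
  have exc: "exceptional M E A"
    if cap: "\<forall>h'. excessive M E h' \<and> h' \<in> dom_ext M E \<and> (AE x in M. 0 < h' x) \<longrightarrow> capacity M E h' A = 0"
  proof -
    obtain H where H: "\<And>N. excessive M E (H N)" "\<And>N. E_ext M E (H N) < \<infinity>"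
      "\<And>N. AE x in M. real (Suc N) * h x \<le> H N x" "\<And>N. AE x in M. H N x \<le> H (Suc N) x"
      using increasing_excessive_majorants[OF hm h0 hfin] by blast
    have large: "AE x in M. real N * h x \<le> H N x" for N
      using H(3)[of N] h_pos by eventually_elim (simp add: distrib_right)
    have "capacity M E (H N) A = 0" for N
    proof -
      have "AE x in M. 0 < H N x"
        using H(3)[of N] h_pos
      proof eventually_elim
        case (elim x)
        have "0 < real (Suc N) * h x" using elim(2) by simp
        then show ?case using elim(1) by linarith
      qed
      moreover have "H N \<in> dom_ext M E" using H(1,2) excessiveD(1) by (auto simp: dom_ext_def)
      ultimately show ?thesis using cap H(1) by blast
    qed
    then show ?thesis by (rule exceptional_if_small_capacities[OF H(1,4) large h_pos])
  qed
  \<comment> \<open>The multiples of \<open>h\<close> themselves are the increasing excessive levels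
    here; \<open>capacity_scale_zero\<close> supplies their capacities.\<close>
  have "exceptional M E A" if N: "\<forall>N::nat. excessive M E (\<lambda>x. real N * h x)" and c: "capacity M E h A = 0"
  proof (rule exceptional_if_small_capacities[of "\<lambda>N x. real N * h x" h A])
    show "excessive M E (\<lambda>x. real N * h x)" for N using N by blast
    show "AE x in M. real N * h x \<le> real (Suc N) * h x" for N
      using h0 by eventually_elim (simp add: distrib_right)
    show "capacity M E (\<lambda>x. real N * h x) A = 0" for N by (rule capacity_scale_zero[OF c]) simp
  qed (use h_pos in simp_all)
  then show ?thesis using cap exc h_dom by blast
qed

end
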